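(* Let $\sigma$ be a surface tension on a convex polygon $N$ with $\mathscr G=\emptyset$ (so $\det D^2\sigma=1$ in $N^\circ$), and let $\mathscr P\cup\mathscr Q=\{p_1,\dots,p_m\}$, listed counter-clockwise along $\partial N$. Let $W=L_\sigma(N^\circ)$ and let $\psi:\mathbb D\to W$ be a Riemann map. Then $U:=L_\sigma^{-1}\circ\psi$ is a harmonic homeomorphism of $\mathbb D$ onto $N^\circ$, and $$U(\zeta)=\sum_{j=1}^m p_j\,\omega(\zeta;I_j),\qquad \zeta\in\mathbb D,$$ where $I_1,\dots,I_m\subset\partial\mathbb D$ are pairwise disjoint open arcs whose closures cover $\partial\mathbb D$ and $\omega(\zeta;I)$ is the harmonic measure of $I$ in $\mathbb D$ at $\zeta$.
   Context: Surface tension: $N\subset\mathbb R^2\cong\mathbb C$ compact convex polygon with corners $\mathscr P$; $L:\partial N\to\mathbb R$ continuous, piecewise affine, admitting a convex extension; $\sigma$ the unique bounded convex solution of $\det D^2\sigma=1$ in $N^\circ$, $\sigma=L$ on $\partial N$ (here no gas points). $\mathscr Q$ = points of $\partial N\setminus\mathscr P$ where $L$ is not differentiable along $\partial N$. Lewy transform: $L_\sigma(z)=z+\nabla\sigma(z)$ for $z\in N^\circ$; it is a homeomorphism of $N^\circ$ onto a simply connected domain $W$. $\mathbb D$ is the unit disc. *)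

theory Defs
  imports "HOL-Complex_Analysis.Complex_Analysis"
begin

definition pdx :: "(complex \<Rightarrow> 'b::real_normed_vector) \<Rightarrow> complex \<Rightarrow> 'b" where
  "pdx f z = vector_derivative (\<lambda>t::real. f (z + complex_of_real t)) (at 0)"

definition pdy :: "(complex \<Rightarrow> 'b::real_normed_vector) \<Rightarrow> complex \<Rightarrow> 'b" where
  "pdy f z = vector_derivative (\<lambda>t::real. f (z + \<i> * complex_of_real t)) (at 0)"

definition C2_on :: "complex set \<Rightarrow> (complex \<Rightarrow> real) \<Rightarrow> bool" where
  "C2_on S f \<longleftrightarrow> open S \<and>
     (\<forall>z\<in>S. f differentiable (at z) \<and> pdx f differentiable (at z) \<and> pdy f differentiable (at z)) \<and>
     continuous_on S (pdx (pdx f)) \<and> continuous_on S (pdy (pdy f)) \<and>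
     continuous_on S (pdx (pdy f)) \<and> continuous_on S (pdy (pdx f))"

definition harmonic_real_on :: "complex set \<Rightarrow> (complex \<Rightarrow> real) \<Rightarrow> bool" where
  "harmonic_real_on S u \<longleftrightarrow> C2_on S u \<and> (\<forall>z\<in>S. pdx (pdx u) z + pdy (pdy u) z = 0)"

definition harmonic_on :: "complex set \<Rightarrow> (complex \<Rightarrow> complex) \<Rightarrow> bool" where
  "harmonic_on S U \<longleftrightarrow> harmonic_real_on S (\<lambda>z. Re (U z)) \<and> harmonic_real_on S (\<lambda>z. Im (U z))"

definition hess_det :: "(complex \<Rightarrow> real) \<Rightarrow> complex \<Rightarrow> real" where
  "hess_det f z = pdx (pdx f) z * pdy (pdy f) z - pdx (pdy f) z * pdy (pdx f) z"

definition grad :: "(complex \<Rightarrow> real) \<Rightarrow> complex \<Rightarrow> complex" where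
  "grad f z = Complex (pdx f z) (pdy f z)"

definition lewy :: "(complex \<Rightarrow> real) \<Rightarrow> complex \<Rightarrow> complex" where
  "lewy \<sigma> z = z + grad \<sigma> z"

definition convex_polygon :: "complex set \<Rightarrow> bool" where
  "convex_polygon N \<longleftrightarrow> polytope N \<and> interior N \<noteq> {}"

definition corners :: "complex set \<Rightarrow> complex set" where
  "corners N = {x. x extreme_point_of N}"

definition affine_on_segment :: "(complex \<Rightarrow> real) \<Rightarrow> complex \<Rightarrow> complex \<Rightarrow> bool" where
  "affine_on_segment L a b \<longleftrightarrow>
     (\<forall>t\<in>{0..1}. L ((1 - complex_of_real t) * a + complex_of_real t * b) = (1 - t) * L a + t * L b)"

definition piecewise_affine_boundary :: "complex set \<Rightarrow> (complex \<Rightarrow> real) \<Rightarrow> bool" where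
  "piecewise_affine_boundary N L \<longleftrightarrow>
     (\<exists>F. finite F \<and> F \<subseteq> frontier N \<and>
        (\<forall>a b. closed_segment a b \<subseteq> frontier N \<and> open_segment a b \<inter> (F \<union> corners N) = {}
               \<longrightarrow> affine_on_segment L a b))"

definition admissible_boundary :: "complex set \<Rightarrow> (complex \<Rightarrow> real) \<Rightarrow> bool" where
  "admissible_boundary N L \<longleftrightarrow> continuous_on (frontier N) L \<and> piecewise_affine_boundary N L \<and>
     (\<exists>f. convex_on N f \<and> (\<forall>x\<in>frontier N. f x = L x))"

definition nondiff_points :: "complex set \<Rightarrow> (complex \<Rightarrow> real) \<Rightarrow> complex set" where
  "nondiff_points N L = {q \<in> frontier N - corners N.
     \<not> (\<exists>v e. v \<noteq> 0 \<and> e > 0 \<and> (\<forall>t::real. \<bar>t\<bar> < e \<longrightarrow> q + complex_of_real t * v \<in> frontier N) \<and>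
             (\<lambda>t::real. L (q + complex_of_real t * v)) differentiable (at 0))}"

text \<open>Surface tension without gas points: the bounded convex classical solution of
  det D^2 sigma = 1 in the interior with sigma = L on the boundary.\<close>
definition surface_tension :: "complex set \<Rightarrow> (complex \<Rightarrow> real) \<Rightarrow> (complex \<Rightarrow> real) \<Rightarrow> bool" where
  "surface_tension N L \<sigma> \<longleftrightarrow> convex_on N \<sigma> \<and> continuous_on N \<sigma> \<and> bounded (\<sigma> ` N) \<and>
     (\<forall>x\<in>frontier N. \<sigma> x = L x) \<and> C2_on (interior N) \<sigma> \<and>
     (\<forall>z\<in>interior N. hess_det \<sigma> z = 1)"

definition ccw_listing :: "complex set \<Rightarrow> (nat \<Rightarrow> complex) \<Rightarrow> nat \<Rightarrow> complex set \<Rightarrow> bool" where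
  "ccw_listing N p m A \<longleftrightarrow> inj_on p {1..m} \<and> p ` {1..m} = A \<and>
     (\<exists>c\<in>interior N. \<exists>\<theta>::nat \<Rightarrow> real.
        (\<forall>j\<in>{1..m}. \<forall>k\<in>{1..m}. j < k \<longrightarrow> \<theta> j < \<theta> k) \<and> \<theta> m < \<theta> 1 + 2 * pi \<and>
        (\<forall>j\<in>{1..m}. p j = c + complex_of_real (cmod (p j - c)) * cis (\<theta> j)))"

definition open_arc :: "real \<Rightarrow> real \<Rightarrow> complex set" where
  "open_arc a b = {cis t | t. a < t \<and> t < b}"

definition harmonic_measure_disc :: "complex \<Rightarrow> complex set \<Rightarrow> real" where
  "harmonic_measure_disc \<zeta> I =
     (1 / (2 * pi)) * integral {0..2*pi}
        (\<lambda>t. indicator I (cis t) * (1 - (cmod \<zeta>)\<^sup>2) / (cmod (cis t - \<zeta>))\<^sup>2)"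

end

(* The inverse F of the Lewy transform is harmonic: its derivative (I + D^2 sigma)^(-1) is
   symmetric with trace 1, so 2 F - id is antiholomorphic, and U = (psi + cnj psi2) / 2 with
   grad sigma (U) = (psi - cnj psi2) / 2.
   Near a boundary point outside P and Q the function sigma is affine along the edge and, by a
   barrier, infinitely steep across it.  Hence W contains a half-strip over that point, and the
   inverse Riemann map sends this half-strip to a single point of the circle: its derivative
   along the strip is dominated by that of a bounded monotone function, the Legendre transform.
   These landing points form a set E of at most m points.  Off E all cluster values of U lie in
   the finite set P Un Q, so U has a locally constant boundary function, and the Poisson formula
   represents U by its values on the at most m arcs of the complement of E.  Every element of
   P Un Q is such a value: for a corner because U is onto; for a kink because otherwise the
   tangential component of grad sigma (U), which is the harmonic conjugate of the normal component
   of U, would be continuous at a landing point where it has to take both slopes of L.  By counting,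
   each value belongs to exactly one arc. *)

theory Submission
  imports Defs
begin

section \<open>Derivative bounds and the Poisson formula\<close>

text \<open>Nothing is known in advance about the boundary behaviour of \<psi>, and W is unbounded.
  Boundary information is therefore read off from the side of N, whose boundary is explicit: limits
  of \<open>G\<close>, the inverse of \<open>U\<close>, are established before limits of
  \<open>U\<close>. The estimates come from convexity, since \<open>lewy_inv w\<close> is the
  minimiser over N of the energy \<sigma>(z) + |z|^2/2 - w \<bullet> z. If w has normal coordinate X
  in the strip over an edge, this minimiser has depth O(1/X) below the edge. Harnack and
  Schwarz-Pick bound the derivative of the inverse Riemann map by that depth, but 1/X is not
  integrable; integrability along the strip comes from the depth being the X-derivative of a bounded
  monotone function. The equation det = 1 enters as an inequality for the steepness at the edges and
  as an exact value for the antiholomorphic part. Corners and kinks differ: a missed corner would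
  contradict surjectivity at once, whereas the two sides of an edge at a kink could land at the same
  point of the circle without any trace in the image of U. Only the jump of the slope of L rules
  this out.\<close>

lemma norm_diff_less_norm_add_cnj:
  assumes "Re a > 0" "Re b > 0"
  shows "cmod (a - b) < cmod (a + cnj b)"
proof -
  have "(cmod (a + cnj b))\<^sup>2 - (cmod (a - b))\<^sup>2 = 4 * Re a * Re b"
    unfolding cmod_power2 by (simp add: power2_eq_square algebra_simps)
  moreover have "4 * Re a * Re b > 0" using assms by simp
  ultimately have "(cmod (a - b))\<^sup>2 < (cmod (a + cnj b))\<^sup>2" by linarith
  then show ?thesis
    by (simp add: power_less_imp_less_base)
qed

lemma norm_mult_less_one:
  fixes a b :: complex
  assumes "cmod a < 1" "cmod b \<le> 1" shows "cmod (a * b) < 1"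
  using mult_left_le[OF assms(2) norm_ge_zero[of a]] assms(1) by (simp add: norm_mult)

text \<open>Schwarz-Pick at the centre of a disc, for maps into the right half-plane. It serves
  twice, for the inverse Riemann map and for the holomorphic function with real part
  \<open>n \<bullet> U\<close>: a small real part forces a small derivative.\<close>

lemma norm_deriv_le_Re:
  assumes f: "f holomorphic_on ball z r" and r: "r > 0"
    and pos: "\<And>u. u \<in> ball z r \<Longrightarrow> Re (f u) > 0"
  shows "cmod (deriv f z) \<le> 2 * Re (f z) / r"
proof -
  \<comment> \<open>The Cayley transform of the half-plane centred at \<open>f z\<close>,
    precomposed with the affine map of the unit disc onto \<open>ball z r\<close>; it sends 0 to 0,
    so the Schwarz lemma applies.\<close>
  define q where "q = (\<lambda>u. (f (z + of_real r * u) - f z) / (f (z + of_real r * u) + cnj (f z)))"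
  have inb: "z + of_real r * u \<in> ball z r" if "cmod u < 1" for u
    using that r by (simp add: dist_norm norm_mult)
  have fz: "Re (f z) > 0" using pos r by simp
  have nz: "f (z + of_real r * u) + cnj (f z) \<noteq> 0" if "cmod u < 1" for u
    using norm_diff_less_norm_add_cnj[OF pos[OF inb[OF that]] fz] by auto
  have hol: "(\<lambda>u. f (z + of_real r * u)) holomorphic_on ball 0 1"
  proof -
    have "f \<circ> (\<lambda>u. z + of_real r * u) holomorphic_on ball 0 1"
      by (rule holomorphic_on_compose_gen[OF _ f]) (auto intro!: holomorphic_intros inb)
    then show ?thesis by (simp add: o_def)
  qed
  have holq: "q holomorphic_on ball 0 1"
    unfolding q_def using hol nz by (intro holomorphic_intros) auto
  have "cmod (deriv q 0) \<le> 1"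
  proof (rule Schwarz_Lemma(2)[OF holq, of 0])
    show "q 0 = 0" by (simp add: q_def)
    fix u :: complex assume u: "cmod u < 1"
    show "cmod (q u) < 1"
      using norm_diff_less_norm_add_cnj[OF pos[OF inb[OF u]] fz]
      by (simp add: q_def norm_divide divide_less_eq)
  qed simp
  moreover have "deriv q 0 = of_real r * deriv f z / (2 * of_real (Re (f z)))"
  proof -
    have df: "(f has_field_derivative deriv f z) (at z)"
      using f r by (auto intro!: holomorphic_derivI[where S="ball z r"])
    have 1: "((\<lambda>u. f (z + of_real r * u)) has_field_derivative deriv f z * of_real r) (at 0)"
      by (rule DERIV_chain2[where f=f]) (use df in \<open>auto intro!: derivative_eq_intros\<close>)
    have cc: "f z + cnj (f z) = 2 * of_real (Re (f z))" by (simp add: complex_eq_iff)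
    have nz0: "f z + cnj (f z) \<noteq> 0" using fz by (simp add: cc)
    have "(q has_field_derivative deriv f z * of_real r / (f z + cnj (f z))) (at 0)"
      unfolding q_def
      by (rule derivative_eq_intros 1 refl | simp add: nz0)+
    then show ?thesis using DERIV_imp_deriv by (simp add: cc mult.commute)
  qed
  ultimately show ?thesis
    using r fz by (simp add: norm_divide norm_mult field_simps)
qed

section \<open>Parametrisation of the circle and Poisson integrals\<close>

lemma cis_eq_cis_iff: "cis a = cis b \<longleftrightarrow> (\<exists>k::int. a = b + 2 * pi * of_int k)"
  using sin_cos_eq_iff[of a b] by (auto simp: cis.ctr)

lemma inj_on_cis: "inj_on cis {a..<a + 2 * pi}"
proof (rule inj_onI)
  fix x y assume x: "x \<in> {a..<a + 2 * pi}" and y: "y \<in> {a..<a + 2 * pi}" and "cis x = cis y"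
  then obtain k :: int where k: "x = y + 2 * pi * of_int k" by (auto simp: cis_eq_cis_iff)
  have "x < a + 2 * pi" "a \<le> x" "y < a + 2 * pi" "a \<le> y" using x y by auto
  then have "2 * pi * of_int k < 2 * pi * 1" "2 * pi * (- 1) < 2 * pi * of_int k"
    using k by linarith+
  then have "of_int k < (1::real)" "(- 1::real) < of_int k"
    by (simp_all only: mult_less_cancel_left_pos pi_gt_zero zero_less_mult_iff zero_less_numeral simp_thms)
  then have "k = 0" by linarith
  then show "x = y" using k by simp
qed

text \<open>The interval is closed, while \<open>cis\<close> is injective only on the half-open one,
  so the right end point is added by hand. In this way a finite exceptional set on the circle
  becomes a finite set of parameters, which integrals ignore.\<close>

lemma finite_cis_vimage:
  assumes "finite E" shows "finite {t \<in> {a..a + 2 * pi}. cis t \<in> E}"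
proof -
  have "finite {t \<in> {a..<a + 2*pi}. cis t \<in> E}"
    using finite_vimage_IntI[OF assms inj_on_cis[of a]] by (simp add: vimage_def Int_def conj_commute)
  moreover have "{t \<in> {a..a + 2 * pi}. cis t \<in> E} \<subseteq> insert (a + 2*pi) {t \<in> {a..<a + 2*pi}. cis t \<in> E}"
    by auto
  ultimately show ?thesis by (meson finite.insertI finite_subset)
qed

text \<open>Normalised to total mass 2 pi: it is the integrand of
  \<open>harmonic_measure_disc\<close>, whose factor 1/(2 pi) stands outside the integral.\<close>

definition poisson_kernel :: "complex \<Rightarrow> real \<Rightarrow> real" where
  "poisson_kernel \<zeta> t = (1 - (cmod \<zeta>)\<^sup>2) / (cmod (cis t - \<zeta>))\<^sup>2"

lemma cis_neq_in_disc: "cmod \<zeta> < 1 \<Longrightarrow> cis t \<noteq> \<zeta>"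
  by (metis norm_cis less_irrefl)

lemma poisson_kernel_nonneg: "cmod \<zeta> < 1 \<Longrightarrow> poisson_kernel \<zeta> t \<ge> 0"
  by (simp add: poisson_kernel_def abs_square_le_1)

lemma continuous_on_poisson_kernel: "cmod \<zeta> < 1 \<Longrightarrow> continuous_on A (poisson_kernel \<zeta>)"
  unfolding poisson_kernel_def using cis_neq_in_disc[of \<zeta>]
  by (intro continuous_intros) auto

text \<open>Cauchy's formula on the unit circle for a modified function. The dilation by r < 1 is
  needed because f is given on the open disc only.\<close>

lemma poisson_integral_holomorphic:
  assumes f: "f holomorphic_on ball 0 1" and r: "0 < r" "r < 1" and z: "cmod \<zeta> < 1"
  shows "((\<lambda>t. f (of_real r * cis t) * of_real (poisson_kernel \<zeta> t)) has_integral
           (2 * of_real pi * f (of_real r * \<zeta>))) {0..2*pi}"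
proof -
  \<comment> \<open>The factor multiplying \<open>f\<close> is 1 at \<zeta> and converts the Cauchy
    kernel into the Poisson kernel on the circle.\<close>
  define G where "G = (\<lambda>z. f (of_real r * z) * (1 - of_real ((cmod \<zeta>)\<^sup>2)) / (1 - cnj \<zeta> * z))"
  have nz: "1 - cnj \<zeta> * z \<noteq> 0" if "cmod z \<le> 1" for z
  proof -
    have "cmod (cnj \<zeta> * z) < 1"
      by (rule norm_mult_less_one) (use z that in auto)
    then show ?thesis by auto
  qed
  have "f \<circ> (\<lambda>z::complex. of_real r * z) holomorphic_on cball 0 1"
  proof (rule holomorphic_on_compose_gen[OF _ f])
    show "(\<lambda>z::complex. of_real r * z) ` cball 0 1 \<subseteq> ball 0 1"
      using norm_mult_less_one[of "of_real r"] r by auto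
  qed (intro holomorphic_intros)
  then have hol: "G holomorphic_on cball 0 1"
    unfolding G_def o_def using nz by (intro holomorphic_intros) auto
  have "((\<lambda>u. G u / (u - \<zeta>)) has_contour_integral (2 * of_real pi * \<i> * G \<zeta>)) (circlepath 0 1)"
    by (rule Cauchy_integral_circlepath_simple[OF hol]) (use z in auto)
  then have I: "((\<lambda>t. G (cis t) / (cis t - \<zeta>) * \<i> * cis t) has_integral
      (2 * of_real pi * \<i> * G \<zeta>)) {0..2*pi}"
    unfolding circlepath_def using has_contour_integral_part_circlepath_iff[of 0 "2*pi" "\<lambda>u. G u / (u - \<zeta>)" _ 0 1]
    by simp
  have "\<zeta> * cnj \<zeta> = of_real ((cmod \<zeta>)\<^sup>2)" by (simp add: complex_norm_square[symmetric])
  then have Gz: "G \<zeta> = f (of_real r * \<zeta>)"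
    unfolding G_def using nz[of \<zeta>] z by (simp add: mult.commute)
  have eq: "- \<i> * (G (cis t) / (cis t - \<zeta>) * \<i> * cis t) = f (of_real r * cis t) * of_real (poisson_kernel \<zeta> t)" for t
  proof -
    have c: "cis t - \<zeta> \<noteq> 0" using cis_neq_in_disc[OF z] by simp
    have c1: "cis t * cnj (cis t) = 1" by (simp add: complex_norm_square[symmetric])
    \<comment> \<open>On the unit circle \<open>1 - cnj \<zeta> * cis t\<close> is
      \<open>cis t\<close> times the conjugate of \<open>cis t - \<zeta>\<close>.\<close>
    have c2: "(cis t - \<zeta>) * (1 - cnj \<zeta> * cis t) = cis t * of_real ((cmod (cis t - \<zeta>))\<^sup>2)"
    proof -
      have "cis t * of_real ((cmod (cis t - \<zeta>))\<^sup>2) = cis t * ((cis t - \<zeta>) * cnj (cis t - \<zeta>))"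
        by (simp only: complex_norm_square)
      also have "\<dots> = (cis t - \<zeta>) * (cis t * cnj (cis t) - cnj \<zeta> * cis t)"
        by (simp add: algebra_simps)
      finally show ?thesis by (simp add: c1)
    qed
    have "- \<i> * (G (cis t) / (cis t - \<zeta>) * \<i> * cis t) =
      f (of_real r * cis t) * (1 - of_real ((cmod \<zeta>)\<^sup>2)) * cis t / ((cis t - \<zeta>) * (1 - cnj \<zeta> * cis t))"
      unfolding G_def using c nz[of "cis t"] by (simp add: field_simps)
    also have "\<dots> = f (of_real r * cis t) * (1 - of_real ((cmod \<zeta>)\<^sup>2)) / of_real ((cmod (cis t - \<zeta>))\<^sup>2)"
      unfolding c2 using c by simp
    finally show ?thesis by (simp add: poisson_kernel_def)
  qed
  have "((\<lambda>t. - \<i> * (G (cis t) / (cis t - \<zeta>) * \<i> * cis t)) has_integral (- \<i> * (2 * of_real pi * \<i> * G \<zeta>))) {0..2*pi}"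
    by (rule has_integral_mult_right[OF I])
  moreover have "- \<i> * (2 * of_real pi * \<i> * G \<zeta>) = 2 * of_real pi * f (of_real r * \<zeta>)"
    by (simp add: Gz field_simps)
  ultimately show ?thesis unfolding eq by (simp only:)
qed

lemma poisson_integral_harmonic:
  assumes f1: "f1 holomorphic_on ball 0 1" and f2: "f2 holomorphic_on ball 0 1"
    and r: "0 < r" "r < 1" and z: "cmod \<zeta> < 1"
    and U: "\<And>\<zeta>. cmod \<zeta> < 1 \<Longrightarrow> U \<zeta> = (f1 \<zeta> + cnj (f2 \<zeta>)) / 2"
  shows "((\<lambda>t. U (of_real r * cis t) * of_real (poisson_kernel \<zeta> t)) has_integral
           (2 * of_real pi * U (of_real r * \<zeta>))) {0..2*pi}"
proof -
  have 1: "((\<lambda>t. f1 (of_real r * cis t) * of_real (poisson_kernel \<zeta> t)) has_integral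
           (2 * of_real pi * f1 (of_real r * \<zeta>))) {0..2*pi}"
    by (rule poisson_integral_holomorphic[OF f1 r z])
  have 2: "((\<lambda>t. cnj (f2 (of_real r * cis t) * of_real (poisson_kernel \<zeta> t))) has_integral
           cnj (2 * of_real pi * f2 (of_real r * \<zeta>))) {0..2*pi}"
    by (rule has_integral_linear[OF poisson_integral_holomorphic[OF f2 r z] bounded_linear_cnj, unfolded o_def])
  have rz: "cmod (of_real r * \<zeta>) < 1"
    using norm_mult_less_one[of "of_real r" \<zeta>] r z by simp
  have rc: "cmod (of_real r * cis t) < 1" for t using r by (simp add: norm_mult)
  have "((\<lambda>t. (1/2) * (f1 (of_real r * cis t) * of_real (poisson_kernel \<zeta> t) +
      cnj (f2 (of_real r * cis t) * of_real (poisson_kernel \<zeta> t)))) has_integral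
      (1/2) * (2 * of_real pi * f1 (of_real r * \<zeta>) + cnj (2 * of_real pi * f2 (of_real r * \<zeta>)))) {0..2*pi}"
    by (intro has_integral_mult_right has_integral_add 1 2)
  moreover have "(1/2) * (f1 (of_real r * cis t) * of_real (poisson_kernel \<zeta> t) +
      cnj (f2 (of_real r * cis t) * of_real (poisson_kernel \<zeta> t))) =
      U (of_real r * cis t) * of_real (poisson_kernel \<zeta> t)" for t
    unfolding U[OF rc] by (simp add: field_simps)
  moreover have "(1/2) * (2 * of_real pi * f1 (of_real r * \<zeta>) + cnj (2 * of_real pi * f2 (of_real r * \<zeta>)))
      = 2 * of_real pi * U (of_real r * \<zeta>)"
    unfolding U[OF rz] by (simp add: field_simps)
  ultimately show ?thesis by (simp only:)
qed

lemma poisson_kernel_has_integral: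
  assumes "cmod \<zeta> < 1" shows "(poisson_kernel \<zeta> has_integral (2 * pi)) {0..2*pi}"
proof -
  have "((\<lambda>t. (\<lambda>_. 1) (of_real (1/2) * cis t) * of_real (poisson_kernel \<zeta> t)) has_integral
           (2 * of_real pi * (1::complex))) {0..2*pi}"
    using poisson_integral_holomorphic[of "\<lambda>_. 1" "1/2" \<zeta>] assms by simp
  from has_integral_linear[OF this bounded_linear_Re] show ?thesis by (simp add: o_def)
qed

text \<open>The formula holds for the dilates of U by r < 1. Boundedness of U gives the majorant B
  times the kernel, so dominated convergence applies as r tends to 1 and the boundary limit may fail
  at finitely many points.\<close>

lemma poisson_representation:
  assumes f1: "f1 holomorphic_on ball 0 1" and f2: "f2 holomorphic_on ball 0 1"
    and z: "cmod \<zeta> < 1"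
    and U: "\<And>\<zeta>. cmod \<zeta> < 1 \<Longrightarrow> U \<zeta> = (f1 \<zeta> + cnj (f2 \<zeta>)) / 2"
    and bdd: "\<And>\<zeta>. cmod \<zeta> < 1 \<Longrightarrow> cmod (U \<zeta>) \<le> B"
    and E: "finite E"
    and lim: "\<And>x. x \<in> sphere 0 1 - E \<Longrightarrow> (U \<longlongrightarrow> u x) (at x within ball 0 1)"
  shows "((\<lambda>t. u (cis t) * of_real (poisson_kernel \<zeta> t)) has_integral
           (2 * of_real pi * U \<zeta>)) {0..2*pi}"
proof -
  define r where "r = (\<lambda>k::nat. 1 - 1 / (real k + 2))"
  have r: "0 < r k" "r k < 1" for k by (auto simp: r_def field_simps)
  have rl: "r \<longlonglongrightarrow> 1"
    unfolding r_def by real_asymp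
  define T where "T = {t \<in> {0..0 + 2 * pi}. cis t \<in> E}"
  have finT: "finite T" unfolding T_def by (rule finite_cis_vimage[OF E])
  \<comment> \<open>At the exceptional parameters no convergence is known; both integrands are put
    to 0 there, which gives pointwise convergence everywhere and changes no integral.\<close>
  define F where "F = (\<lambda>k t. if t \<in> T then 0 else U (of_real (r k) * cis t) * of_real (poisson_kernel \<zeta> t))"
  define G where "G = (\<lambda>t. if t \<in> T then 0 else u (cis t) * of_real (poisson_kernel \<zeta> t))"
  have Bpos: "B \<ge> 0" using order_trans[OF norm_ge_zero bdd[of 0]] by simp
  have 1: "(F k has_integral (2 * of_real pi * U (of_real (r k) * \<zeta>))) {0..2*pi}" for k
    by (rule has_integral_spike_finite[OF finT _ poisson_integral_harmonic[OF f1 f2 r[of k] z U]])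
       (auto simp: F_def)
  have 2: "(\<lambda>k. F k t) \<longlonglongrightarrow> G t" if "t \<in> {0..2*pi}" for t
  proof (cases "t \<in> T")
    case False
    then have x: "cis t \<in> sphere 0 1 - E" using that by (auto simp: T_def)
    have "(\<lambda>k. U (of_real (r k) * cis t)) \<longlonglongrightarrow> u (cis t)"
    proof (rule filterlim_compose[OF lim[OF x]])
      have "(\<lambda>k. of_real (r k) * cis t) \<longlonglongrightarrow> of_real 1 * cis t"
        by (intro tendsto_intros rl)
      moreover have "of_real (r k) * cis t \<in> ball 0 1" "of_real (r k) * cis t \<noteq> cis t" for k
        using r[of k] by (auto simp: norm_mult)
      ultimately show "filterlim (\<lambda>k. of_real (r k) * cis t) (at (cis t) within ball 0 1) sequentially"
        by (auto simp: filterlim_at)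
    qed
    then show ?thesis using False by (auto simp: F_def G_def intro!: tendsto_intros)
  qed (auto simp: F_def G_def)
  have bF: "norm (F k t) \<le> B * poisson_kernel \<zeta> t" if "t \<in> {0..2*pi}" for k t
  proof -
    have "cmod (U (of_real (r k) * cis t)) \<le> B"
      by (rule bdd) (use r[of k] in \<open>simp add: norm_mult\<close>)
    then show ?thesis
      using poisson_kernel_nonneg[OF z, of t] Bpos
      by (auto simp: F_def norm_mult intro!: mult_right_mono)
  qed
  have iF: "F k integrable_on {0..2*pi}" for k using 1 by blast
  have ih: "(\<lambda>t. B * poisson_kernel \<zeta> t) integrable_on {0..2*pi}"
    using poisson_kernel_has_integral[OF z] has_integral_mult_right by blast
  note dc = dominated_convergence[of F "{0..2*pi}" "\<lambda>t. B * poisson_kernel \<zeta> t" G, OF iF ih bF 2]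
  have "(\<lambda>k. integral {0..2*pi} (F k)) \<longlonglongrightarrow> 2 * of_real pi * U \<zeta>"
  proof -
    have "isCont f1 \<zeta>" "isCont f2 \<zeta>"
      using f1 f2 z by (auto intro!: holomorphic_on_imp_continuous_on[THEN continuous_on_interior] simp: interior_open)
    moreover have "(\<lambda>k. of_real (r k) * \<zeta>) \<longlonglongrightarrow> of_real 1 * \<zeta>"
      by (intro tendsto_intros rl)
    ultimately have "(\<lambda>k. (f1 (of_real (r k) * \<zeta>) + cnj (f2 (of_real (r k) * \<zeta>))) / 2) \<longlonglongrightarrow> (f1 \<zeta> + cnj (f2 \<zeta>)) / 2"
      by (auto intro!: tendsto_intros isCont_tendsto_compose[where g=f1] isCont_tendsto_compose[where g=f2])
    moreover have "cmod (of_real (r k) * \<zeta>) < 1" for k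
      using norm_mult_less_one[of "of_real (r k)" \<zeta>] r[of k] z by simp
    ultimately have "(\<lambda>k. U (of_real (r k) * \<zeta>)) \<longlonglongrightarrow> U \<zeta>"
      by (simp add: U z)
    then show ?thesis
      using 1[THEN integral_unique] by (auto intro!: tendsto_intros)
  qed
  with dc have "(G has_integral (2 * of_real pi * U \<zeta>)) {0..2*pi}"
    by (metis LIMSEQ_unique has_integral_integral)
  then show ?thesis
    by (rule has_integral_spike_finite[OF finT, rotated]) (auto simp: G_def)
qed

section \<open>Mixed partial derivatives and harmonic functions\<close>

lemma differentiable_has_derivative_pd:
  fixes f :: "complex \<Rightarrow> real"
  assumes "f differentiable (at z)"
  shows "(f has_derivative (\<lambda>h. Re h * pdx f z + Im h * pdy f z)) (at z)"
proof -
  obtain f' where f': "(f has_derivative f') (at z)" using assms by (auto simp: differentiable_def)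
  interpret bounded_linear f' using f' by (rule has_derivative_bounded_linear)
  have 1: "((\<lambda>t::real. f (z + c * of_real t)) has_vector_derivative f' c) (at 0)" for c
  proof -
    have "((\<lambda>t::real. z + c * of_real t) has_derivative (\<lambda>t. c * of_real t)) (at 0)"
      by (auto intro!: derivative_eq_intros)
    then have "((\<lambda>t::real. f (z + c * of_real t)) has_derivative (\<lambda>t. f' (c * of_real t))) (at 0)"
      by (rule has_derivative_compose) (use f' in simp)
    moreover have "(\<lambda>t. f' (c * of_real t)) = (\<lambda>t. t *\<^sub>R f' c)"
      
      using scaleR[of _ c] by (simp add: fun_eq_iff scaleR_conv_of_real mult.commute)
    ultimately show ?thesis by (simp add: has_vector_derivative_def)
  qed
  have x: "pdx f z = f' 1" unfolding pdx_def
    using 1[of 1] by (simp add: vector_derivative_at)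
  have y: "pdy f z = f' \<i>" unfolding pdy_def
    using 1[of \<i>] by (simp add: vector_derivative_at)
  have "f' h = Re h * pdx f z + Im h * pdy f z" for h
  proof -
    have "h = Re h *\<^sub>R 1 + Im h *\<^sub>R \<i>" by (simp add: complex_eq_iff)
    then have "f' h = f' (Re h *\<^sub>R 1 + Im h *\<^sub>R \<i>)" by simp
    then show ?thesis unfolding add scaleR x y by simp
  qed
  then show ?thesis using f' by (metis (no_types, lifting) ext)
qed

lemma directional_derivative:
  fixes f :: "complex \<Rightarrow> real"
  assumes "f differentiable (at (z + s *\<^sub>R v))"
  shows "((\<lambda>t. f (z + t *\<^sub>R v)) has_real_derivative
           (Re v * pdx f (z + s *\<^sub>R v) + Im v * pdy f (z + s *\<^sub>R v))) (at s)"
proof -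
  have "((\<lambda>t. f (z + t *\<^sub>R v)) has_derivative
     (\<lambda>t. Re (t *\<^sub>R v) * pdx f (z + s *\<^sub>R v) + Im (t *\<^sub>R v) * pdy f (z + s *\<^sub>R v))) (at s)"
    by (rule has_derivative_compose[where g=f and f="\<lambda>t. z + t *\<^sub>R v" and x=s and s=UNIV, OF _ differentiable_has_derivative_pd[OF assms]])
       (auto intro!: derivative_eq_intros)
  then show ?thesis
    unfolding has_field_derivative_def by (rule has_derivative_eq_rhs) (auto simp: algebra_simps)
qed

text \<open>Schwarz's argument: the second difference of f over a small square is evaluated by the
  mean value theorem in the two possible orders.\<close>

lemma mixed_partials_near:
  fixes f :: "complex \<Rightarrow> real"
  assumes f: "C2_on S f" and z: "z \<in> S" and e: "e > 0"
  shows "\<exists>p\<in>ball z e. \<exists>q\<in>ball z e. p \<in> S \<and> q \<in> S \<and> pdy (pdx f) p = pdx (pdy f) q"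
proof -
  have "open S" and d: "\<And>z. z\<in>S \<Longrightarrow> f differentiable (at z)" "\<And>z. z\<in>S \<Longrightarrow> pdx f differentiable (at z)"
     "\<And>z. z\<in>S \<Longrightarrow> pdy f differentiable (at z)" using f by (auto simp: C2_on_def)
  obtain e' where e': "e' > 0" "ball z e' \<subseteq> S" using \<open>open S\<close> z openE by blast
  define h where "h = min e e' / 4"
  have h: "h > 0" "4 * h \<le> e" "4 * h \<le> e'" using e e' by (auto simp: h_def)
  define P where "P = (\<lambda>s t. z + s *\<^sub>R 1 + t *\<^sub>R \<i>)"
  have near: "dist z (P s t) < 4 * h" if "0 \<le> s" "s \<le> h" "0 \<le> t" "t \<le> h" for s t
  proof -
    have "dist z (P s t) = cmod (s *\<^sub>R 1 + t *\<^sub>R \<i>)"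
      by (simp add: P_def dist_norm norm_minus_commute algebra_simps)
    also have "\<dots> \<le> \<bar>s\<bar> + \<bar>t\<bar>" by (rule norm_triangle_le) simp
    finally show ?thesis using that h by linarith
  qed
  then have inS: "P s t \<in> S" if "0 \<le> s" "s \<le> h" "0 \<le> t" "t \<le> h" for s t
    using that h e' by (meson in_mono mem_ball order_less_le_trans)
  have Dx: "((\<lambda>s. F (P s t)) has_real_derivative pdx F (P s t)) (at s)"
    if "F differentiable (at (P s t))" for F :: "complex \<Rightarrow> real" and s t
    using directional_derivative[of F "z + t *\<^sub>R \<i>" s 1] that by (simp add: P_def ac_simps)
  have Dy: "((\<lambda>t. F (P s t)) has_real_derivative pdy F (P s t)) (at t)"
    if "F differentiable (at (P s t))" for F :: "complex \<Rightarrow> real" and s t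
    using directional_derivative[of F "z + s *\<^sub>R 1" t \<i>] that by (simp add: P_def)
  define A where "A = (\<lambda>s t. f (P s t))"
  have "\<exists>s>0. s < h \<and> (A h h - A h 0) - (A 0 h - A 0 0) = (h - 0) * (pdx f (P s h) - pdx f (P s 0))"
    unfolding A_def
    by (rule MVT2[where f = "\<lambda>s. f (P s h) - f (P s 0)"])
       (use h in \<open>auto intro!: DERIV_diff Dx d inS\<close>)
  then obtain s where s: "0 < s" "s < h" and
     s_eq: "(A h h - A h 0) - (A 0 h - A 0 0) = h * (pdx f (P s h) - pdx f (P s 0))"
    by auto
  have "\<exists>t>0. t < h \<and> pdx f (P s h) - pdx f (P s 0) = (h - 0) * pdy (pdx f) (P s t)"
    by (rule MVT2[where f = "\<lambda>t. pdx f (P s t)"])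
       (use h s in \<open>auto intro!: Dy d inS\<close>)
  then obtain t where t: "0 < t" "t < h"
    and t_eq: "pdx f (P s h) - pdx f (P s 0) = h * pdy (pdx f) (P s t)"
    by auto
  have "\<exists>t>0. t < h \<and> (A h h - A 0 h) - (A h 0 - A 0 0) = (h - 0) * (pdy f (P h t) - pdy f (P 0 t))"
    unfolding A_def
    by (rule MVT2[where f = "\<lambda>t. f (P h t) - f (P 0 t)"])
       (use h in \<open>auto intro!: DERIV_diff Dy d inS\<close>)
  then obtain t' where t': "0 < t'" "t' < h" and
     t'_eq: "(A h h - A 0 h) - (A h 0 - A 0 0) = h * (pdy f (P h t') - pdy f (P 0 t'))"
    by auto
  have "\<exists>s>0. s < h \<and> pdy f (P h t') - pdy f (P 0 t') = (h - 0) * pdx (pdy f) (P s t')"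
    by (rule MVT2[where f = "\<lambda>s. pdy f (P s t')"])
       (use h t' in \<open>auto intro!: Dx d inS\<close>)
  then obtain s' where s': "0 < s'" "s' < h"
    and s'_eq: "pdy f (P h t') - pdy f (P 0 t') = h * pdx (pdy f) (P s' t')"
    by auto
  have "h * (h * pdy (pdx f) (P s t)) = h * (h * pdx (pdy f) (P s' t'))"
    using s_eq t'_eq unfolding t_eq s'_eq by linarith
  then have "pdy (pdx f) (P s t) = pdx (pdy f) (P s' t')"
    using h by simp
  moreover have "P s t \<in> ball z e \<inter> S" "P s' t' \<in> ball z e \<inter> S"
    using near[of s t] near[of s' t'] inS[of s t] inS[of s' t'] s t s' t' h by auto
  ultimately show ?thesis by blast
qed

text \<open>The squares of the preceding lemma shrink to z, and both mixed derivatives are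
  continuous there.\<close>

lemma mixed_partials_commute:
  fixes f :: "complex \<Rightarrow> real"
  assumes f: "C2_on S f" and z: "z \<in> S"
  shows "pdx (pdy f) z = pdy (pdx f) z"
proof -
  have op: "open S" and c: "continuous_on S (pdx (pdy f))" "continuous_on S (pdy (pdx f))"
    using f by (auto simp: C2_on_def)
  have "\<exists>p q. \<forall>n::nat. p n \<in> ball z (inverse (Suc n)) \<and> q n \<in> ball z (inverse (Suc n)) \<and> p n \<in> S \<and> q n \<in> S
         \<and> pdy (pdx f) (p n) = pdx (pdy f) (q n)"
  proof -
    have "\<forall>n::nat. \<exists>p q. p \<in> ball z (inverse (Suc n)) \<and> q \<in> ball z (inverse (Suc n)) \<and> p \<in> S \<and> q \<in> S
         \<and> pdy (pdx f) p = pdx (pdy f) q"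
      using mixed_partials_near[OF f z] by (metis inverse_positive_iff_positive of_nat_0_less_iff zero_less_Suc)
    then show ?thesis by metis
  qed
  then obtain p q where pq: "\<And>n. p n \<in> ball z (inverse (Suc n))" "\<And>n. q n \<in> ball z (inverse (Suc n))"
     "\<And>n. p n \<in> S" "\<And>n. q n \<in> S" "\<And>n. pdy (pdx f) (p n) = pdx (pdy f) (q n)" by blast
  have lim: "r \<longlonglongrightarrow> z" if "\<And>n. r n \<in> ball z (inverse (Suc n))" for r
  proof (rule metric_LIMSEQ_I)
    fix e :: real assume "e > 0"
    then obtain N where N: "inverse (real (Suc N)) < e" using reals_Archimedean by blast
    show "\<exists>no. \<forall>n\<ge>no. dist (r n) z < e"
    proof (intro exI allI impI)
      fix n assume "n \<ge> N"
      then have "inverse (real (Suc n)) \<le> inverse (real (Suc N))" by (simp add: field_simps)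
      then show "dist (r n) z < e" using that[of n] N unfolding mem_ball dist_commute[of "r n"] by linarith
    qed
  qed
  have "(\<lambda>n. pdy (pdx f) (p n)) \<longlonglongrightarrow> pdy (pdx f) z"
    by (rule continuous_on_tendsto_compose[OF c(2) lim[OF pq(1)] z]) (simp add: pq)
  moreover have "(\<lambda>n. pdx (pdy f) (q n)) \<longlonglongrightarrow> pdx (pdy f) z"
    by (rule continuous_on_tendsto_compose[OF c(1) lim[OF pq(2)] z]) (simp add: pq)
  ultimately show ?thesis unfolding pq(5) by (rule LIMSEQ_unique[symmetric])
qed

lemma pd_Re_holomorphic:
  assumes f: "f holomorphic_on S" and S: "open S" and z: "z \<in> S"
  shows "pdx (\<lambda>z. Re (f z)) z = Re (deriv f z)" "pdy (\<lambda>z. Re (f z)) z = Re (\<i> * deriv f z)"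
    "(\<lambda>z. Re (f z)) differentiable (at z)"
proof -
  have df: "(f has_field_derivative deriv f z) (at z)"
    using f S z by (rule holomorphic_derivI)
  have D: "((\<lambda>z. Re (f z)) has_derivative (\<lambda>h. Re (deriv f z * h))) (at z)"
    using has_derivative_Re[OF df[unfolded has_field_derivative_def]] by simp
  then show dd: "(\<lambda>z. Re (f z)) differentiable (at z)" by (auto simp: differentiable_def)
  have "(\<lambda>h. Re (deriv f z * h)) = (\<lambda>h. Re h * pdx (\<lambda>z. Re (f z)) z + Im h * pdy (\<lambda>z. Re (f z)) z)"
    by (rule has_derivative_unique[OF D differentiable_has_derivative_pd[OF dd]])
  from fun_cong[OF this, of 1] fun_cong[OF this, of \<i>]
  show "pdx (\<lambda>z. Re (f z)) z = Re (deriv f z)" "pdy (\<lambda>z. Re (f z)) z = Re (\<i> * deriv f z)"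
    by simp_all
qed

lemma pd_cong:
  assumes "open S" "z \<in> S" "\<And>w. w \<in> S \<Longrightarrow> f w = g w"
  shows "pdx f z = pdx g z" "pdy f z = pdy g z"
proof -
  have 1: "\<forall>\<^sub>F t::real in nhds 0. f (z + c * of_real t) = g (z + c * of_real t)" for c
  proof -
    have "((\<lambda>t::real. z + c * of_real t) \<longlongrightarrow> z + c * of_real 0) (nhds 0)"
      by (intro tendsto_intros filterlim_ident)
    then have "\<forall>\<^sub>F t::real in nhds 0. z + c * of_real t \<in> S"
      using assms(1,2) by (simp add: topological_tendstoD)
    then show ?thesis by (rule eventually_mono) (use assms(3) in auto)
  qed
  show "pdx f z = pdx g z" unfolding pdx_def
    by (rule vector_derivative_cong_eq) (use 1[of 1] in auto)
  show "pdy f z = pdy g z" unfolding pdy_def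
    by (rule vector_derivative_cong_eq) (use 1[of \<i>] in auto)
qed

text \<open>All second partial derivatives are real parts of f'' times a power of \<i>; the two pure
  ones carry the factors 1 and \<i>^2 and cancel.\<close>

lemma harmonic_real_on_Re_holomorphic:
  assumes f: "f holomorphic_on S" and S: "open S"
  shows "harmonic_real_on S (\<lambda>z. Re (f z))"
proof -
  let ?u = "\<lambda>z. Re (f z)"
  have f1: "deriv f holomorphic_on S" by (rule holomorphic_deriv[OF f S])
  have f1': "(\<lambda>z. \<i> * deriv f z) holomorphic_on S"
    by (rule holomorphic_on_mult[OF holomorphic_on_const f1])
  have f2: "deriv (deriv f) holomorphic_on S" by (rule holomorphic_deriv[OF f1 S])
  have dI: "deriv (\<lambda>z. \<i> * deriv f z) z = \<i> * deriv (deriv f) z" if "z \<in> S" for z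
    by (rule deriv_cmult) (rule holomorphic_on_imp_differentiable_at[OF f1 S that])
  note px = pd_Re_holomorphic(1)[OF f S] and py = pd_Re_holomorphic(2)[OF f S]
  have dif: "pdx ?u differentiable (at z)" "pdy ?u differentiable (at z)" if z: "z \<in> S" for z
  proof -
    obtain D where "((\<lambda>z. Re (deriv f z)) has_derivative D) (at z)"
      using pd_Re_holomorphic(3)[OF f1 S z] by (auto simp: differentiable_def)
    then have "(pdx ?u has_derivative D) (at z)"
      by (rule has_derivative_transform_within_open[OF _ S z]) (simp add: px)
    then show "pdx ?u differentiable (at z)" by (auto simp: differentiable_def)
    obtain D where "((\<lambda>z. Re (\<i> * deriv f z)) has_derivative D) (at z)"
      using pd_Re_holomorphic(3)[OF f1' S z] by (auto simp: differentiable_def)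
    then have "(pdy ?u has_derivative D) (at z)"
      by (rule has_derivative_transform_within_open[OF _ S z]) (simp add: py)
    then show "pdy ?u differentiable (at z)" by (auto simp: differentiable_def)
  qed
  have xx: "pdx (pdx ?u) z = Re (deriv (deriv f) z)" if z: "z \<in> S" for z
    using pd_cong(1)[OF S z px] pd_Re_holomorphic(1)[OF f1 S z] by simp
  have yx: "pdy (pdx ?u) z = Re (\<i> * deriv (deriv f) z)" if z: "z \<in> S" for z
    using pd_cong(2)[OF S z px] pd_Re_holomorphic(2)[OF f1 S z] by simp
  have xy: "pdx (pdy ?u) z = Re (\<i> * deriv (deriv f) z)" if z: "z \<in> S" for z
    using pd_cong(1)[OF S z py] pd_Re_holomorphic(1)[OF f1' S z] by (simp add: dI[OF z])
  have yy: "pdy (pdy ?u) z = Re (\<i> * (\<i> * deriv (deriv f) z))" if z: "z \<in> S" for z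
    using pd_cong(2)[OF S z py] pd_Re_holomorphic(2)[OF f1' S z] by (simp add: dI[OF z])
  have c2: "continuous_on S (deriv (deriv f))" using f2 by (rule holomorphic_on_imp_continuous_on)
  have "continuous_on S (pdx (pdx ?u))" 
    by (rule continuous_on_eq[OF _ xx[symmetric]]) (intro continuous_intros c2)
  moreover have "continuous_on S (pdy (pdy ?u))"
    by (rule continuous_on_eq[OF _ yy[symmetric]]) (intro continuous_intros c2)
  moreover have "continuous_on S (pdx (pdy ?u))"
    by (rule continuous_on_eq[OF _ xy[symmetric]]) (intro continuous_intros c2)
  moreover have "continuous_on S (pdy (pdx ?u))"
    by (rule continuous_on_eq[OF _ yx[symmetric]]) (intro continuous_intros c2)
  ultimately show ?thesis
    unfolding harmonic_real_on_def C2_on_def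
    using S dif pd_Re_holomorphic(3)[OF f S] by (auto simp: xx yy)
qed

text \<open>Conjugation does not affect the real part and only changes the sign of the imaginary
  part, so Re U and Im U are real parts of the holomorphic functions (f1 + f2)/2 and -\<i>(f1 -
  f2)/2.\<close>

lemma harmonic_onI:
  assumes "f1 holomorphic_on S" "f2 holomorphic_on S" "open S"
    and U: "\<And>z. z \<in> S \<Longrightarrow> U z = (f1 z + cnj (f2 z)) / 2"
  shows "harmonic_on S U"
proof -
  \<comment> \<open>The predicates concern functions on the whole plane, but U is controlled on S
    only; as S is open, equality there passes to every derivative in turn.\<close>
  have cong: "harmonic_real_on S u" if v: "harmonic_real_on S v" and eq: "\<And>z. z \<in> S \<Longrightarrow> u z = v z"
    for u v :: "complex \<Rightarrow> real"
  proof -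
    have S: "open S" using v by (simp add: harmonic_real_on_def C2_on_def)
    have 1: "pdx u z = pdx v z" "pdy u z = pdy v z" if "z \<in> S" for z
      using pd_cong[OF S that, of u v] eq by blast+
    have 2: "pdx (pdx u) z = pdx (pdx v) z" "pdy (pdx u) z = pdy (pdx v) z" if "z \<in> S" for z
      using pd_cong[OF S that, of "pdx u" "pdx v"] 1(1) by blast+
    have 3: "pdx (pdy u) z = pdx (pdy v) z" "pdy (pdy u) z = pdy (pdy v) z" if "z \<in> S" for z
      using pd_cong[OF S that, of "pdy u" "pdy v"] 1(2) by blast+
    have tr: "u' differentiable (at z)" if "v' differentiable (at z)" "z \<in> S" "\<And>z. z \<in> S \<Longrightarrow> u' z = v' z"
      for u' v' :: "complex \<Rightarrow> real" and z
      using that S unfolding differentiable_def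
      using has_derivative_transform_within_open[of v' _ z UNIV S u'] by auto
    have d: "u differentiable (at z)" "pdx u differentiable (at z)" "pdy u differentiable (at z)" if z: "z \<in> S" for z
      using v z by (simp_all add: harmonic_real_on_def C2_on_def tr[OF _ z eq] tr[OF _ z 1(1)] tr[OF _ z 1(2)])
    have "continuous_on S (pdx (pdx u))" "continuous_on S (pdy (pdy u))"
     "continuous_on S (pdx (pdy u))" "continuous_on S (pdy (pdx u))"
      using v by (auto simp: harmonic_real_on_def C2_on_def
          intro: continuous_on_eq[OF _ 2(1)[symmetric]] continuous_on_eq[OF _ 2(2)[symmetric]]
            continuous_on_eq[OF _ 3(1)[symmetric]] continuous_on_eq[OF _ 3(2)[symmetric]])
    moreover have "pdx (pdx u) z + pdy (pdy u) z = 0" if "z \<in> S" for z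
      unfolding 2(1)[OF that] 3(2)[OF that] using v that by (simp add: harmonic_real_on_def)
    ultimately show ?thesis using S d unfolding harmonic_real_on_def C2_on_def by blast
  qed
  have "harmonic_real_on S (\<lambda>z. Re ((f1 z + f2 z) / 2))"
    by (rule harmonic_real_on_Re_holomorphic) (use assms in \<open>auto intro!: holomorphic_intros\<close>)
  then have "harmonic_real_on S (\<lambda>z. Re (U z))" by (rule cong) (simp add: U)
  moreover have "harmonic_real_on S (\<lambda>z. Re (- \<i> * (f1 z - f2 z) / 2))"
    by (rule harmonic_real_on_Re_holomorphic) (use assms in \<open>auto intro!: holomorphic_intros\<close>)
  then have "harmonic_real_on S (\<lambda>z. Im (U z))" by (rule cong) (simp add: U field_simps)
  ultimately show ?thesis unfolding harmonic_on_def ..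
qed

section \<open>Arcs of the circle\<close>

lemma cis_Arg_unit: "cmod x = 1 \<Longrightarrow> cis (Arg x) = x"
  using cis_Arg[of x] by (cases "x = 0") (auto simp: sgn_eq)

text \<open>The upper bound is included so that the set is never empty: after a full turn e itself
  is met. If E = {e}, the arc is the circle without e.\<close>

definition next_angle :: "complex set \<Rightarrow> complex \<Rightarrow> real" where
  "next_angle E e = Min {t. Arg e < t \<and> t \<le> Arg e + 2 * pi \<and> cis t \<in> E}"

definition next_arc :: "complex set \<Rightarrow> complex \<Rightarrow> complex set" where
  "next_arc E e = open_arc (Arg e) (next_angle E e)"

lemma cis_shift [simp]: "cis (t + 2 * pi * of_int k) = cis t"
  using cis_eq_cis_iff by blast

lemma next_angle:
  assumes E: "finite E" "E \<subseteq> sphere 0 1" and e: "e \<in> E"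
  shows "Arg e < next_angle E e" "next_angle E e \<le> Arg e + 2 * pi" "cis (next_angle E e) \<in> E"
    "\<And>t. Arg e < t \<Longrightarrow> t < next_angle E e \<Longrightarrow> cis t \<notin> E"
proof -
  let ?S = "{t. Arg e < t \<and> t \<le> Arg e + 2 * pi \<and> cis t \<in> E}"
  have ce: "cis (Arg e) = e"
    using E e by (auto simp: cis_Arg_unit subset_iff)
  have "?S \<subseteq> {t \<in> {Arg e..Arg e + 2 * pi}. cis t \<in> E}" by auto
  then have fin: "finite ?S" using finite_cis_vimage[OF E(1)] by (rule finite_subset)
  have "Arg e + 2 * pi \<in> ?S" using ce e cis_shift[of "Arg e" 1] by simp
  then have "next_angle E e \<in> ?S"
    unfolding next_angle_def using fin by (intro Min_in) auto
  then show "Arg e < next_angle E e" and le: "next_angle E e \<le> Arg e + 2 * pi" and "cis (next_angle E e) \<in> E"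
    by auto
  show "cis t \<notin> E" if "Arg e < t" "t < next_angle E e" for t
  proof
    assume "cis t \<in> E"
    then have "t \<in> ?S" using that le by auto
    then have "next_angle E e \<le> t" unfolding next_angle_def using fin by (intro Min_le) auto
    then show False using that by simp
  qed
qed

text \<open>Shift one of two overlapping arcs by a multiple of 2 pi so that the parameters of a
  common point agree. The later of the two starting angles then lies inside the other arc, although
  it belongs to a point of E.\<close>

lemma next_arc_disjoint:
  assumes E: "finite E" "E \<subseteq> sphere 0 1" and e: "e \<in> E" and e': "e' \<in> E" and ne: "e \<noteq> e'"
  shows "next_arc E e \<inter> next_arc E e' = {}"
proof (rule ccontr)
  assume "next_arc E e \<inter> next_arc E e' \<noteq> {}"
  then obtain t t' where t: "Arg e < t" "t < next_angle E e" and t': "Arg e' < t'" "t' < next_angle E e'"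
    and eq: "cis t = cis t'" unfolding next_arc_def open_arc_def by auto
  obtain k :: int where k: "t = t' + 2 * pi * of_int k" using eq by (auto simp: cis_eq_cis_iff)
  have ce: "cis (Arg e) = e" "cis (Arg e') = e'"
    using E e e' by (auto simp: cis_Arg_unit subset_iff)
  consider "Arg e' + 2 * pi * of_int k < Arg e" | "Arg e' + 2 * pi * of_int k = Arg e"
    | "Arg e' + 2 * pi * of_int k > Arg e" by linarith
  then show False
  proof cases
    case 1
    have k': "Arg e + 2 * pi * of_int (- k) = Arg e - 2 * pi * of_int k" by simp
    have "Arg e' < Arg e + 2 * pi * of_int (- k)" "Arg e + 2 * pi * of_int (- k) < next_angle E e'"
      unfolding k' using 1 k t t' by linarith+
    then have "cis (Arg e + 2 * pi * of_int (- k)) \<notin> E"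
      by (rule next_angle(4)[OF E e'])
    then show False using ce e unfolding cis_shift by simp
  next
    case 2 then show False using ce ne by (metis cis_shift)
  next
    case 3
    have "cis (Arg e' + 2 * pi * of_int k) \<notin> E"
      by (rule next_angle(4)[OF E e]) (use 3 k t t' in linarith)+
    then show False using ce e' unfolding cis_shift by simp
  qed
qed

text \<open>Turning clockwise from x, the first point of E that is met is the start of the arc
  containing x.\<close>

lemma next_arc_cover:
  assumes E: "finite E" "E \<subseteq> sphere 0 1" and ne: "E \<noteq> {}"
  shows "(\<Union>e\<in>E. next_arc E e) = sphere 0 1 - E"
proof (intro equalityI subsetI)
  fix x assume "x \<in> (\<Union>e\<in>E. next_arc E e)"
  then show "x \<in> sphere 0 1 - E"
    using next_angle(4)[OF E] by (auto simp: next_arc_def open_arc_def)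
next
  fix x :: complex assume x: "x \<in> sphere 0 1 - E"
  define a where "a = Arg x"
  have cx: "cis a = x" using x by (auto simp: cis_Arg_unit a_def)
  let ?S = "{t \<in> {a - 2 * pi..<a}. cis t \<in> E}"
  have "finite ?S"
    using finite_vimage_IntI[OF E(1) inj_on_cis[of "a - 2*pi"]] by (simp add: vimage_def Int_def conj_commute)
  moreover have "?S \<noteq> {}"
  proof -
    obtain e where e: "e \<in> E" using ne by auto
    have ce: "cis (Arg e) = e" using E e by (auto simp: cis_Arg_unit subset_iff)
    \<comment> \<open>The multiple of 2 pi that moves \<open>Arg e\<close> into the half-open turn
      ending at \<open>a\<close>; the end point \<open>a\<close> itself is excluded because x is not
      in E.\<close>
    define k :: int where "k = \<lfloor>(a - Arg e) / (2 * pi)\<rfloor>"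
    have "of_int k \<le> (a - Arg e) / (2 * pi)" "(a - Arg e) / (2 * pi) < of_int k + 1"
      unfolding k_def by linarith+
    then have 1: "2 * pi * of_int k \<le> a - Arg e" "a - Arg e < 2 * pi * of_int k + 2 * pi"
      by (simp_all add: field_simps)
    have "Arg e + 2 * pi * of_int k \<noteq> a"
      using cx ce e x cis_shift[of "Arg e" k] by auto
    then have "Arg e + 2 * pi * of_int k \<in> ?S"
      using 1 ce e by auto
    then show ?thesis by blast
  qed
  ultimately have s: "Max ?S \<in> ?S" "\<And>t. t \<in> ?S \<Longrightarrow> t \<le> Max ?S" 
    using Max_in[of ?S] Max_ge[of ?S] by blast+
  define s where "s = Max ?S"
  define e where "e = cis s"
  have e: "e \<in> E" using s(1) by (auto simp: e_def s_def)
  have ce: "cis (Arg e) = e" using E e by (auto simp: cis_Arg_unit subset_iff)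
  then obtain k :: int where k: "Arg e = s + 2 * pi * of_int k" by (auto simp: e_def cis_eq_cis_iff)
  have sa: "a - 2 * pi \<le> s" "s < a" using s(1) by (auto simp: s_def)
  have "a + 2 * pi * of_int k < next_angle E e"
  proof (rule ccontr)
    \<comment> \<open>If the next angle did not pass \<open>a\<close>, its translate b would be a
      parameter of E strictly between s and a, against the choice of s as a maximum.\<close>
    define b where "b = next_angle E e - 2 * pi * of_int k"
    assume "\<not> a + 2 * pi * of_int k < next_angle E e"
    then have "b \<le> a" by (simp add: b_def)
    have sb: "s < b" using next_angle(1)[OF E e] by (simp add: b_def k)
    have "next_angle E e = b + 2 * pi * of_int k" by (simp add: b_def)
    then have cb: "cis b \<in> E" using next_angle(3)[OF E e] by simp
    then have "b \<noteq> a" using cx x by auto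
    then have "b \<in> ?S" using \<open>b \<le> a\<close> sb sa cb by auto
    then show False using s(2)[of b] sb by (simp add: s_def)
  qed
  then have "cis (a + 2 * pi * of_int k) \<in> next_arc E e"
    unfolding next_arc_def open_arc_def using sa k by fastforce
  then show "x \<in> (\<Union>e\<in>E. next_arc E e)" using e cx by auto
qed

lemma connected_next_arc: "connected (next_arc E e)"
proof -
  have "next_arc E e = cis ` {Arg e<..<next_angle E e}"
    by (auto simp: next_arc_def open_arc_def)
  then show ?thesis by (auto intro!: connected_continuous_image continuous_intros)
qed

lemma next_arc_nonempty: "finite E \<Longrightarrow> E \<subseteq> sphere 0 1 \<Longrightarrow> e \<in> E \<Longrightarrow> next_arc E e \<noteq> {}"
  using next_angle(1)[of E e] dense[of "Arg e" "next_angle E e"] by (auto simp: next_arc_def open_arc_def)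

text \<open>A connected set with more than one point has no isolated points, and a limit point
  survives the removal of finitely many points.\<close>

lemma closure_sphere_minus_finite:
  assumes "finite E" shows "closure (sphere 0 1 - E) = sphere (0::complex) 1"
proof
  show "closure (sphere 0 1 - E) \<subseteq> sphere (0::complex) 1"
    by (rule closure_minimal) auto
  show "sphere (0::complex) 1 \<subseteq> closure (sphere 0 1 - E)"
  proof
    fix x :: complex assume "x \<in> sphere 0 1"
    have "x islimpt sphere 0 1"
      by (rule connected_imp_perfect) (use \<open>x \<in> sphere 0 1\<close> in \<open>auto simp: connected_sphere\<close>,
         metis mem_sphere_0 norm_minus_cancel norm_zero one_neq_neg_one singletonD norm_one zero_neq_one)
    then have "x islimpt (sphere 0 1 - E)"
      using assms islimpt_finite[of E x] islimpt_Un[of x "sphere 0 1 - E" E]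
      by (metis Diff_partition Un_Diff_cancel2 islimpt_Un sup_ge1)
    then show "x \<in> closure (sphere 0 1 - E)" by (simp add: closure_def)
  qed
qed

text \<open>The parameters of an arc form a union of translates of an open interval, hence an open
  set; measurability follows, and the kernel itself is an integrable majorant.\<close>

lemma open_arc_integrable:
  assumes z: "cmod \<zeta> < 1"
  shows "(\<lambda>t. indicator (open_arc a b) (cis t) * poisson_kernel \<zeta> t) integrable_on {0..2*pi}"
proof -
  have "{t. cis t \<in> open_arc a b} = (\<Union>k::int. {a + 2 * pi * of_int k<..<b + 2 * pi * of_int k})"
  proof (intro set_eqI iffI)
    fix t assume "t \<in> {t. cis t \<in> open_arc a b}"
    then obtain s where s: "a < s" "s < b" "cis t = cis s" by (auto simp: open_arc_def)
    then obtain k :: int where "t = s + 2 * pi * of_int k" by (auto simp: cis_eq_cis_iff)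
    with s have "t \<in> {a + 2 * pi * of_int k<..<b + 2 * pi * of_int k}" by simp
    then show "t \<in> (\<Union>k::int. {a + 2 * pi * of_int k<..<b + 2 * pi * of_int k})" by blast
  next
    fix t assume "t \<in> (\<Union>k::int. {a + 2 * pi * of_int k<..<b + 2 * pi * of_int k})"
    then obtain k :: int where k: "a + 2 * pi * of_int k < t" "t < b + 2 * pi * of_int k" by auto
    have "cis t = cis (t - 2 * pi * of_int k)" using cis_shift[of "t - 2 * pi * of_int k" k] by simp
    then show "t \<in> {t. cis t \<in> open_arc a b}" using k by (force simp: open_arc_def)
  qed
  then have "open {t. cis t \<in> open_arc a b}" by auto
  then have m: "{t. cis t \<in> open_arc a b} \<in> sets borel" by auto
  have pk: "poisson_kernel \<zeta> \<in> borel_measurable borel"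
    by (rule borel_measurable_continuous_onI[OF continuous_on_poisson_kernel[OF z]])
  have "(\<lambda>t. indicator {t. cis t \<in> open_arc a b} t * poisson_kernel \<zeta> t) \<in> borel_measurable borel"
    by (intro borel_measurable_times borel_measurable_indicator m pk)
  then have "(\<lambda>t. indicator (open_arc a b) (cis t) * poisson_kernel \<zeta> t) \<in> borel_measurable borel"
    by (simp add: indicator_def)
  then have "(\<lambda>t. indicator (open_arc a b) (cis t) * poisson_kernel \<zeta> t) \<in> borel_measurable (lebesgue_on {0..2*pi})"
    by (intro measurable_restrict_space1 measurable_completion) simp
  then show ?thesis
  proof (rule measurable_bounded_by_integrable_imp_integrable)
    show "poisson_kernel \<zeta> integrable_on {0..2*pi}" using poisson_kernel_has_integral[OF z] by blast
  qed (use poisson_kernel_nonneg[OF z] in \<open>auto simp: indicator_def\<close>)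
qed

section \<open>Convex solutions near an affine edge and the Lewy transform\<close>

text \<open>Needed for the barrier at an interior maximum, in the tangential and in the normal
  direction separately. Only a second derivative at the maximum is asked for: if it were positive,
  f' would be positive just to the right.\<close>

lemma second_derivative_local_max:
  fixes f :: "real \<Rightarrow> real"
  assumes d: "d > 0"
    and f': "\<And>x. \<bar>x - x0\<bar> < d \<Longrightarrow> (f has_real_derivative f' x) (at x)"
    and f2: "(f' has_real_derivative D) (at x0)"
    and max: "\<And>x. \<bar>x - x0\<bar> < d \<Longrightarrow> f x \<le> f x0"
  shows "D \<le> 0"
proof (rule ccontr)
  assume "\<not> D \<le> 0"
  then obtain e where e: "e > 0" "\<And>h. 0 < h \<Longrightarrow> h < e \<Longrightarrow> f' x0 < f' (x0 + h)"
    using DERIV_pos_inc_right[OF f2] by auto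
  have z: "f' x0 = 0"
  proof (rule DERIV_local_max[of f "f' x0" x0 d])
    show "(f has_real_derivative f' x0) (at x0)" using f'[of x0] d by simp
    show "\<forall>y. \<bar>x0 - y\<bar> < d \<longrightarrow> f y \<le> f x0" using max by (simp add: abs_minus_commute)
  qed (rule d)
  define h where "h = min d e / 2"
  have h: "0 < h" "h < d" "h < e" using d e by (auto simp: h_def)
  have "f x0 < f (x0 + h)"
  proof (rule DERIV_pos_imp_increasing_open[where f=f and a=x0 and b="x0 + h"])
    show "x0 < x0 + h" using h by simp
    fix x assume "x0 < x" "x < x0 + h"
    then show "\<exists>y. (f has_real_derivative y) (at x) \<and> 0 < y"
      using f'[of x] e(2)[of "x - x0"] z h by auto
  next
    show "continuous_on {x0..x0 + h} f"
      by (rule DERIV_continuous_on[where D=f'], rule has_field_derivative_at_within, rule f') (use h in auto)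
  qed
  then show False using max[of "x0 + h"] h by auto
qed

text \<open>Throughout, n is the outward unit normal of an edge and \<open>\<i> * n\<close> its
  counter-clockwise tangent; all estimates near an edge are done in this frame.\<close>

lemma frame_expand:
  fixes n v :: complex
  assumes n: "cmod n = 1"
  shows "v = ((\<i> * n) \<bullet> v) *\<^sub>R (\<i> * n) + (n \<bullet> v) *\<^sub>R n"
proof (rule complex_eqI)
  have nn: "Re n * Re n + Im n * Im n = 1" using n by (simp add: cmod_def power2_eq_square)
  have "Re v = (Re n * Re n + Im n * Im n) * Re v" "Im v = (Re n * Re n + Im n * Im n) * Im v"
    by (simp_all add: nn)
  then show "Re v = Re (((\<i> * n) \<bullet> v) *\<^sub>R (\<i> * n) + (n \<bullet> v) *\<^sub>R n)"
    "Im v = Im (((\<i> * n) \<bullet> v) *\<^sub>R (\<i> * n) + (n \<bullet> v) *\<^sub>R n)"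
    unfolding inner_complex_def by (simp_all add: algebra_simps)
qed

lemma frame_inner:
  fixes n u v :: complex
  assumes n: "cmod n = 1"
  shows "u \<bullet> v = (n \<bullet> u) * (n \<bullet> v) + ((\<i> * n) \<bullet> u) * ((\<i> * n) \<bullet> v)"
proof -
  have "u \<bullet> v = u \<bullet> (((\<i> * n) \<bullet> v) *\<^sub>R (\<i> * n) + (n \<bullet> v) *\<^sub>R n)"
    using frame_expand[OF n, of v] by simp
  then show ?thesis by (simp add: inner_add_right inner_commute algebra_simps)
qed

lemma interior_below_support:
  fixes n :: complex
  assumes z: "z \<in> interior N" and n: "cmod n = 1" and sup: "\<And>z. z \<in> N \<Longrightarrow> n \<bullet> z \<le> d"
  shows "n \<bullet> z < d"
proof -
  obtain e where e: "e > 0" "ball z e \<subseteq> N" using z by (meson mem_interior)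
  have "z + (e/2) *\<^sub>R n \<in> N" using e n by (intro subsetD[OF e(2)]) (simp add: dist_norm)
  from sup[OF this] have "n \<bullet> z + e / 2 * (n \<bullet> n) \<le> d" by (simp add: inner_add_right)
  then show ?thesis using e n by (simp add: dot_square_norm)
qed

text \<open>Every point of a thin rectangle below the segment lies on a line from a point of the
  segment to the interior point c, and convexity makes the open part of such a line
  interior.\<close>

lemma interior_box:
  fixes N :: "complex set"
  assumes cvx: "convex N" and c: "c \<in> interior N" and n: "cmod n = 1"
    and sup: "\<And>z. z \<in> N \<Longrightarrow> n \<bullet> z \<le> n \<bullet> y"
    and seg: "\<And>t. \<bar>t\<bar> \<le> r \<Longrightarrow> y + t *\<^sub>R (\<i> * n) \<in> N"
    and r: "0 < \<rho>" "\<rho> < r"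
  obtains h where "h > 0" "\<And>t \<eta>. \<bar>t\<bar> \<le> \<rho> \<Longrightarrow> 0 < \<eta> \<Longrightarrow> \<eta> \<le> h \<Longrightarrow> y + t *\<^sub>R (\<i> * n) - \<eta> *\<^sub>R n \<in> interior N"
proof -
  define c1 where "c1 = (\<i> * n) \<bullet> (c - y)"
  define c2 where "c2 = - (n \<bullet> (c - y))"
  have cy: "c - y = c1 *\<^sub>R (\<i> * n) - c2 *\<^sub>R n"
    using frame_expand[OF n, of "c - y"] by (simp add: c1_def c2_def)
  have c2: "c2 > 0" using interior_below_support[OF c n sup] by (simp add: c2_def inner_diff_right)
  \<comment> \<open>Chosen such that, at depth at most h, the foot t' of the line through c stays
    within distance r of y.\<close>
  define h where "h = c2 * ((r - \<rho>) / (\<bar>c1\<bar> + r))"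
  have h: "h > 0" using c2 r by (auto simp: h_def intro!: mult_pos_pos divide_pos_pos)
  show thesis
  proof (rule that[OF h])
    fix t \<eta> assume t: "\<bar>t\<bar> \<le> \<rho>" and \<eta>: "0 < \<eta>" "\<eta> \<le> h"
    define e where "e = \<eta> / c2"
    have e0: "e > 0" using \<eta> c2 by (simp add: e_def)
    have "e \<le> (r - \<rho>) / (\<bar>c1\<bar> + r)" using \<eta> c2 by (simp add: e_def h_def field_simps)
    then have e1: "e * (\<bar>c1\<bar> + r) \<le> r - \<rho>" using r by (simp add: pos_le_divide_eq)
    have "e * r \<le> e * (\<bar>c1\<bar> + r)" using e0 by (intro mult_left_mono) auto
    then have "e * r < 1 * r" using e1 r by linarith
    then have e2: "e < 1" using r by (simp only: mult_less_cancel_right_pos)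
    \<comment> \<open>The position on the edge from which moving by the fraction e towards c reaches
      the coordinates t and \<eta>.\<close>
    define t' where "t' = (t - e * c1) / (1 - e)"
    have t'e: "(1 - e) * t' = t - e * c1" using e2 by (simp add: t'_def)
    have "\<bar>t - e * c1\<bar> \<le> \<rho> + e * \<bar>c1\<bar>" using t e0 
      using abs_triangle_ineq4[of t "e * c1"] by (simp add: abs_mult)
    also have "\<dots> \<le> r * (1 - e)" using e1 by (simp add: algebra_simps)
    finally have "\<bar>t'\<bar> \<le> r" using e2 by (simp add: t'_def pos_divide_le_eq)
    from mem_interior_convex_shrink[OF cvx c seg[OF this] e0] e2
    have "(y + t' *\<^sub>R (\<i> * n)) - e *\<^sub>R ((y + t' *\<^sub>R (\<i> * n)) - c) \<in> interior N" by simp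
    also have "(y + t' *\<^sub>R (\<i> * n)) - e *\<^sub>R ((y + t' *\<^sub>R (\<i> * n)) - c)
       = y + ((1 - e) * t') *\<^sub>R (\<i> * n) + e *\<^sub>R (c - y)"
      by (simp add: algebra_simps)
    also have "\<dots> = y + t *\<^sub>R (\<i> * n) - (e * c2) *\<^sub>R n"
      unfolding t'e cy by (simp add: algebra_simps)
    finally show "y + t *\<^sub>R (\<i> * n) - \<eta> *\<^sub>R n \<in> interior N" using c2 by (simp add: e_def)
  qed
qed

section \<open>Convexity and the Hessian of the surface tension\<close>

locale tension =
  fixes N :: "complex set" and \<sigma> :: "complex \<Rightarrow> real"
  assumes convex_N: "convex N" and compact_N: "compact N" and interior_N: "interior N \<noteq> {}"
    and convex_sigma: "convex_on N \<sigma>" and cont_sigma: "continuous_on N \<sigma>"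
    and C2_sigma: "C2_on (interior N) \<sigma>"
    and hess_det_sigma: "\<And>z. z \<in> interior N \<Longrightarrow> hess_det \<sigma> z = 1"
begin

lemma diff_sigma: "z \<in> interior N \<Longrightarrow> \<sigma> differentiable (at z)"
  and diff_pdx: "z \<in> interior N \<Longrightarrow> pdx \<sigma> differentiable (at z)"
  and diff_pdy: "z \<in> interior N \<Longrightarrow> pdy \<sigma> differentiable (at z)"
  using C2_sigma by (auto simp: C2_on_def)

lemma inner_grad: "grad \<sigma> z \<bullet> v = Re v * pdx \<sigma> z + Im v * pdy \<sigma> z"
  by (simp add: inner_complex_def grad_def)

lemma sigma_directional:
  assumes "z + s *\<^sub>R v \<in> interior N"
  shows "((\<lambda>t. \<sigma> (z + t *\<^sub>R v)) has_real_derivative (grad \<sigma> (z + s *\<^sub>R v) \<bullet> v)) (at s)"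
  using directional_derivative[OF diff_sigma[OF assms]] by (simp add: inner_grad)

text \<open>Convexity bounds the difference quotients along the segment from z to y, and the
  one-sided limit at z gives the slope. Only z has to be interior; comparison with boundary points y
  is what links the gradient to the boundary values.\<close>

lemma gradient_inequality:
  assumes z: "z \<in> interior N" and y: "y \<in> N"
  shows "\<sigma> z + grad \<sigma> z \<bullet> (y - z) \<le> \<sigma> y"
proof -
  have "((\<lambda>t. \<sigma> (z + t *\<^sub>R (y - z))) has_real_derivative (grad \<sigma> z \<bullet> (y - z))) (at 0)"
    using sigma_directional[of z 0 "y - z"] z by simp
  then have "((\<lambda>t. (\<sigma> (z + t *\<^sub>R (y - z)) - \<sigma> z) / t) \<longlongrightarrow> grad \<sigma> z \<bullet> (y - z)) (at 0)"
    by (simp add: has_field_derivative_iff)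
  then have "((\<lambda>t. (\<sigma> (z + t *\<^sub>R (y - z)) - \<sigma> z) / t) \<longlongrightarrow> grad \<sigma> z \<bullet> (y - z)) (at_right 0)"
    by (rule tendsto_within_subset) simp
  moreover have "\<forall>\<^sub>F t in at_right 0. (\<sigma> (z + t *\<^sub>R (y - z)) - \<sigma> z) / t \<le> \<sigma> y - \<sigma> z"
  proof -
    have "\<forall>\<^sub>F t in at_right 0. t \<in> {0<..<1::real}" by (rule eventually_at_right_real) simp
    then show ?thesis
    proof (rule eventually_mono)
      fix t :: real assume t: "t \<in> {0<..<1}"
      have zN: "z \<in> N" using z interior_subset by auto
      have "\<sigma> ((1 - t) *\<^sub>R z + t *\<^sub>R y) \<le> (1 - t) * \<sigma> z + t * \<sigma> y"
        by (rule convex_onD[OF convex_sigma]) (use t zN y in auto)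
      moreover have "(1 - t) *\<^sub>R z + t *\<^sub>R y = z + t *\<^sub>R (y - z)" by (simp add: algebra_simps)
      ultimately have "\<sigma> (z + t *\<^sub>R (y - z)) - \<sigma> z \<le> t * (\<sigma> y - \<sigma> z)"
        by (simp add: algebra_simps)
      then show "(\<sigma> (z + t *\<^sub>R (y - z)) - \<sigma> z) / t \<le> \<sigma> y - \<sigma> z"
        using t by (simp add: pos_divide_le_eq mult.commute)
    qed
  qed
  ultimately have "grad \<sigma> z \<bullet> (y - z) \<le> \<sigma> y - \<sigma> z"
    by (rule tendsto_upperbound) simp
  then show ?thesis by simp
qed

lemma gradient_monotone:
  assumes "z \<in> interior N" "w \<in> interior N"
  shows "(grad \<sigma> z - grad \<sigma> w) \<bullet> (z - w) \<ge> 0"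
proof -
  have "w \<in> N" "z \<in> N" using assms interior_subset by auto
  then show ?thesis
    using gradient_inequality[OF assms(1), of w] gradient_inequality[OF assms(2), of z]
    by (simp add: inner_diff_left inner_diff_right)
qed

text \<open>The Hessian as a bilinear form. One mixed derivative stands for both, by
  \<open>mixed_partials_commute\<close>.\<close>

definition hess :: "complex \<Rightarrow> complex \<Rightarrow> complex \<Rightarrow> real" where
  "hess z v u = Re v * Re u * pdx (pdx \<sigma>) z + (Re v * Im u + Im v * Re u) * pdx (pdy \<sigma>) z
     + Im v * Im u * pdy (pdy \<sigma>) z"

lemma hess_ac: "z \<in> interior N \<Longrightarrow> pdx (pdx \<sigma>) z * pdy (pdy \<sigma>) z - (pdx (pdy \<sigma>) z)\<^sup>2 = 1"
  using hess_det_sigma[of z] mixed_partials_commute[OF C2_sigma, of z]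
  by (simp add: hess_det_def power2_eq_square)

lemma grad_directional:
  assumes "z + s *\<^sub>R v \<in> interior N"
  shows "((\<lambda>t. grad \<sigma> (z + t *\<^sub>R v) \<bullet> u) has_real_derivative hess (z + s *\<^sub>R v) v u) (at s)"
proof -
  let ?p = "z + s *\<^sub>R v"
  have "((\<lambda>t. Re u * pdx \<sigma> (z + t *\<^sub>R v) + Im u * pdy \<sigma> (z + t *\<^sub>R v)) has_real_derivative
     (Re u * (Re v * pdx (pdx \<sigma>) ?p + Im v * pdy (pdx \<sigma>) ?p) + Im u * (Re v * pdx (pdy \<sigma>) ?p + Im v * pdy (pdy \<sigma>) ?p))) (at s)"
    by (intro DERIV_add DERIV_cmult directional_derivative diff_pdx diff_pdy assms)
  moreover have "Re u * (Re v * pdx (pdx \<sigma>) ?p + Im v * pdy (pdx \<sigma>) ?p) + Im u * (Re v * pdx (pdy \<sigma>) ?p + Im v * pdy (pdy \<sigma>) ?p)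
     = hess ?p v u"
    unfolding hess_def mixed_partials_commute[OF C2_sigma assms] by (simp add: algebra_simps)
  ultimately show ?thesis by (simp only: inner_grad)
qed

text \<open>A monotone gradient gives a nonnegative second x-derivative; the product of the two pure
  derivatives is 1 plus a square, so neither vanishes and the signs agree.\<close>

lemma pd_pos:
  assumes z: "z \<in> interior N"
  shows "pdx (pdx \<sigma>) z > 0" "pdy (pdy \<sigma>) z > 0"
proof -
  have "0 \<le> hess z 1 1"
  proof (rule ccontr)
    assume "\<not> 0 \<le> hess z 1 1"
    then have neg: "hess z 1 1 < 0" by simp
    have der: "((\<lambda>t. grad \<sigma> (z + t *\<^sub>R 1) \<bullet> 1) has_real_derivative hess z 1 1) (at 0)"
      using grad_directional[of z 0 1 1] z by simp
    obtain d where d: "d > 0" "\<And>h. 0 < h \<Longrightarrow> h < d \<Longrightarrow> grad \<sigma> (z + h *\<^sub>R 1) \<bullet> 1 < grad \<sigma> z \<bullet> 1"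
      using DERIV_neg_dec_right[OF der neg] by auto
    obtain e where e: "e > 0" "ball z e \<subseteq> interior N" using z by (meson open_interior openE)
    define h where "h = min d e / 2"
    have h: "0 < h" "h < d" "h < e" using d e by (auto simp: h_def)
    have "z + h *\<^sub>R 1 \<in> interior N" using h by (intro subsetD[OF e(2)]) (simp add: dist_norm)
    from gradient_monotone[OF this z] have "0 \<le> h * ((grad \<sigma> (z + h *\<^sub>R 1) - grad \<sigma> z) \<bullet> 1)" by simp
    then show False using d(2)[of h] h by (simp add: zero_le_mult_iff inner_diff_left)
  qed
  then have 1: "pdx (pdx \<sigma>) z \<ge> 0" by (simp add: hess_def)
  have "pdx (pdx \<sigma>) z * pdy (pdy \<sigma>) z > 0"
    using hess_ac[OF z] zero_le_power2[of "pdx (pdy \<sigma>) z"] by linarith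
  with 1 show "pdx (pdx \<sigma>) z > 0" "pdy (pdy \<sigma>) z > 0"
    by (auto simp: zero_less_mult_iff)
qed

text \<open>Multiplication by the positive second x-derivative completes the square, with the
  determinant 1 as the remaining coefficient.\<close>

lemma hess_pos:
  assumes z: "z \<in> interior N" and v: "v \<noteq> 0"
  shows "hess z v v > 0"
proof -
  define a b c where "a = pdx (pdx \<sigma>) z" and "b = pdx (pdy \<sigma>) z" and "c = pdy (pdy \<sigma>) z"
  have ac: "a * c - b\<^sup>2 = 1" "a > 0" using hess_ac[OF z] pd_pos[OF z] by (simp_all add: a_def b_def c_def)
  have "a * hess z v v = (a * Re v + b * Im v)\<^sup>2 + (a * c - b\<^sup>2) * (Im v)\<^sup>2"
    unfolding hess_def a_def[symmetric] b_def[symmetric] c_def[symmetric]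
    by (simp add: power2_eq_square algebra_simps)
  also have "\<dots> > 0"
  proof (cases "Im v = 0")
    case True then show ?thesis using v ac by (auto simp: complex_eq_iff)
  next
    case False then show ?thesis using ac by (simp add: add_nonneg_pos)
  qed
  finally show ?thesis using ac by (simp add: zero_less_mult_iff)
qed

text \<open>The determinant is the same in every orthonormal frame, and dropping the squared
  off-diagonal entry only increases it. This is the inequality that the barrier contradicts.\<close>

lemma hess_orthonormal:
  assumes z: "z \<in> interior N" and n: "cmod n = 1"
  shows "hess z n n * hess z (\<i> * n) (\<i> * n) \<ge> 1"
proof -
  define a b c where "a = pdx (pdx \<sigma>) z" and "b = pdx (pdy \<sigma>) z" and "c = pdy (pdy \<sigma>) z"
  have ac: "a * c - b\<^sup>2 = 1" using hess_ac[OF z] by (simp add: a_def b_def c_def)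
  have nn: "(Re n)\<^sup>2 + (Im n)\<^sup>2 = 1" using n by (simp add: cmod_def)
  have "hess z n n * hess z (\<i> * n) (\<i> * n) =
     (a * c - b\<^sup>2) * ((Re n)\<^sup>2 + (Im n)\<^sup>2)\<^sup>2 + (hess z n (\<i> * n))\<^sup>2"
    unfolding hess_def a_def[symmetric] b_def[symmetric] c_def[symmetric]
    by (simp add: power2_eq_square algebra_simps)
  then show ?thesis by (simp add: ac nn)
qed

section \<open>Boundary behaviour of the gradient along an affine edge\<close>

text \<open>Local edge data at y: n is an outward unit normal of a supporting line, r the
  half-length of a boundary segment centred at y, and a the slope of \<sigma> along it,
  counter-clockwise.\<close>

definition flat :: "complex \<Rightarrow> complex \<Rightarrow> real \<Rightarrow> real \<Rightarrow> bool" where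
  "flat y n r a \<longleftrightarrow> cmod n = 1 \<and> r > 0 \<and> (\<forall>z\<in>N. n \<bullet> z \<le> n \<bullet> y) \<and>
     (\<forall>t. \<bar>t\<bar> \<le> r \<longrightarrow> y + t *\<^sub>R (\<i> * n) \<in> N \<and> \<sigma> (y + t *\<^sub>R (\<i> * n)) = \<sigma> y + a * t)"

lemma inner_i_mult [simp]: "n \<bullet> (\<i> * n) = 0" "(\<i> * n) \<bullet> n = 0"
  by (simp_all add: inner_complex_def)

lemma flat_shift:
  assumes f: "flat y n r a" and t: "\<bar>t\<bar> < r"
  shows "flat (y + t *\<^sub>R (\<i> * n)) n (r - \<bar>t\<bar>) a"
proof -
  have "y + t *\<^sub>R (\<i> * n) + s *\<^sub>R (\<i> * n) \<in> N \<and>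
      \<sigma> (y + t *\<^sub>R (\<i> * n) + s *\<^sub>R (\<i> * n)) = \<sigma> (y + t *\<^sub>R (\<i> * n)) + a * s"
    if s: "\<bar>s\<bar> \<le> r - \<bar>t\<bar>" for s
  proof -
    have "\<bar>t + s\<bar> \<le> r" "\<bar>t\<bar> \<le> r" using s t by linarith+
    then have "y + (t + s) *\<^sub>R (\<i> * n) \<in> N" "\<sigma> (y + (t + s) *\<^sub>R (\<i> * n)) = \<sigma> y + a * (t + s)"
      "\<sigma> (y + t *\<^sub>R (\<i> * n)) = \<sigma> y + a * t"
      using f unfolding flat_def by blast+
    then show ?thesis by (simp add: algebra_simps)
  qed
  then show ?thesis using f t unfolding flat_def by (simp add: inner_add_right)
qed

lemma sigma_bounded: obtains M where "M > 0" "\<And>z. z \<in> N \<Longrightarrow> \<bar>\<sigma> z\<bar> \<le> M"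
proof -
  have "compact (\<sigma> ` N)" using cont_sigma compact_N by (rule compact_continuous_image)
  then have "bounded (\<sigma> ` N)" by (rule compact_imp_bounded)
  then show ?thesis using that by (auto simp: bounded_pos)
qed


lemma cont_on_N_within: "z \<in> N \<Longrightarrow> (\<sigma> \<longlongrightarrow> \<sigma> z) (at z within N)"
  using cont_sigma by (simp add: continuous_on_def)

lemma flat_box:
  assumes f: "flat y n r a" and r: "0 < \<rho>" "\<rho> < r"
  obtains h where "h > 0" "\<And>t \<eta>. \<bar>t\<bar> \<le> \<rho> \<Longrightarrow> 0 < \<eta> \<Longrightarrow> \<eta> \<le> h \<Longrightarrow> y + t *\<^sub>R (\<i> * n) - \<eta> *\<^sub>R n \<in> interior N"
proof -
  obtain c where c: "c \<in> interior N" using interior_N by auto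
  show thesis
    by (rule interior_box[OF convex_N c _ _ _ r, of n y]) (use f that in \<open>auto simp: flat_def\<close>)
qed

text \<open>If \<open>\<sigma>\<close> is affine along an edge, its slope towards the edge is infinite: after adding a
  multiple \<open>K\<eta>\<close> of the distance to the edge, \<open>C\<eta>(t\<^sup>2/\<rho>\<^sup>2 + (\<eta>/h)\<^sup>\<beta>)\<close> is for
  small \<open>\<beta>\<close> an upper barrier, because at an interior maximum of the difference the product of
  the two second derivatives would be less than 1.\<close>

lemma flat_steep:
  assumes f: "flat y n r a" and h0: "h0 > 0"
  shows "\<exists>\<eta>. 0 < \<eta> \<and> \<eta> < h0 \<and> y - \<eta> *\<^sub>R n \<in> interior N \<and> \<sigma> (y - \<eta> *\<^sub>R n) < \<sigma> y - K * \<eta>"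
proof -
  define \<rho> where "\<rho> = r / 2"
  have r: "r > 0" and n: "cmod n = 1" using f by (auto simp: flat_def)
  have \<rho>: "0 < \<rho>" "\<rho> < r" using r by (auto simp: \<rho>_def)
  obtain h where h: "h > 0"
    and box: "\<And>t \<eta>. \<bar>t\<bar> \<le> \<rho> \<Longrightarrow> 0 < \<eta> \<Longrightarrow> \<eta> \<le> h \<Longrightarrow> y + t *\<^sub>R (\<i> * n) - \<eta> *\<^sub>R n \<in> interior N"
    using flat_box[OF f \<rho>] by blast
  obtain M where M: "M > 0" "\<And>z. z \<in> N \<Longrightarrow> \<bar>\<sigma> z\<bar> \<le> M" using sigma_bounded by blast
  define P where "P = (\<lambda>t \<eta>::real. y + t *\<^sub>R (\<i> * n) - \<eta> *\<^sub>R n)"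
  have P0: "P t 0 = y + t *\<^sub>R (\<i> * n)" for t by (simp add: P_def)
  have edge: "P t 0 \<in> N" "\<sigma> (P t 0) = \<sigma> y + a * t" if "\<bar>t\<bar> \<le> \<rho>" for t
    unfolding P0 using f that \<rho> by (auto simp: flat_def)
  have PI: "P t \<eta> \<in> interior N" if "\<bar>t\<bar> \<le> \<rho>" "0 < \<eta>" "\<eta> \<le> h" for t \<eta>
    unfolding P_def by (rule box[OF that])
  have PN: "P t \<eta> \<in> N" if "\<bar>t\<bar> \<le> \<rho>" "0 \<le> \<eta>" "\<eta> \<le> h" for t \<eta>
    using PI[of t \<eta>] edge(1)[of t] that interior_subset by (cases "\<eta> = 0") auto
  have yN: "y \<in> N" using edge(1)[of 0] \<rho> by (simp add: P0)
  \<comment> \<open>After subtraction of the affine boundary values s vanishes on the edge. The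
    coefficient K + 1 instead of K leaves a margin \<eta>, which yields a strict inequality at the
    end.\<close>
  define s where "s = (\<lambda>t \<eta>. \<sigma> (P t \<eta>) - \<sigma> y - a * t + (K + 1) * \<eta>)"
  \<comment> \<open>The constant of the crude linear bound
    \<open>s t \<eta> \<le> C * \<eta>\<close>, from the chord of \<sigma> between the edge and
    depth h; the last summand makes it positive.\<close>
  define C where "C = (2 * M + \<bar>a\<bar> * \<rho>) / h + \<bar>K + 1\<bar> + 1"
  have C: "C > 0" unfolding C_def using M h \<rho> by (intro add_nonneg_pos add_nonneg_nonneg divide_nonneg_pos) auto
  have s_le: "s t \<eta> \<le> C * \<eta>" if t: "\<bar>t\<bar> \<le> \<rho>" and \<eta>: "0 \<le> \<eta>" "\<eta> \<le> h" for t \<eta>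
  proof -
    have hh: "\<eta> / h \<ge> 0" "\<eta> / h \<le> 1" using \<eta> h by auto
    have "P t \<eta> = (1 - \<eta> / h) *\<^sub>R P t 0 + (\<eta> / h) *\<^sub>R P t h"
      unfolding P_def using h by (simp add: algebra_simps)
    then have "\<sigma> (P t \<eta>) \<le> (1 - \<eta> / h) * \<sigma> (P t 0) + (\<eta> / h) * \<sigma> (P t h)"
      using convex_onD[OF convex_sigma hh edge(1)[OF t] PN[OF t, of h]] h by simp
    then have "s t \<eta> \<le> (\<eta> / h) * (\<sigma> (P t h) - \<sigma> y - a * t) + (K + 1) * \<eta>"
      unfolding s_def edge(2)[OF t] by (simp add: algebra_simps)
    also have "\<dots> \<le> (\<eta> / h) * (2 * M + \<bar>a\<bar> * \<rho>) + \<bar>K + 1\<bar> * \<eta>"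
    proof (intro add_mono mult_left_mono mult_right_mono)
      have "\<bar>a * t\<bar> \<le> \<bar>a\<bar> * \<rho>" using t by (simp add: abs_mult mult_left_mono)
      then show "\<sigma> (P t h) - \<sigma> y - a * t \<le> 2 * M + \<bar>a\<bar> * \<rho>"
        using M(2)[OF PN[OF t, of h]] M(2)[OF yN] h by linarith
    qed (use hh \<eta> in auto)
    also have "\<dots> \<le> C * \<eta>" using \<eta> by (simp add: C_def algebra_simps add_divide_distrib)
    finally show ?thesis .
  qed
  \<comment> \<open>So small that \<open>4 * C\<^sup>2 * \<beta> / \<rho>\<^sup>2\<close> is at most
    1/2; this number will bound the product of the second derivatives of the barrier.\<close>
  define \<beta> where "\<beta> = min (1/2) (\<rho>\<^sup>2 / (8 * C\<^sup>2))"
  have \<beta>: "0 < \<beta>" "\<beta> < 1" "8 * C\<^sup>2 * \<beta> \<le> \<rho>\<^sup>2"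
  proof -
    show "0 < \<beta>" "\<beta> < 1" using \<rho> C by (auto simp: \<beta>_def)
    have "\<beta> \<le> \<rho>\<^sup>2 / (8 * C\<^sup>2)" by (simp add: \<beta>_def)
    then show "8 * C\<^sup>2 * \<beta> \<le> \<rho>\<^sup>2" using C by (simp add: field_simps)
  qed
  define D where "D = C * h powr (- \<beta>)"
  have D: "D > 0" using C h by (simp add: D_def)
  \<comment> \<open>The first term equals \<open>C * \<eta>\<close> on the lateral sides, and by the
    choice of D the second one equals \<open>C * \<eta>\<close> at depth h, so B dominates s on the
    whole boundary of the rectangle.\<close>
  define B where "B = (\<lambda>t \<eta>. C * \<eta> * t\<^sup>2 / \<rho>\<^sup>2 + D * \<eta> powr (1 + \<beta>))"
  have Dh: "D * h powr (1 + \<beta>) = C * h"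
    using h by (simp add: D_def powr_add powr_minus field_simps)
  have Bnn: "B t \<eta> \<ge> 0" if "\<eta> \<ge> 0" for t \<eta>
    unfolding B_def using C D that by (intro add_nonneg_nonneg) auto
  have main: "s t \<eta> \<le> B t \<eta>" if t: "\<bar>t\<bar> \<le> \<rho>" and \<eta>: "0 \<le> \<eta>" "\<eta> \<le> h" for t \<eta>
  proof (rule ccontr)
    assume neg: "\<not> s t \<eta> \<le> B t \<eta>"
    let ?Q = "{-\<rho>..\<rho>} \<times> {0..h}"
    define G where "G = (\<lambda>p. s (fst p) (snd p) - B (fst p) (snd p))"
    have contG: "continuous_on ?Q G"
    proof -
      have "continuous_on ?Q (\<lambda>p. \<sigma> (P (fst p) (snd p)))"
        by (rule continuous_on_compose2[OF cont_sigma])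
           (auto simp: P_def intro!: continuous_intros PN[unfolded P_def])
      moreover define pw where "pw = (\<lambda>p :: real \<times> real. snd p powr (1 + \<beta>))"
      have "continuous_on ?Q pw"
        unfolding pw_def by (rule continuous_on_powr') (use \<beta> in \<open>auto intro!: continuous_intros\<close>)
      ultimately show ?thesis
        unfolding G_def s_def B_def fun_cong[OF pw_def, symmetric] using \<rho> by (intro continuous_intros) auto
    qed
    have "compact ?Q" by (intro compact_Times) auto
    moreover have tQ: "(t, \<eta>) \<in> ?Q" using t \<eta> by auto
    ultimately obtain q where q: "q \<in> ?Q" "\<And>p. p \<in> ?Q \<Longrightarrow> G p \<le> G q"
      using continuous_attains_sup[OF _ _ contG] by blast
    obtain t0 e0 where q_eq: "q = (t0, e0)" by (cases q)
    have t0: "\<bar>t0\<bar> \<le> \<rho>" and e0: "0 \<le> e0" "e0 \<le> h" using q(1) by (auto simp: q_eq)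
    have pos: "s t0 e0 > B t0 e0"
      using q(2)[OF tQ] neg by (simp add: G_def q_eq)
    have mx: "s t e - B t e \<le> s t0 e0 - B t0 e0" if "\<bar>t\<bar> \<le> \<rho>" "0 \<le> e" "e \<le> h" for t e
      using q(2)[of "(t, e)"] that by (auto simp: G_def q_eq abs_le_iff)
    have "e0 \<noteq> 0"
    proof
      assume "e0 = 0"
      then have "s t0 e0 = 0" using edge(2)[OF t0] by (simp add: s_def)
      then show False using pos Bnn[of e0 t0] e0 by simp
    qed
    moreover have "e0 \<noteq> h"
    proof
      assume e: "e0 = h"
      then have "B t0 e0 \<ge> C * h" unfolding B_def e Dh using C h by simp
      then show False using pos s_le[OF t0 e0] e by simp
    qed
    moreover have "\<bar>t0\<bar> \<noteq> \<rho>"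
    proof
      assume "\<bar>t0\<bar> = \<rho>"
      then have "t0\<^sup>2 = \<rho>\<^sup>2" by (metis power2_abs)
      then have "B t0 e0 \<ge> C * e0" unfolding B_def using \<rho> D by simp
      then show False using pos s_le[OF t0 e0] by simp
    qed
    ultimately have int: "\<bar>t0\<bar> < \<rho>" "0 < e0" "e0 < h" using t0 e0 by auto
    have P1: "P t e = (y - e *\<^sub>R n) + t *\<^sub>R (\<i> * n)" for t e by (simp add: P_def algebra_simps)
    have P2: "P t e = (y + t *\<^sub>R (\<i> * n)) + e *\<^sub>R (- n)" for t e by (simp add: P_def)
    note z0 = PI[OF t0 int(2) e0(2)]
    have tt: "hess (P t0 e0) (\<i> * n) (\<i> * n) - 2 * C * e0 / \<rho>\<^sup>2 \<le> 0"
    proof (rule second_derivative_local_max)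
      show "\<rho> - \<bar>t0\<bar> > 0" using int by simp
      fix t assume "\<bar>t - t0\<bar> < \<rho> - \<bar>t0\<bar>"
      then have t: "\<bar>t\<bar> \<le> \<rho>" by linarith
      show "s t e0 - B t e0 \<le> s t0 e0 - B t0 e0" by (rule mx[OF t e0])
      have "((\<lambda>t. \<sigma> (P t e0)) has_real_derivative grad \<sigma> (P t e0) \<bullet> (\<i> * n)) (at t)"
        unfolding P1 by (rule sigma_directional) (use PI[OF t int(2) e0(2)] in \<open>simp add: P1\<close>)
      then show "((\<lambda>t. s t e0 - B t e0) has_real_derivative
          grad \<sigma> (P t e0) \<bullet> (\<i> * n) - a - 2 * C * e0 * t / \<rho>\<^sup>2) (at t)"
        unfolding s_def B_def using \<rho> by (auto intro!: derivative_eq_intros simp: power2_eq_square)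
    next
      have "((\<lambda>t. grad \<sigma> (P t e0) \<bullet> (\<i> * n)) has_real_derivative hess (P t0 e0) (\<i> * n) (\<i> * n)) (at t0)"
        unfolding P1 by (rule grad_directional) (use z0 in \<open>simp add: P1\<close>)
      then show "((\<lambda>t. grad \<sigma> (P t e0) \<bullet> (\<i> * n) - a - 2 * C * e0 * t / \<rho>\<^sup>2) has_real_derivative
          hess (P t0 e0) (\<i> * n) (\<i> * n) - 2 * C * e0 / \<rho>\<^sup>2) (at t0)"
        using \<rho> by (auto intro!: derivative_eq_intros simp: power2_eq_square power4_eq_xxxx)
    qed
    have ee: "hess (P t0 e0) (- n) (- n) - D * ((1 + \<beta>) * (\<beta> * e0 powr (\<beta> - 1))) \<le> 0"
    proof (rule second_derivative_local_max)
      show "min e0 (h - e0) > 0" using int by simp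
      fix e assume "\<bar>e - e0\<bar> < min e0 (h - e0)"
      then have e: "0 < e" "e \<le> h" by linarith+
      show "s t0 e - B t0 e \<le> s t0 e0 - B t0 e0" by (rule mx[OF t0]) (use e in auto)
      have 1: "((\<lambda>e. \<sigma> (P t0 e)) has_real_derivative grad \<sigma> (P t0 e) \<bullet> (- n)) (at e)"
        unfolding P2 by (rule sigma_directional) (use PI[OF t0 e] in \<open>simp add: P2\<close>)
      have 2: "((\<lambda>e. e powr (1 + \<beta>)) has_real_derivative (1 + \<beta>) * e powr \<beta>) (at e)"
        using has_real_derivative_powr[OF e(1), of "1 + \<beta>"] by simp
      show "((\<lambda>e. s t0 e - B t0 e) has_real_derivative
          grad \<sigma> (P t0 e) \<bullet> (- n) + (K + 1) - C * t0\<^sup>2 / \<rho>\<^sup>2 - D * ((1 + \<beta>) * e powr \<beta>)) (at e)"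
      proof -
        have "((\<lambda>e. (\<sigma> (P t0 e) + ((K + 1) - C * t0\<^sup>2 / \<rho>\<^sup>2) * e - (\<sigma> y + a * t0)) - D * (e powr (1 + \<beta>)))
          has_real_derivative (grad \<sigma> (P t0 e) \<bullet> (- n) + ((K + 1) - C * t0\<^sup>2 / \<rho>\<^sup>2) * 1 - 0) - D * ((1 + \<beta>) * e powr \<beta>)) (at e)"
          by (intro DERIV_diff DERIV_add DERIV_cmult 1 2 DERIV_const DERIV_ident)
        moreover have "(\<lambda>e. (\<sigma> (P t0 e) + ((K + 1) - C * t0\<^sup>2 / \<rho>\<^sup>2) * e - (\<sigma> y + a * t0)) - D * (e powr (1 + \<beta>)))
          = (\<lambda>e. s t0 e - B t0 e)"
          by (simp add: s_def B_def fun_eq_iff algebra_simps)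
        moreover have "(grad \<sigma> (P t0 e) \<bullet> (- n) + ((K + 1) - C * t0\<^sup>2 / \<rho>\<^sup>2) * 1 - 0) - D * ((1 + \<beta>) * e powr \<beta>)
          = grad \<sigma> (P t0 e) \<bullet> (- n) + (K + 1) - C * t0\<^sup>2 / \<rho>\<^sup>2 - D * ((1 + \<beta>) * e powr \<beta>)"
          by simp
        ultimately show ?thesis by (simp only:)
      qed
    next
      have 1: "((\<lambda>e. grad \<sigma> (P t0 e) \<bullet> (- n)) has_real_derivative hess (P t0 e0) (- n) (- n)) (at e0)"
        unfolding P2 by (rule grad_directional) (use z0 in \<open>simp add: P2\<close>)
      have 2: "((\<lambda>e. e powr \<beta>) has_real_derivative \<beta> * e0 powr (\<beta> - 1)) (at e0)"
        using has_real_derivative_powr[OF int(2), of \<beta>] by simp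
      show "((\<lambda>e. grad \<sigma> (P t0 e) \<bullet> (- n) + (K + 1) - C * t0\<^sup>2 / \<rho>\<^sup>2 - D * ((1 + \<beta>) * e powr \<beta>)) has_real_derivative
          hess (P t0 e0) (- n) (- n) - D * ((1 + \<beta>) * (\<beta> * e0 powr (\<beta> - 1)))) (at e0)"
      proof -
        have "((\<lambda>e. grad \<sigma> (P t0 e) \<bullet> (- n) + (K + 1) - C * t0\<^sup>2 / \<rho>\<^sup>2 - D * ((1 + \<beta>) * e powr \<beta>)) has_real_derivative
          hess (P t0 e0) (- n) (- n) + 0 - 0 - D * ((1 + \<beta>) * (\<beta> * e0 powr (\<beta> - 1)))) (at e0)"
          by (intro DERIV_diff DERIV_add DERIV_cmult 1 2 DERIV_const)
        then show ?thesis by (simp only: add_0_right diff_0_right)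
      qed
    qed
    have nn: "hess (P t0 e0) (- n) (- n) = hess (P t0 e0) n n" by (simp add: hess_def)
    have n0: "n \<noteq> 0" using n by auto
    \<comment> \<open>At the interior maximum each pure second derivative of \<sigma> is at most
      that of B. One of them is proportional to e0, the other to e0 to the power \<beta> - 1, so the
      product is of order e0 to the power \<beta> and stays bounded.\<close>
    have "1 \<le> hess (P t0 e0) n n * hess (P t0 e0) (\<i> * n) (\<i> * n)"
      by (rule hess_orthonormal[OF z0 n])
    also have "\<dots> \<le> (D * ((1 + \<beta>) * (\<beta> * e0 powr (\<beta> - 1)))) * (2 * C * e0 / \<rho>\<^sup>2)"
      using tt ee hess_pos[OF z0 n0] hess_pos[OF z0, of "\<i> * n"] n0 unfolding nn
      by (intro mult_mono) auto
    also have "\<dots> = (e0 powr (\<beta> - 1) * e0) * D * (2 * C * (1 + \<beta>) * \<beta> / \<rho>\<^sup>2)"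
      by (simp add: field_simps)
    also have "e0 powr (\<beta> - 1) * e0 = e0 powr \<beta>"
      using int(2) by (simp add: powr_diff)
    also have "e0 powr \<beta> * D = C * (e0 / h) powr \<beta>"
      using int(2) h by (simp add: D_def powr_divide powr_minus field_simps)
    also have "C * (e0 / h) powr \<beta> * (2 * C * (1 + \<beta>) * \<beta> / \<rho>\<^sup>2) \<le> C * 1 * (2 * C * 2 * \<beta> / \<rho>\<^sup>2)"
    proof (intro mult_mono)
      show "(e0 / h) powr \<beta> \<le> 1" using int h \<beta> by (intro powr_le1) auto
      show "2 * C * (1 + \<beta>) * \<beta> / \<rho>\<^sup>2 \<le> 2 * C * 2 * \<beta> / \<rho>\<^sup>2"
        using \<beta> C \<rho> by (intro divide_right_mono mult_right_mono mult_left_mono) auto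
    qed (use C \<beta> \<rho> in auto)
    also have "\<dots> = 4 * C\<^sup>2 * \<beta> / \<rho>\<^sup>2" by (simp add: power2_eq_square)
    also have "\<dots> \<le> (\<rho>\<^sup>2 / 2) / \<rho>\<^sup>2" using \<beta>(3) by (intro divide_right_mono) auto
    also have "\<dots> < 1" using \<rho> by simp
    finally show False by simp
  qed
  \<comment> \<open>On the inward normal t = 0 only the second term of B is left, and it is
    o(\<eta>).\<close>
  have "((\<lambda>\<eta>. D * \<eta> powr \<beta>) \<longlongrightarrow> D * 0 powr \<beta>) (at_right 0)"
    by (intro tendsto_intros tendsto_powr' tendsto_ident_at) (use \<beta> in \<open>auto simp: eventually_at_right_less eventually_at intro: exI[of _ 1]\<close>)
  then have "((\<lambda>\<eta>. D * \<eta> powr \<beta>) \<longlongrightarrow> 0) (at_right 0)" using \<beta> by simp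
  then have "\<forall>\<^sub>F \<eta> in at_right 0. D * \<eta> powr \<beta> < 1" by (rule order_tendstoD) simp
  moreover have "\<forall>\<^sub>F \<eta> in at_right 0. \<eta> \<in> {0<..<min h h0}"
    by (rule eventually_at_right_real) (use h h0 in auto)
  ultimately have "\<forall>\<^sub>F \<eta> in at_right (0::real). D * \<eta> powr \<beta> < 1 \<and> \<eta> \<in> {0<..<min h h0}" by eventually_elim auto
  then obtain \<eta> where \<eta>: "D * \<eta> powr \<beta> < 1" "0 < \<eta>" "\<eta> < h" "\<eta> < h0"
    using eventually_happens'[OF trivial_limit_at_right_real] by (metis (no_types, lifting) greaterThanLessThan_iff min_less_iff_conj)
  have "s 0 \<eta> \<le> D * \<eta> powr \<beta> * \<eta>"
    using main[of 0 \<eta>] \<rho> \<eta> by (simp add: B_def powr_add mult_ac)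
  also have "\<dots> < 1 * \<eta>" using \<eta> by (intro mult_strict_right_mono) auto
  finally have "\<sigma> (y - \<eta> *\<^sub>R n) < \<sigma> y - K * \<eta>" by (simp add: s_def P_def algebra_simps)
  moreover have "y - \<eta> *\<^sub>R n \<in> interior N" using PI[of 0 \<eta>] \<rho> \<eta> by (simp add: P_def)
  ultimately show ?thesis using \<eta> by blast
qed


lemma flatD:
  assumes "flat y n r a"
  shows "cmod n = 1" "r > 0" "\<And>z. z \<in> N \<Longrightarrow> n \<bullet> z \<le> n \<bullet> y" "y \<in> N"
    "\<And>t. \<bar>t\<bar> \<le> r \<Longrightarrow> y + t *\<^sub>R (\<i> * n) \<in> N"
    "\<And>t. \<bar>t\<bar> \<le> r \<Longrightarrow> \<sigma> (y + t *\<^sub>R (\<i> * n)) = \<sigma> y + a * t"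
proof -
  show 5: "\<And>t. \<bar>t\<bar> \<le> r \<Longrightarrow> y + t *\<^sub>R (\<i> * n) \<in> N" and r: "r > 0"
    using assms unfolding flat_def by blast+
  show "y \<in> N" using 5[of 0] r by simp
qed (use assms in \<open>auto simp: flat_def\<close>)

text \<open>Gradients are estimated by comparing z with translates of z, and these must stay in N
  uniformly for z near y. The bound r/4 on the distance and r/2 on the shift add up to 3r/4 <
  r.\<close>

lemma flat_near:
  assumes f: "flat y n r a"
  obtains h where "h > 0" "h \<le> r / 4"
    "\<And>z t \<eta>. z \<in> interior N \<Longrightarrow> cmod (z - y) < h \<Longrightarrow> \<bar>t\<bar> \<le> r / 2 \<Longrightarrow> 0 \<le> \<eta> \<Longrightarrow> \<eta> \<le> h
       \<Longrightarrow> z + t *\<^sub>R (\<i> * n) - \<eta> *\<^sub>R n \<in> interior N"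
proof -
  note fD = flatD[OF f]
  obtain h0 where h0: "h0 > 0" and box: "\<And>t \<eta>. \<bar>t\<bar> \<le> 3 * r / 4 \<Longrightarrow> 0 < \<eta> \<Longrightarrow> \<eta> \<le> h0 \<Longrightarrow> y + t *\<^sub>R (\<i> * n) - \<eta> *\<^sub>R n \<in> interior N"
    using flat_box[OF f, of "3 * r / 4"] fD(2) by auto
  show thesis
  proof (rule that[of "min (r / 4) (h0 / 2)"])
    fix z t \<eta> assume z: "z \<in> interior N" and d: "cmod (z - y) < min (r / 4) (h0 / 2)" and t: "\<bar>t\<bar> \<le> r / 2"
      and \<eta>: "0 \<le> \<eta>" "\<eta> \<le> min (r / 4) (h0 / 2)"
    define u where "u = (\<i> * n) \<bullet> (z - y)"
    define v where "v = - (n \<bullet> (z - y))"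
    have "z - y = u *\<^sub>R (\<i> * n) - v *\<^sub>R n"
      using frame_expand[OF fD(1), of "z - y"] by (simp add: u_def v_def)
    then have zz: "z + t *\<^sub>R (\<i> * n) - \<eta> *\<^sub>R n = y + (u + t) *\<^sub>R (\<i> * n) - (v + \<eta>) *\<^sub>R n"
      by (simp add: algebra_simps)
    have "v > 0" using interior_below_support[OF z fD(1) fD(3)] by (simp add: v_def inner_diff_right)
    moreover have "\<bar>u\<bar> \<le> cmod (z - y)" "\<bar>v\<bar> \<le> cmod (z - y)"
      using Cauchy_Schwarz_ineq2[of "\<i> * n" "z - y"] Cauchy_Schwarz_ineq2[of n "z - y"] fD(1)
      by (auto simp: u_def v_def norm_mult)
    ultimately show "z + t *\<^sub>R (\<i> * n) - \<eta> *\<^sub>R n \<in> interior N"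
      unfolding zz using d t \<eta> by (intro box) (auto simp: abs_if split: if_splits)
  qed (use h0 fD(2) in auto)
qed

lemma eventually_near_within:
  fixes y :: complex
  assumes "h > 0" shows "\<forall>\<^sub>F z in at y within S. z \<in> S \<and> cmod (z - y) < h"
  unfolding eventually_at using assms by (auto simp: dist_norm)

lemma sigma_shift_tendsto:
  assumes "y + v \<in> N" "\<forall>\<^sub>F z in at y within S. z + v \<in> N"
  shows "((\<lambda>z. \<sigma> (z + v)) \<longlongrightarrow> \<sigma> (y + v)) (at y within S)"
  by (rule continuous_on_tendsto_compose[OF cont_sigma]) (use assms in \<open>auto intro!: tendsto_intros\<close>)

text \<open>The gradient inequality places the tangential slope at z between the two difference
  quotients of step r/2. Both tend to a, because \<sigma> is continuous up to the edge and affine on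
  it.\<close>

lemma flat_grad_tangential:
  assumes f: "flat y n r a"
  shows "((\<lambda>z. grad \<sigma> z \<bullet> (\<i> * n)) \<longlongrightarrow> a) (at y within interior N)"
proof -
  note fD = flatD[OF f]
  obtain h where h: "h > 0" "h \<le> r / 4" and box: "\<And>z t \<eta>. z \<in> interior N \<Longrightarrow> cmod (z - y) < h \<Longrightarrow> \<bar>t\<bar> \<le> r / 2 \<Longrightarrow> 0 \<le> \<eta> \<Longrightarrow> \<eta> \<le> h
       \<Longrightarrow> z + t *\<^sub>R (\<i> * n) - \<eta> *\<^sub>R n \<in> interior N"
    using flat_near[OF f] by blast
  let ?v = "(r / 2) *\<^sub>R (\<i> * n)"
  have nr: "z + ?v \<in> N \<and> z + - ?v \<in> N" if "z \<in> interior N \<and> cmod (z - y) < h" for z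
    using box[of z "r/2" 0] box[of z "- r/2" 0] that fD(2) h interior_subset[of N] by auto
  note ev = eventually_near_within[OF h(1), where y=y and S="interior N"]
  have ev1: "\<forall>\<^sub>F z in at y within interior N. z + ?v \<in> N" and ev2: "\<forall>\<^sub>F z in at y within interior N. z + - ?v \<in> N"
    using ev nr by (auto elim!: eventually_mono)
  have e1: "y + ?v \<in> N" "\<sigma> (y + ?v) = \<sigma> y + a * (r/2)"
    using fD(5)[of "r/2"] fD(6)[of "r/2"] fD(2) by auto
  have e2: "y + - ?v \<in> N" "\<sigma> (y + - ?v) = \<sigma> y - a * (r/2)"
    using fD(5)[of "- (r/2)"] fD(6)[of "- (r/2)"] fD(2) by auto
  have L0: "(\<sigma> \<longlongrightarrow> \<sigma> y) (at y within interior N)"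
    using cont_on_N_within[OF fD(4)] interior_subset by (rule tendsto_within_subset)
  have L1: "((\<lambda>z. (\<sigma> (z + ?v) - \<sigma> z) / (r/2)) \<longlongrightarrow> (\<sigma> (y + ?v) - \<sigma> y) / (r/2)) (at y within interior N)"
    by (intro tendsto_intros sigma_shift_tendsto e1 ev1 L0) (use fD(2) in auto)
  have L2: "((\<lambda>z. (\<sigma> z - \<sigma> (z + - ?v)) / (r/2)) \<longlongrightarrow> (\<sigma> y - \<sigma> (y + - ?v)) / (r/2)) (at y within interior N)"
    by (intro tendsto_intros sigma_shift_tendsto e2 ev2 L0) (use fD(2) in auto)
  show ?thesis
  proof (rule tendsto_sandwich)
    show "\<forall>\<^sub>F z in at y within interior N. (\<sigma> z - \<sigma> (z + - ?v)) / (r/2) \<le> grad \<sigma> z \<bullet> (\<i> * n)"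
      using ev
    proof (rule eventually_mono)
      fix z assume z: "z \<in> interior N \<and> cmod (z - y) < h"
      have "\<sigma> z + grad \<sigma> z \<bullet> (z + - ?v - z) \<le> \<sigma> (z + - ?v)"
        by (rule gradient_inequality) (use z nr[OF z] in auto)
      then show "(\<sigma> z - \<sigma> (z + - ?v)) / (r/2) \<le> grad \<sigma> z \<bullet> (\<i> * n)"
        using fD(2) by (simp add: field_simps)
    qed
    show "\<forall>\<^sub>F z in at y within interior N. grad \<sigma> z \<bullet> (\<i> * n) \<le> (\<sigma> (z + ?v) - \<sigma> z) / (r/2)"
      using ev
    proof (rule eventually_mono)
      fix z assume z: "z \<in> interior N \<and> cmod (z - y) < h"
      have "\<sigma> z + grad \<sigma> z \<bullet> (z + ?v - z) \<le> \<sigma> (z + ?v)"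
        by (rule gradient_inequality) (use z nr[OF z] in auto)
      then show "grad \<sigma> z \<bullet> (\<i> * n) \<le> (\<sigma> (z + ?v) - \<sigma> z) / (r/2)"
        using fD(2) by (simp add: field_simps)
    qed
    show "((\<lambda>z. (\<sigma> z - \<sigma> (z + - ?v)) / (r/2)) \<longlongrightarrow> a) (at y within interior N)"
      using L2 fD(2) unfolding e2 by simp
    show "((\<lambda>z. (\<sigma> (z + ?v) - \<sigma> z) / (r/2)) \<longlongrightarrow> a) (at y within interior N)"
      using L1 fD(2) unfolding e1 by simp
  qed
qed

text \<open>One inward point at which \<sigma> has dropped by more than K times the depth suffices:
  by continuity the drop persists for starting points z near y, and the gradient inequality makes
  the normal slope at z exceed K.\<close>

lemma flat_grad_normal:
  assumes f: "flat y n r a"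
  shows "filterlim (\<lambda>z. grad \<sigma> z \<bullet> n) at_top (at y within interior N)"
  unfolding filterlim_at_top_dense
proof
  fix K :: real
  note fD = flatD[OF f]
  obtain h where h: "h > 0" "h \<le> r / 4" and box: "\<And>z t \<eta>. z \<in> interior N \<Longrightarrow> cmod (z - y) < h \<Longrightarrow> \<bar>t\<bar> \<le> r / 2 \<Longrightarrow> 0 \<le> \<eta> \<Longrightarrow> \<eta> \<le> h
       \<Longrightarrow> z + t *\<^sub>R (\<i> * n) - \<eta> *\<^sub>R n \<in> interior N"
    using flat_near[OF f] by blast
  obtain \<eta> where \<eta>: "0 < \<eta>" "\<eta> < h" and yI: "y - \<eta> *\<^sub>R n \<in> interior N" and st: "\<sigma> (y - \<eta> *\<^sub>R n) < \<sigma> y - K * \<eta>"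
    using flat_steep[OF f h(1)] by blast
  have nr: "z + - \<eta> *\<^sub>R n \<in> N" if "z \<in> interior N \<and> cmod (z - y) < h" for z
    using box[of z 0 \<eta>] that fD(2) \<eta> interior_subset[of N] by auto
  note ev = eventually_near_within[OF h(1), where y=y and S="interior N"]
  have ev1: "\<forall>\<^sub>F z in at y within interior N. z + - \<eta> *\<^sub>R n \<in> N"
    using ev nr by (auto elim!: eventually_mono)
  have L0: "(\<sigma> \<longlongrightarrow> \<sigma> y) (at y within interior N)"
    using cont_on_N_within[OF fD(4)] interior_subset by (rule tendsto_within_subset)
  have "((\<lambda>z. \<sigma> (z + - \<eta> *\<^sub>R n) - \<sigma> z) \<longlongrightarrow> \<sigma> (y + - \<eta> *\<^sub>R n) - \<sigma> y) (at y within interior N)"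
    by (intro tendsto_intros sigma_shift_tendsto ev1 L0) (use yI interior_subset[of N] in auto)
  then have "\<forall>\<^sub>F z in at y within interior N. \<sigma> (z + - \<eta> *\<^sub>R n) - \<sigma> z < - K * \<eta>"
    by (rule order_tendstoD) (use st in auto)
  with ev show "\<forall>\<^sub>F z in at y within interior N. K < grad \<sigma> z \<bullet> n"
  proof eventually_elim
    case (elim z)
    have "\<sigma> z + grad \<sigma> z \<bullet> (z + - \<eta> *\<^sub>R n - z) \<le> \<sigma> (z + - \<eta> *\<^sub>R n)"
      by (rule gradient_inequality) (use elim nr in auto)
    then have "\<eta> * K < \<eta> * (grad \<sigma> z \<bullet> n)" using elim by (simp add: mult.commute)
    then show ?case using \<eta> by simp
  qed
qed

section \<open>Minimisers of the Lewy energy and half-strips in W\<close>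

text \<open>Its gradient in z is \<open>lewy \<sigma> z - w\<close>, so solving for a preimage of w
  is a minimisation, which also makes sense when the minimiser lies on the boundary of N.\<close>

definition lewy_energy :: "complex \<Rightarrow> complex \<Rightarrow> real" where
  "lewy_energy w z = \<sigma> z + (z \<bullet> z) / 2 - w \<bullet> z"

lemma lewy_energy_min_exists: obtains z where "z \<in> N" "\<And>v. v \<in> N \<Longrightarrow> lewy_energy w z \<le> lewy_energy w v"
proof -
  have "continuous_on N (lewy_energy w)" unfolding lewy_energy_def
    by (intro continuous_intros cont_sigma) auto
  moreover have "N \<noteq> {}" using interior_N interior_subset by auto
  ultimately show ?thesis using that continuous_attains_inf[OF compact_N] by blast
qed

lemma lewy_of_interior_min:
  assumes z: "z \<in> interior N" and min: "\<And>v. v \<in> N \<Longrightarrow> lewy_energy w z \<le> lewy_energy w v"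
  shows "lewy \<sigma> z = w"
proof -
  obtain e where e: "e > 0" "ball z e \<subseteq> N" using z by (meson mem_interior)
  have "grad \<sigma> z \<bullet> v + z \<bullet> v - w \<bullet> v = 0" for v
  proof (rule DERIV_local_min[where f="\<lambda>t. lewy_energy w (z + t *\<^sub>R v)" and x=0 and d="e / (norm v + 1)"])
    have 1: "((\<lambda>t. \<sigma> (z + t *\<^sub>R v)) has_real_derivative grad \<sigma> z \<bullet> v) (at 0)"
      using sigma_directional[of z 0 v] z by simp
    have 2: "(\<lambda>t. lewy_energy w (z + t *\<^sub>R v)) =
       (\<lambda>t. \<sigma> (z + t *\<^sub>R v) + (z \<bullet> z + t * (2 * (z \<bullet> v)) + t\<^sup>2 * (v \<bullet> v)) / 2 - (w \<bullet> z + t * (w \<bullet> v)))"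
      by (simp add: lewy_energy_def fun_eq_iff inner_add_left inner_add_right inner_commute power2_eq_square algebra_simps)
    show "((\<lambda>t. lewy_energy w (z + t *\<^sub>R v)) has_real_derivative (grad \<sigma> z \<bullet> v + z \<bullet> v - w \<bullet> v)) (at 0)"
      unfolding 2 by (auto intro!: derivative_eq_intros 1)
    show "0 < e / (norm v + 1)" using e by (auto intro!: divide_pos_pos add_nonneg_pos)
    show "\<forall>t. \<bar>0 - t\<bar> < e / (norm v + 1) \<longrightarrow> lewy_energy w (z + 0 *\<^sub>R v) \<le> lewy_energy w (z + t *\<^sub>R v)"
    proof (intro allI impI)
      fix t assume "\<bar>0 - t\<bar> < e / (norm v + 1)"
      then have "\<bar>t\<bar> * (norm v + 1) < e" by (simp add: pos_less_divide_eq add_nonneg_pos)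
      then have "\<bar>t\<bar> * norm v < e" by (simp add: algebra_simps) 
      then have "z + t *\<^sub>R v \<in> N" by (intro subsetD[OF e(2)]) (simp add: dist_norm)
      from min[OF this] show "lewy_energy w (z + 0 *\<^sub>R v) \<le> lewy_energy w (z + t *\<^sub>R v)" by simp
    qed
  qed
  from this[of "grad \<sigma> z + z - w"] have "(grad \<sigma> z + z - w) \<bullet> (grad \<sigma> z + z - w) = 0"
    by (simp only: inner_add_left inner_diff_left)
  then have "grad \<sigma> z + z - w = 0" by (simp only: inner_eq_zero_iff)
  then show ?thesis by (simp add: lewy_def algebra_simps)
qed

text \<open>By convexity a critical point is a global minimiser, also against competitors on the
  boundary.\<close>

lemma lewy_min_is_preimage:
  assumes z: "z \<in> interior N" and v: "v \<in> N"
  shows "lewy_energy (lewy \<sigma> z) z \<le> lewy_energy (lewy \<sigma> z) v"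
proof -
  have "0 \<le> (v - z) \<bullet> (v - z)" by simp
  then show ?thesis using gradient_inequality[OF z v]
    by (simp add: lewy_energy_def lewy_def inner_add_left inner_diff_left inner_diff_right inner_commute algebra_simps)
qed

text \<open>With y as competitor, all terms of the energy difference are bounded except the product
  of the normal component of w and the depth of z. Hence the depth is O(1/X) as the normal component
  X of w grows.\<close>

lemma flat_min_bound:
  assumes f: "flat y n r a"
  obtains C where "C > 0" "\<And>w z. z \<in> N \<Longrightarrow> lewy_energy w z \<le> lewy_energy w y \<Longrightarrow> \<bar>(\<i> * n) \<bullet> w - ((\<i> * n) \<bullet> y + a)\<bar> \<le> r / 2
    \<Longrightarrow> (n \<bullet> w) * (n \<bullet> y - n \<bullet> z) \<le> C"
proof -
  note fD = flatD[OF f]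
  obtain M where M: "M > 0" "\<And>z. z \<in> N \<Longrightarrow> \<bar>\<sigma> z\<bar> \<le> M" using sigma_bounded by blast
  obtain R where R: "R > 0" "\<And>z. z \<in> N \<Longrightarrow> cmod z \<le> R" using compact_imp_bounded[OF compact_N] by (auto simp: bounded_pos)
  define Y where "Y = \<bar>(\<i> * n) \<bullet> y + a\<bar> + r / 2"
  have Y: "Y > 0" using fD(2) by (simp add: Y_def)
  show thesis
  proof (rule that[of "2 * M + R\<^sup>2 + Y * (2 * R)"])
    show "2 * M + R\<^sup>2 + Y * (2 * R) > 0" using M R Y by (intro add_pos_nonneg) auto
    fix w z assume z: "z \<in> N" and le: "lewy_energy w z \<le> lewy_energy w y" and w: "\<bar>(\<i> * n) \<bullet> w - ((\<i> * n) \<bullet> y + a)\<bar> \<le> r / 2"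
    have "y \<bullet> y \<le> R\<^sup>2" using R(2)[OF fD(4)] by (simp add: dot_square_norm power_mono)
    moreover have "z \<bullet> z \<ge> 0" by simp
    moreover have "\<bar>\<sigma> y\<bar> \<le> M" "\<bar>\<sigma> z\<bar> \<le> M" using M(2) fD(4) z by auto
    moreover have "((\<i> * n) \<bullet> w) * ((\<i> * n) \<bullet> z - (\<i> * n) \<bullet> y) \<le> Y * (2 * R)"
    proof -
      have "\<bar>(\<i> * n) \<bullet> w\<bar> \<le> Y" using w unfolding Y_def by linarith
      moreover have "\<bar>(\<i> * n) \<bullet> z - (\<i> * n) \<bullet> y\<bar> \<le> 2 * R"
        using Cauchy_Schwarz_ineq2[of "\<i> * n" z] Cauchy_Schwarz_ineq2[of "\<i> * n" y] R(2)[OF z] R(2)[OF fD(4)] fD(1)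
        by (simp add: norm_mult)
      ultimately have "\<bar>((\<i> * n) \<bullet> w) * ((\<i> * n) \<bullet> z - (\<i> * n) \<bullet> y)\<bar> \<le> Y * (2 * R)"
        unfolding abs_mult using Y R by (intro mult_mono) auto
      then show ?thesis by linarith
    qed
    moreover have "lewy_energy w y - lewy_energy w z = \<sigma> y - \<sigma> z + (y \<bullet> y) / 2 - (z \<bullet> z) / 2
       - (n \<bullet> w) * (n \<bullet> y - n \<bullet> z) + ((\<i> * n) \<bullet> w) * ((\<i> * n) \<bullet> z - (\<i> * n) \<bullet> y)"
      unfolding lewy_energy_def frame_inner[OF fD(1), of w] by (simp add: algebra_simps)
    ultimately show "(n \<bullet> w) * (n \<bullet> y - n \<bullet> z) \<le> 2 * M + R\<^sup>2 + Y * (2 * R)"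
      using le zero_le_power2[of R] by linarith
  qed
qed


text \<open>On the rest of the supporting line nothing is known but convexity, which keeps \<sigma>
  above the affine continuation of its values near y.\<close>

lemma flat_line_below:
  assumes f: "flat y n r a" and z: "y + u *\<^sub>R (\<i> * n) \<in> N"
  shows "\<sigma> y + a * u \<le> \<sigma> (y + u *\<^sub>R (\<i> * n))"
proof -
  note fD = flatD[OF f]
  \<comment> \<open>Scales u back into the segment of half-length r on which \<sigma> is
    affine.\<close>
  define l where "l = r / (r + \<bar>u\<bar>)"
  have l: "0 < l" "l \<le> 1" "\<bar>l * u\<bar> \<le> r"
  proof -
    have p: "r + \<bar>u\<bar> > 0" using fD(2) by linarith
    show "0 < l" "l \<le> 1" using fD(2) p by (auto simp: l_def)
    have "r * \<bar>u\<bar> \<le> r * (r + \<bar>u\<bar>)" using fD(2) by (intro mult_left_mono) auto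
    then show "\<bar>l * u\<bar> \<le> r" using p fD(2) by (simp add: l_def abs_mult pos_divide_le_eq)
  qed
  have "\<sigma> ((1 - l) *\<^sub>R y + l *\<^sub>R (y + u *\<^sub>R (\<i> * n))) \<le> (1 - l) * \<sigma> y + l * \<sigma> (y + u *\<^sub>R (\<i> * n))"
    by (rule convex_onD[OF convex_sigma]) (use l fD(4) z in auto)
  moreover have "(1 - l) *\<^sub>R y + l *\<^sub>R (y + u *\<^sub>R (\<i> * n)) = y + (l * u) *\<^sub>R (\<i> * n)"
    by (simp add: algebra_simps)
  ultimately have "l * (\<sigma> y + a * u) \<le> l * \<sigma> (y + u *\<^sub>R (\<i> * n))"
    using fD(6)[OF l(3)] by (simp add: algebra_simps)
  then show ?thesis using l(1) by simp
qed

text \<open>Moving inwards by \<eta> changes the linear and quadratic terms by O(\<eta>), while the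
  infinite steepness of \<sigma> makes the drop larger than any prescribed multiple of
  \<eta>.\<close>

lemma flat_not_minimiser:
  assumes f: "flat y n r a" and min: "\<And>v. v \<in> N \<Longrightarrow> lewy_energy w y \<le> lewy_energy w v"
  shows False
proof -
  note fD = flatD[OF f]
  obtain \<eta> where \<eta>: "0 < \<eta>" "\<eta> < 1" "y - \<eta> *\<^sub>R n \<in> interior N"
    and st: "\<sigma> (y - \<eta> *\<^sub>R n) < \<sigma> y - (n \<bullet> w - n \<bullet> y + 1) * \<eta>"
    using flat_steep[OF f zero_less_one] by blast
  have "lewy_energy w y \<le> lewy_energy w (y - \<eta> *\<^sub>R n)"
    using min \<eta>(3) interior_subset by auto
  also have "\<dots> = \<sigma> (y - \<eta> *\<^sub>R n) + (y \<bullet> y - 2 * \<eta> * (n \<bullet> y) + \<eta> * \<eta> * (n \<bullet> n)) / 2 - w \<bullet> y + \<eta> * (n \<bullet> w)"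
    by (simp add: lewy_energy_def inner_diff_left inner_diff_right inner_commute algebra_simps)
  finally have 1: "0 \<le> \<sigma> (y - \<eta> *\<^sub>R n) - \<sigma> y - \<eta> * (n \<bullet> y) + \<eta> * \<eta> / 2 + \<eta> * (n \<bullet> w)"
    using fD(1) by (simp add: lewy_energy_def dot_square_norm field_simps)
  have 2: "(n \<bullet> w - n \<bullet> y + 1) * \<eta> = \<eta> * (n \<bullet> w) - \<eta> * (n \<bullet> y) + \<eta>" by (simp add: algebra_simps)
  have "\<eta> * \<eta> < \<eta>" using \<eta> mult_strict_left_mono[of \<eta> 1 \<eta>] by simp
  then show False using 1 st \<eta>(1) unfolding 2 by linarith
qed

text \<open>For w far out the minimiser is driven to the supporting line. There the tangential
  component of w fixes its position by a one-dimensional problem, close enough to y for the segment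
  to be flat; as no flat point is a minimiser, the minimiser is interior.\<close>

lemma flat_half_strip:
  assumes f: "flat y n r a"
  obtains M where "M > 0" "\<And>w. n \<bullet> w > M \<Longrightarrow> \<bar>(\<i> * n) \<bullet> w - ((\<i> * n) \<bullet> y + a)\<bar> \<le> r / 2 \<Longrightarrow> w \<in> lewy \<sigma> ` interior N"
proof (rule ccontr)
  assume no: "\<not> thesis"
  note fD = flatD[OF f]
  let ?\<tau> = "\<i> * n"
  define Y0 where "Y0 = ?\<tau> \<bullet> y + a"
  have "\<exists>w. n \<bullet> w > real (Suc k) \<and> \<bar>?\<tau> \<bullet> w - Y0\<bar> \<le> r / 2 \<and> w \<notin> lewy \<sigma> ` interior N" for k
    using no that[of "real (Suc k)"] unfolding Y0_def by force
  then obtain w where w: "\<And>k. n \<bullet> w k > real (Suc k)" "\<And>k. \<bar>?\<tau> \<bullet> w k - Y0\<bar> \<le> r / 2"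
    "\<And>k. w k \<notin> lewy \<sigma> ` interior N" by metis
  have "\<exists>z. z \<in> N \<and> (\<forall>v\<in>N. lewy_energy (w k) z \<le> lewy_energy (w k) v)" for k
    using lewy_energy_min_exists by metis
  then obtain z where z: "\<And>k. z k \<in> N" "\<And>k v. v \<in> N \<Longrightarrow> lewy_energy (w k) (z k) \<le> lewy_energy (w k) v" by metis
  have zI: "z k \<notin> interior N" for k
  proof
    assume "z k \<in> interior N"
    then have "lewy \<sigma> (z k) = w k" by (rule lewy_of_interior_min) (rule z(2))
    then show False using w(3)[of k] \<open>z k \<in> interior N\<close> by (metis imageI)
  qed
  define q where "q = (\<lambda>k. (z k, ?\<tau> \<bullet> w k - Y0))"
  have "compact (N \<times> {- (r/2)..r/2})" using compact_N by (intro compact_Times) auto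
  then have sc: "seq_compact (N \<times> {- (r/2)..r/2})" by (simp add: compact_eq_seq_compact_metric)
  have "\<forall>k. q k \<in> N \<times> {- (r/2)..r/2}" 
  proof
    fix k
    have "- (r / 2) \<le> ?\<tau> \<bullet> w k - Y0" "?\<tau> \<bullet> w k - Y0 \<le> r / 2" using w(2)[of k] by linarith+
    then show "q k \<in> N \<times> {- (r/2)..r/2}" using z(1)[of k] unfolding q_def mem_Sigma_iff atLeastAtMost_iff by blast
  qed
  then obtain l \<phi> where l: "l \<in> N \<times> {- (r/2)..r/2}" and \<phi>: "strict_mono (\<phi>::nat \<Rightarrow> nat)" and ql: "(q \<circ> \<phi>) \<longlonglongrightarrow> l"
    using seq_compactE[OF sc] by metis
  obtain z' t' where l_eq: "l = (z', t')" by (cases l)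
  have z'N: "z' \<in> N" and t': "\<bar>t'\<bar> \<le> r / 2" using l unfolding l_eq mem_Sigma_iff atLeastAtMost_iff by auto
  have zl: "(\<lambda>k. z (\<phi> k)) \<longlonglongrightarrow> z'" using tendsto_fst[OF ql] by (simp add: q_def l_eq o_def)
  have Yl: "(\<lambda>k. ?\<tau> \<bullet> w (\<phi> k) - Y0) \<longlonglongrightarrow> t'" using tendsto_snd[OF ql] by (simp add: q_def l_eq o_def)
  have Yl': "(\<lambda>k. ?\<tau> \<bullet> w (\<phi> k)) \<longlonglongrightarrow> Y0 + t'" using tendsto_add[OF Yl tendsto_const[of Y0]] by (simp add: add.commute)
  obtain C where C: "C > 0" "\<And>w z. z \<in> N \<Longrightarrow> lewy_energy w z \<le> lewy_energy w y \<Longrightarrow> \<bar>(\<i> * n) \<bullet> w - ((\<i> * n) \<bullet> y + a)\<bar> \<le> r / 2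
    \<Longrightarrow> (n \<bullet> w) * (n \<bullet> y - n \<bullet> z) \<le> C" using flat_min_bound[OF f] by blast
  have nz: "n \<bullet> z' = n \<bullet> y"
  proof -
    have le: "n \<bullet> y - n \<bullet> z (\<phi> k) \<le> C / real (Suc (\<phi> k))" for k
    proof -
      have "(n \<bullet> w (\<phi> k)) * (n \<bullet> y - n \<bullet> z (\<phi> k)) \<le> C"
        by (rule C(2)[OF z(1) z(2)[OF fD(4)]]) (use w(2) in \<open>simp add: Y0_def\<close>)
      moreover have "real (Suc (\<phi> k)) * (n \<bullet> y - n \<bullet> z (\<phi> k)) \<le> (n \<bullet> w (\<phi> k)) * (n \<bullet> y - n \<bullet> z (\<phi> k))"
        using w(1)[of "\<phi> k"] fD(3)[OF z(1)] by (intro mult_right_mono) (auto simp: less_imp_le)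
      ultimately show ?thesis by (simp add: pos_le_divide_eq mult.commute)
    qed
    have "(\<lambda>k. C / real (Suc (\<phi> k))) \<longlonglongrightarrow> 0"
      using LIMSEQ_subseq_LIMSEQ[OF _ \<phi>, of "\<lambda>k. C / real (Suc k)" 0] tendsto_mult_right_zero[OF LIMSEQ_inverse_real_of_nat, of C]
      by (simp add: o_def divide_inverse)
    moreover have "(\<lambda>k. n \<bullet> y - n \<bullet> z (\<phi> k)) \<longlonglongrightarrow> n \<bullet> y - n \<bullet> z'" by (intro tendsto_intros zl)
    ultimately have "n \<bullet> y - n \<bullet> z' \<le> 0"
      using le LIMSEQ_le by (metis (no_types, lifting))
    then show ?thesis using fD(3)[OF z'N] by simp
  qed
  define u where "u = ?\<tau> \<bullet> (z' - y)"
  have z'u: "z' = y + u *\<^sub>R ?\<tau>"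
    using frame_expand[OF fD(1), of "z' - y"] nz by (simp add: u_def inner_diff_right algebra_simps)
  \<comment> \<open>The position at which the limiting one-dimensional problem should have its
    minimum; it serves as competitor.\<close>
  define v where "v = y + t' *\<^sub>R ?\<tau>"
  have vN: "v \<in> N" and sv: "\<sigma> v = \<sigma> y + a * t'" using fD(5,6)[of t'] t' fD(2) by (auto simp: v_def)
  have tn: "?\<tau> \<bullet> ?\<tau> = 1" using fD(1) by (simp add: dot_square_norm norm_mult)
  \<comment> \<open>The normal components of \<open>w k\<close> are unbounded and have to disappear
    before the limit: v lies on the supporting line, so they favour v and may be dropped.\<close>
  have "\<sigma> z' + (z' \<bullet> z') / 2 - (Y0 + t') * (?\<tau> \<bullet> z') \<le> \<sigma> v + (v \<bullet> v) / 2 - (Y0 + t') * (?\<tau> \<bullet> v)"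
  proof (rule LIMSEQ_le)
    show "(\<lambda>k. \<sigma> (z (\<phi> k)) + (z (\<phi> k) \<bullet> z (\<phi> k)) / 2 - (?\<tau> \<bullet> w (\<phi> k)) * (?\<tau> \<bullet> z (\<phi> k))) \<longlonglongrightarrow>
      \<sigma> z' + (z' \<bullet> z') / 2 - (Y0 + t') * (?\<tau> \<bullet> z')"
      by (intro tendsto_intros zl Yl' continuous_on_tendsto_compose[OF cont_sigma zl z'N]) (auto simp: z)
    show "(\<lambda>k. \<sigma> v + (v \<bullet> v) / 2 - (?\<tau> \<bullet> w (\<phi> k)) * (?\<tau> \<bullet> v)) \<longlonglongrightarrow> \<sigma> v + (v \<bullet> v) / 2 - (Y0 + t') * (?\<tau> \<bullet> v)"
      by (intro tendsto_intros Yl')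
    have "\<sigma> (z k) + (z k \<bullet> z k) / 2 - (?\<tau> \<bullet> w k) * (?\<tau> \<bullet> z k) \<le> \<sigma> v + (v \<bullet> v) / 2 - (?\<tau> \<bullet> w k) * (?\<tau> \<bullet> v)" for k
    proof -
      have "n \<bullet> v = n \<bullet> y" by (simp add: v_def inner_add_right)
      then have "(n \<bullet> w k) * (n \<bullet> z k) \<le> (n \<bullet> w k) * (n \<bullet> v)"
        using fD(3)[OF z(1)[of k]] w(1)[of k] by (intro mult_left_mono) auto
      then show ?thesis using z(2)[OF vN, of k]
        unfolding lewy_energy_def frame_inner[OF fD(1), of "w k"] by linarith
    qed
    then show "\<exists>K. \<forall>k\<ge>K. \<sigma> (z (\<phi> k)) + (z (\<phi> k) \<bullet> z (\<phi> k)) / 2 - (?\<tau> \<bullet> w (\<phi> k)) * (?\<tau> \<bullet> z (\<phi> k))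
       \<le> \<sigma> v + (v \<bullet> v) / 2 - (?\<tau> \<bullet> w (\<phi> k)) * (?\<tau> \<bullet> v)" by blast
  qed
  moreover have "\<sigma> y + a * u \<le> \<sigma> z'" using flat_line_below[OF f, of u] z'N by (simp add: z'u)
  moreover have "z' \<bullet> z' = y \<bullet> y + 2 * u * (?\<tau> \<bullet> y) + u * u" "v \<bullet> v = y \<bullet> y + 2 * t' * (?\<tau> \<bullet> y) + t' * t'"
     "?\<tau> \<bullet> z' = ?\<tau> \<bullet> y + u" "?\<tau> \<bullet> v = ?\<tau> \<bullet> y + t'"
    using tn unfolding z'u v_def by (simp_all add: inner_add_left inner_add_right inner_commute algebra_simps)
  \<comment> \<open>Along the edge the limiting energies differ by at least half the squared
    distance of the positions, whatever the slope a is.\<close>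
  ultimately have "(u - t') * (u - t') \<le> 0"
  proof -
    assume 1: "\<sigma> z' + (z' \<bullet> z') / 2 - (Y0 + t') * (?\<tau> \<bullet> z') \<le> \<sigma> v + (v \<bullet> v) / 2 - (Y0 + t') * (?\<tau> \<bullet> v)"
      and 2: "\<sigma> y + a * u \<le> \<sigma> z'"
      and 3: "z' \<bullet> z' = y \<bullet> y + 2 * u * (?\<tau> \<bullet> y) + u * u" "v \<bullet> v = y \<bullet> y + 2 * t' * (?\<tau> \<bullet> y) + t' * t'"
        "?\<tau> \<bullet> z' = ?\<tau> \<bullet> y + u" "?\<tau> \<bullet> v = ?\<tau> \<bullet> y + t'"
    define T yy where "T = ?\<tau> \<bullet> y" and "yy = y \<bullet> y"
    define A B where "A = (yy + 2 * u * T + u * u) / 2 - (T + a + t') * (T + u)"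
      and "B = (yy + 2 * t' * T + t' * t') / 2 - (T + a + t') * (T + t')"
    have "\<sigma> z' + A \<le> \<sigma> y + a * t' + B"
      using 1 sv unfolding 3 Y0_def T_def[symmetric] yy_def[symmetric] A_def B_def by simp
    with 2 have "(a * u + A) - (a * t' + B) \<le> 0" by linarith
    moreover have "(u - t') * (u - t') = 2 * ((a * u + A) - (a * t' + B))"
      unfolding A_def B_def by (simp add: field_simps)
    ultimately show ?thesis by (simp only: mult_le_0_iff) simp
  qed
  then have "u = t'" by (metis eq_iff_diff_eq_0 mult_eq_0_iff order_antisym zero_le_square)
  then have z'v: "z' = y + t' *\<^sub>R ?\<tau>" by (simp add: z'u)
  \<comment> \<open>The limit position satisfies \<open>\<bar>t'\<bar> \<le> r / 2\<close>, so the
    minimisers eventually enter a box of half-width 3r/4. A non-interior point there can only lie on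
    the edge.\<close>
  obtain h where h: "h > 0" and box: "\<And>t \<eta>. \<bar>t\<bar> \<le> 3 * r / 4 \<Longrightarrow> 0 < \<eta> \<Longrightarrow> \<eta> \<le> h \<Longrightarrow> y + t *\<^sub>R (\<i> * n) - \<eta> *\<^sub>R n \<in> interior N"
    using flat_box[OF f, of "3 * r / 4"] fD(2) by auto
  have "(\<lambda>k. ?\<tau> \<bullet> (z (\<phi> k) - y)) \<longlonglongrightarrow> ?\<tau> \<bullet> (z' - y)" "(\<lambda>k. n \<bullet> (y - z (\<phi> k))) \<longlonglongrightarrow> n \<bullet> (y - z')"
    by (intro tendsto_intros zl)+
  then have lims: "(\<lambda>k. \<bar>?\<tau> \<bullet> (z (\<phi> k) - y)\<bar>) \<longlonglongrightarrow> \<bar>t'\<bar>" "(\<lambda>k. n \<bullet> (y - z (\<phi> k))) \<longlonglongrightarrow> 0"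
    using tn nz by (auto simp: z'v inner_add_right inner_diff_right intro!: tendsto_rabs)
  have "\<bar>t'\<bar> < 3 * r / 4" using t' fD(2) by linarith
  then have "\<forall>\<^sub>F k in sequentially. \<bar>?\<tau> \<bullet> (z (\<phi> k) - y)\<bar> < 3 * r / 4" "\<forall>\<^sub>F k in sequentially. n \<bullet> (y - z (\<phi> k)) < h"
    using order_tendstoD(2)[OF lims(1)] order_tendstoD(2)[OF lims(2)] h by blast+
  then have "\<forall>\<^sub>F k in sequentially. \<bar>?\<tau> \<bullet> (z (\<phi> k) - y)\<bar> < 3 * r / 4 \<and> n \<bullet> (y - z (\<phi> k)) < h"
    by eventually_elim auto
  then obtain k where k: "\<bar>?\<tau> \<bullet> (z (\<phi> k) - y)\<bar> < 3 * r / 4" "n \<bullet> (y - z (\<phi> k)) < h"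
    using eventually_happens'[OF sequentially_bot] by blast
  define x t \<eta> where "x = z (\<phi> k)" and "t = ?\<tau> \<bullet> (x - y)" and "\<eta> = n \<bullet> (y - x)"
  have x: "x = y + t *\<^sub>R ?\<tau> - \<eta> *\<^sub>R n"
    using frame_expand[OF fD(1), of "x - y"] by (simp add: t_def \<eta>_def inner_diff_right algebra_simps)
  have "\<eta> \<ge> 0" using fD(3)[OF z(1)] by (simp add: \<eta>_def x_def inner_diff_right)
  moreover have "\<not> \<eta> > 0" using box[of t \<eta>] k zI[of "\<phi> k"] x by (auto simp: x_def t_def \<eta>_def)
  ultimately have "x = y + t *\<^sub>R ?\<tau>" using x by simp
  moreover have "\<bar>t\<bar> < r" using k fD(2) by (simp add: t_def x_def)
  ultimately have "flat x n (r - \<bar>t\<bar>) a" using flat_shift[OF f] by simp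
  then show False by (rule flat_not_minimiser[where w="w (\<phi> k)"]) (use z(2) in \<open>simp add: x_def\<close>)
qed

section \<open>The Lewy transform and its inverse\<close>

text \<open>The identity plus a monotone map is expanding. This gives injectivity and the Lipschitz
  constant 1 of the inverse, which is used again when the Legendre transform is
  differentiated.\<close>

lemma lewy_expanding:
  assumes "z \<in> interior N" "w \<in> interior N"
  shows "cmod (z - w) \<le> cmod (lewy \<sigma> z - lewy \<sigma> w)"
proof (cases "z = w")
  case False
  have "cmod (z - w) * cmod (z - w) = (z - w) \<bullet> (z - w)" by (simp add: dot_square_norm power2_eq_square)
  also have "\<dots> \<le> (lewy \<sigma> z - lewy \<sigma> w) \<bullet> (z - w)"
    using gradient_monotone[OF assms] by (simp add: lewy_def inner_diff_left inner_add_left)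
  also have "\<dots> \<le> cmod (lewy \<sigma> z - lewy \<sigma> w) * cmod (z - w)" by (rule norm_cauchy_schwarz)
  finally show ?thesis using False by simp
qed simp

lemma inj_lewy: "inj_on (lewy \<sigma>) (interior N)"
proof (rule inj_onI)
  fix x y assume "x \<in> interior N" "y \<in> interior N" "lewy \<sigma> x = lewy \<sigma> y"
  then show "x = y" using lewy_expanding[of x y] by simp
qed

abbreviation W :: "complex set" where "W \<equiv> lewy \<sigma> ` interior N"

definition lewy_inv :: "complex \<Rightarrow> complex" where "lewy_inv = inv_into (interior N) (lewy \<sigma>)"

lemma lewy_inv_lewy: "z \<in> interior N \<Longrightarrow> lewy_inv (lewy \<sigma> z) = z"
  by (simp add: lewy_inv_def inv_into_f_f[OF inj_lewy])

lemma lewy_lewy_inv: "w \<in> W \<Longrightarrow> lewy \<sigma> (lewy_inv w) = w"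
  by (simp add: lewy_inv_def f_inv_into_f)

lemma lewy_inv_in: "w \<in> W \<Longrightarrow> lewy_inv w \<in> interior N"
  using inv_into_into[of w "lewy \<sigma>" "interior N"] by (simp add: lewy_inv_def)

lemma lewy_inv_nonexpanding: "v \<in> W \<Longrightarrow> w \<in> W \<Longrightarrow> cmod (lewy_inv v - lewy_inv w) \<le> cmod (v - w)"
  using lewy_expanding[OF lewy_inv_in lewy_inv_in] by (simp add: lewy_lewy_inv)

lemma continuous_lewy_inv: "continuous_on W lewy_inv"
  unfolding continuous_on_iff
  using lewy_inv_nonexpanding by (metis (no_types, opaque_lifting) dist_norm order_le_less_trans)

lemma lewy_has_derivative:
  assumes z: "z \<in> interior N"
  shows "(lewy \<sigma> has_derivative (\<lambda>v. v + Complex (Re v * pdx (pdx \<sigma>) z + Im v * pdx (pdy \<sigma>) z)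
            (Re v * pdx (pdy \<sigma>) z + Im v * pdy (pdy \<sigma>) z))) (at z)"
proof -
  have g: "grad \<sigma> = (\<lambda>z. of_real (pdx \<sigma> z) + \<i> * of_real (pdy \<sigma> z))"
    by (simp add: grad_def fun_eq_iff complex_eq_iff)
  have "((\<lambda>z. z + (of_real (pdx \<sigma> z) + \<i> * of_real (pdy \<sigma> z))) has_derivative
     (\<lambda>v. v + (of_real (Re v * pdx (pdx \<sigma>) z + Im v * pdy (pdx \<sigma>) z) +
            \<i> * of_real (Re v * pdx (pdy \<sigma>) z + Im v * pdy (pdy \<sigma>) z)))) (at z)"
    by (intro has_derivative_add has_derivative_ident has_derivative_mult_right has_derivative_of_real
        differentiable_has_derivative_pd diff_pdx[OF z] diff_pdy[OF z])
  moreover have "lewy \<sigma> = (\<lambda>z. z + (of_real (pdx \<sigma> z) + \<i> * of_real (pdy \<sigma> z)))"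
    by (simp add: fun_eq_iff lewy_def g)
  ultimately show ?thesis
    by (simp add: mixed_partials_commute[OF C2_sigma z] Complex_eq)
qed

lemma continuous_lewy: "continuous_on (interior N) (lewy \<sigma>)"
  by (rule has_derivative_continuous_on) (use lewy_has_derivative has_derivative_at_withinI in blast)

lemma open_W: "open W"
  by (rule invariance_of_domain[OF continuous_lewy open_interior inj_lewy])

text \<open>The derivative of \<open>lewy_inv\<close> is \<open>(I + H)\<^sup>-\<^sup>1\<close> with \<open>det H = 1\<close>, which
  is symmetric of trace 1; so \<open>2 lewy_inv - id\<close> has a symmetric trace-free derivative and is
  antiholomorphic.\<close>

lemma holomorphic_cnj_lewy_inv: "(\<lambda>w. cnj (2 * lewy_inv w - w)) holomorphic_on W"
proof (rule holomorphic_onI)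
  fix w assume w: "w \<in> W"
  define z where "z = lewy_inv w"
  have z: "z \<in> interior N" and wz: "w = lewy \<sigma> z" using w by (simp_all add: z_def lewy_inv_in lewy_lewy_inv)
  define a b c where "a = pdx (pdx \<sigma>) z" and "b = pdx (pdy \<sigma>) z" and "c = pdy (pdy \<sigma>) z"
  have ac: "a * c - b\<^sup>2 = 1" "a > 0" "c > 0" using hess_ac[OF z] pd_pos[OF z] by (simp_all add: a_def b_def c_def)
  \<comment> \<open>The determinant of I + H; since det H = 1 it equals 2 + tr H, so that the
    inverse matrix has trace 1.\<close>
  define d where "d = 2 + a + c"
  have d: "d > 0" "(1 + a) * (1 + c) - b * b = d" using ac by (auto simp: d_def power2_eq_square algebra_simps)
  let ?f' = "\<lambda>v. v + Complex (Re v * a + Im v * b) (Re v * b + Im v * c)"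
  let ?g' = "\<lambda>v. Complex (((1 + c) * Re v - b * Im v) / d) (((1 + a) * Im v - b * Re v) / d)"
  have f': "(lewy \<sigma> has_derivative ?f') (at z)"
    using lewy_has_derivative[OF z] by (simp add: a_def b_def c_def)
  have lin: "bounded_linear ?g'"
    by (intro linear_conv_bounded_linear[THEN iffD1] linearI)
       (simp_all add: complex_eq_iff algebra_simps add_divide_distrib diff_divide_distrib)
  have "(lewy_inv has_derivative ?g') (at w)"
    unfolding wz
  proof (rule has_derivative_inverse_dieudonne[OF open_interior open_W continuous_lewy continuous_lewy_inv lewy_inv_lewy z f' lin])
    show "?g' \<circ> ?f' = id"
    proof
      fix v
      have "(1 + c) * Re (?f' v) - b * Im (?f' v) = ((1 + a) * (1 + c) - b * b) * Re v"
         "(1 + a) * Im (?f' v) - b * Re (?f' v) = ((1 + a) * (1 + c) - b * b) * Im v"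
        by (simp_all add: algebra_simps)
      then show "(?g' \<circ> ?f') v = id v" using d by (simp add: complex_eq_iff)
    qed
  qed
  then have "((\<lambda>w. cnj (2 * lewy_inv w - w)) has_derivative (\<lambda>v. cnj (2 * ?g' v - v))) (at w)"
    by (intro bounded_linear.has_derivative[OF bounded_linear_cnj] has_derivative_diff has_derivative_mult_right has_derivative_ident)
  \<comment> \<open>A symmetric trace-free real matrix followed by conjugation is multiplication by
    a complex number, which is complex differentiability.\<close>
  moreover have "(\<lambda>v. cnj (2 * ?g' v - v)) = (*) (Complex ((c - a) / d) (2 * b / d))"
  proof
    fix v
    have "2 * ((1 + c) * Re v - b * Im v) / d - Re v = (c - a) / d * Re v - 2 * b / d * Im v"
      "2 * ((1 + a) * Im v - b * Re v) / d - Im v = - ((c - a) / d * Im v + 2 * b / d * Re v)"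
      using d(1) by (simp_all add: field_simps) (simp_all add: d_def algebra_simps)
    then show "cnj (2 * ?g' v - v) = Complex ((c - a) / d) (2 * b / d) * v"
      by (simp add: complex_eq_iff)
  qed
  ultimately show "(\<lambda>w. cnj (2 * lewy_inv w - w)) field_differentiable at w within W"
    unfolding field_differentiable_def has_field_derivative_def by (metis has_derivative_at_withinI)
qed

end

section \<open>Landing points of the inverse Riemann map\<close>

locale tension_disc = tension +
  fixes \<psi> :: "complex \<Rightarrow> complex"
  assumes psi_hol: "\<psi> holomorphic_on ball 0 1"
    and psi_bij: "bij_betw \<psi> (ball 0 1) (lewy \<sigma> ` interior N)"
begin

definition U :: "complex \<Rightarrow> complex" where "U \<zeta> = lewy_inv (\<psi> \<zeta>)"
definition phi :: "complex \<Rightarrow> complex" where "phi = inv_into (ball 0 1) \<psi>"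
definition G :: "complex \<Rightarrow> complex" where "G z = phi (lewy \<sigma> z)"
definition psi2 :: "complex \<Rightarrow> complex" where "psi2 \<zeta> = cnj (2 * lewy_inv (\<psi> \<zeta>) - \<psi> \<zeta>)"

lemma psi_in_W: "cmod \<zeta> < 1 \<Longrightarrow> \<psi> \<zeta> \<in> W"
  using psi_bij by (auto simp: bij_betw_def)

lemma U_in: "cmod \<zeta> < 1 \<Longrightarrow> U \<zeta> \<in> interior N"
  by (simp add: U_def lewy_inv_in psi_in_W)

lemma phi_psi: "cmod \<zeta> < 1 \<Longrightarrow> phi (\<psi> \<zeta>) = \<zeta>"
  using psi_bij by (simp add: phi_def bij_betw_def)

lemma psi_phi: "w \<in> W \<Longrightarrow> \<psi> (phi w) = w"
  using psi_bij by (metis phi_def bij_betw_inv_into_right)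

lemma phi_in: "w \<in> W \<Longrightarrow> cmod (phi w) < 1"
  using psi_bij by (metis phi_def bij_betw_def inv_into_into mem_ball_0)

lemma G_U: "cmod \<zeta> < 1 \<Longrightarrow> G (U \<zeta>) = \<zeta>"
  by (simp add: G_def U_def lewy_lewy_inv psi_in_W phi_psi)

lemma U_G: "z \<in> interior N \<Longrightarrow> U (G z) = z"
  by (simp add: G_def U_def psi_phi lewy_inv_lewy)

lemma G_in: "z \<in> interior N \<Longrightarrow> cmod (G z) < 1"
  by (simp add: G_def phi_in)

lemma U_phi: "w \<in> W \<Longrightarrow> U (phi w) = lewy_inv w"
  by (simp add: U_def psi_phi)

lemma psi2_hol: "psi2 holomorphic_on ball 0 1"
proof -
  have "(\<lambda>w. cnj (2 * lewy_inv w - w)) \<circ> \<psi> holomorphic_on ball 0 1"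
    by (rule holomorphic_on_compose_gen[OF psi_hol holomorphic_cnj_lewy_inv]) (auto intro: psi_in_W)
  then show ?thesis by (simp add: o_def psi2_def[abs_def])
qed

lemma U_eq: "U \<zeta> = (\<psi> \<zeta> + cnj (psi2 \<zeta>)) / 2"
  by (simp add: U_def psi2_def)

lemma phi_hol: "phi holomorphic_on W"
proof -
  have "inj_on \<psi> (ball 0 1)" and im: "\<psi> ` ball 0 1 = W" using psi_bij by (auto simp: bij_betw_def)
  then obtain g where g: "g holomorphic_on \<psi> ` ball 0 1" "\<And>z. z \<in> ball 0 1 \<Longrightarrow> g (\<psi> z) = z"
    using holomorphic_has_inverse[OF psi_hol open_ball] by metis
  have "phi w = g w" if "w \<in> W" for w
    using g(2)[of "phi w"] phi_in[OF that] psi_phi[OF that] by simp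
  then show ?thesis using g(1) unfolding im by (simp cong: holomorphic_cong)
qed

lemma grad_U: "cmod \<zeta> < 1 \<Longrightarrow> grad \<sigma> (U \<zeta>) = \<psi> \<zeta> - U \<zeta>"
  using lewy_lewy_inv[OF psi_in_W, of \<zeta>] by (simp add: U_def lewy_def algebra_simps)

lemma cont_U: "continuous_on (ball 0 1) U"
proof -
  have "continuous_on (ball 0 1) (\<lambda>\<zeta>. (\<psi> \<zeta> + cnj (psi2 \<zeta>)) / 2)"
    by (intro continuous_intros holomorphic_on_imp_continuous_on psi_hol psi2_hol) auto
  then show ?thesis by (simp add: U_eq[abs_def])
qed

lemma cont_G: "continuous_on (interior N) G"
  unfolding G_def[abs_def]
  by (rule continuous_on_compose2[OF holomorphic_on_imp_continuous_on[OF phi_hol] continuous_lewy]) auto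

lemma homeomorphism_U: "homeomorphism (ball 0 1) (interior N) U G"
  by (rule homeomorphismI[OF cont_U cont_G]) (auto simp: U_in G_in G_U U_G)

lemma harmonic_U: "harmonic_on (ball 0 1) U"
  by (rule harmonic_onI[OF psi_hol psi2_hol open_ball]) (rule U_eq)

lemma U_poisson:
  assumes r: "0 < r" "r < 1" and z: "cmod \<zeta> < 1"
  shows "((\<lambda>t. U (of_real r * cis t) * of_real (poisson_kernel \<zeta> t)) has_integral
           (2 * of_real pi * U (of_real r * \<zeta>))) {0..2*pi}"
  by (rule poisson_integral_harmonic[OF psi_hol psi2_hol r z U_eq])

section \<open>Harnack and Schwarz-Pick estimates, and landing along a strip\<close>

text \<open>The function \<open>d - n \<bullet> U\<close> is positive and harmonic, and the Poisson
  kernel is at least (1 - |\<zeta>|)/2. It turns a small depth of U below a supporting line into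
  closeness of \<zeta> to the circle.\<close>

lemma harnack:
  assumes n: "cmod n = 1" and sup: "\<And>z. z \<in> N \<Longrightarrow> n \<bullet> z \<le> d" and z: "cmod \<zeta> < 1"
  shows "(1 - cmod \<zeta>) / 2 * (d - n \<bullet> U 0) \<le> d - n \<bullet> U \<zeta>"
proof -
  define v where "v = (\<lambda>\<zeta>. d - n \<bullet> U \<zeta>)"
  have vpos: "v \<zeta> > 0" if "cmod \<zeta> < 1" for \<zeta>
    using interior_below_support[OF U_in[OF that] n sup] by (simp add: v_def)
  have *: "((\<lambda>t. v (of_real r * cis t) * poisson_kernel \<zeta> t) has_integral (2 * pi * v (of_real r * \<zeta>))) {0..2*pi}"
    if r: "0 < r" "r < 1" and z: "cmod \<zeta> < 1" for r \<zeta>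
  proof -
    have "((\<lambda>t. n \<bullet> (U (of_real r * cis t) * of_real (poisson_kernel \<zeta> t))) has_integral
           n \<bullet> (2 * of_real pi * U (of_real r * \<zeta>))) {0..2*pi}"
      by (rule has_integral_linear[OF U_poisson[OF r z] bounded_linear_inner_right, unfolded o_def])
    moreover have "n \<bullet> (U (of_real r * cis t) * of_real (poisson_kernel \<zeta> t)) = (n \<bullet> U (of_real r * cis t)) * poisson_kernel \<zeta> t" for t
      by (simp add: inner_complex_def algebra_simps)
    moreover have "n \<bullet> (2 * of_real pi * U (of_real r * \<zeta>)) = 2 * pi * (n \<bullet> U (of_real r * \<zeta>))"
      by (simp add: inner_complex_def algebra_simps)
    ultimately have "((\<lambda>t. (n \<bullet> U (of_real r * cis t)) * poisson_kernel \<zeta> t) has_integral 2 * pi * (n \<bullet> U (of_real r * \<zeta>))) {0..2*pi}"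
      by (simp only:)
    from has_integral_diff[OF has_integral_mult_right[OF poisson_kernel_has_integral[OF z], of d] this]
    show ?thesis unfolding v_def by (simp add: algebra_simps)
  qed
  have le: "(1 - cmod \<zeta>) / 2 * v 0 \<le> v (of_real r * \<zeta>)" if r: "0 < r" "r < 1" for r
  proof -
    have P0: "poisson_kernel 0 t = 1" for t by (simp add: poisson_kernel_def)
    have Pl: "(1 - cmod \<zeta>) / 2 \<le> poisson_kernel \<zeta> t" for t
    proof -
      have c: "cmod (cis t - \<zeta>) > 0" using cis_neq_in_disc[OF z] by simp
      have "cmod (cis t - \<zeta>) \<le> 1 + cmod \<zeta>" using norm_triangle_ineq4[of "cis t" \<zeta>] by simp
      then have "(cmod (cis t - \<zeta>))\<^sup>2 \<le> (1 + cmod \<zeta>)\<^sup>2" by (intro power_mono) auto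
      also have "\<dots> \<le> (1 + cmod \<zeta>) * 2"
        unfolding power2_eq_square using z by (intro mult_left_mono) auto
      finally have "(1 - cmod \<zeta>) * (cmod (cis t - \<zeta>))\<^sup>2 \<le> (1 - cmod \<zeta>) * ((1 + cmod \<zeta>) * 2)"
        using z by (intro mult_left_mono) auto
      also have "\<dots> = 2 * (1 - (cmod \<zeta>)\<^sup>2)" by (simp add: power2_eq_square algebra_simps)
      finally show ?thesis unfolding poisson_kernel_def using c by (simp add: field_simps)
    qed
    have 0: "((\<lambda>t. v (of_real r * cis t)) has_integral (2 * pi * v 0)) {0..2*pi}"
      using *[OF r, of 0] by (simp add: P0)
    have "2 * pi * v 0 * ((1 - cmod \<zeta>) / 2) \<le> 2 * pi * v (of_real r * \<zeta>)"
    proof (rule has_integral_le[OF has_integral_mult_left[OF 0] *[OF r z]])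
      fix t
      have "cmod (of_real r * cis t) < 1" using r by (simp add: norm_mult)
      then show "v (of_real r * cis t) * ((1 - cmod \<zeta>) / 2) \<le> v (of_real r * cis t) * poisson_kernel \<zeta> t"
        using vpos[of "of_real r * cis t"] by (intro mult_left_mono Pl) auto
    qed
    then have "(2 * pi) * ((1 - cmod \<zeta>) / 2 * v 0) \<le> (2 * pi) * v (of_real r * \<zeta>)" by (simp add: mult_ac)
    then show ?thesis by (simp only: mult_le_cancel_left_pos[of "2 * pi"] pi_gt_zero zero_less_mult_iff zero_less_numeral simp_thms)
  qed
  have "((\<lambda>r::real. of_real r * \<zeta>) \<longlongrightarrow> of_real 1 * \<zeta>) (at_left 1)"
    by (intro tendsto_intros)
  moreover have "isCont U \<zeta>" using cont_U z by (simp add: continuous_on_eq_continuous_at)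
  ultimately have "((\<lambda>r::real. v (of_real r * \<zeta>)) \<longlongrightarrow> v \<zeta>) (at_left 1)"
    unfolding v_def by (intro tendsto_intros isCont_tendsto_compose[where g=U]) auto
  moreover have "\<forall>\<^sub>F r in at_left (1::real). r \<in> {0<..<1}" by (rule eventually_at_left_real) simp
  then have "\<forall>\<^sub>F r in at_left (1::real). (1 - cmod \<zeta>) / 2 * v 0 \<le> v (of_real r * \<zeta>)"
    by (rule eventually_mono) (use le in auto)
  ultimately have "(1 - cmod \<zeta>) / 2 * v 0 \<le> v \<zeta>" by (rule tendsto_lowerbound) simp
  then show ?thesis by (simp add: v_def)
qed

text \<open>A rotation makes the value of \<open>phi\<close> at w real and nonnegative; the
  half-plane estimate for 1 minus the rotated map then yields 1 - |phi w|, not just a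
  constant.\<close>

lemma deriv_phi_bound:
  assumes b: "ball w R \<subseteq> W" and R: "R > 0"
  shows "cmod (deriv phi w) \<le> 2 * (1 - cmod (phi w)) / R"
proof -
  define c where "c = (if phi w = 0 then 1 else cnj (phi w) / of_real (cmod (phi w)))"
  have c1: "cmod c = 1" by (simp add: c_def norm_divide)
  have c2: "c * phi w = of_real (cmod (phi w))"
    using complex_norm_square[of "phi w"] by (auto simp: c_def power2_eq_square field_simps)
  have hol: "phi holomorphic_on ball w R" using phi_hol b by (rule holomorphic_on_subset)
  have "cmod (deriv (\<lambda>w. 1 - c * phi w) w) \<le> 2 * Re (1 - c * phi w) / R"
  proof (rule norm_deriv_le_Re[OF _ R])
    show "(\<lambda>w. 1 - c * phi w) holomorphic_on ball w R" using hol by (intro holomorphic_intros)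
    fix u assume "u \<in> ball w R"
    then have "cmod (c * phi u) < 1" using phi_in[of u] b c1 by (auto simp: norm_mult)
    then show "0 < Re (1 - c * phi u)" using complex_Re_le_cmod[of "c * phi u"] by simp
  qed
  moreover have "deriv (\<lambda>w. 1 - c * phi w) w = - c * deriv phi w"
  proof (rule DERIV_imp_deriv)
    have "(phi has_field_derivative deriv phi w) (at w)"
      by (rule holomorphic_derivI[OF hol open_ball]) (use R in auto)
    then show "((\<lambda>w. 1 - c * phi w) has_field_derivative - c * deriv phi w) (at w)"
      by (auto intro!: derivative_eq_intros)
  qed
  ultimately show ?thesis using c1 by (simp add: c2 norm_mult)
qed


text \<open>Along a half-strip of \<open>W\<close> over an edge with outward normal \<open>n\<close>, Schwarz-Pick and Harnack
  bound \<open>|phi'|\<close> by a multiple of \<open>d - n \<bullet> lewy_inv w\<close>, which is the derivative in the direction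
  \<open>n\<close> of the bounded function \<open>d X - \<Phi>\<close>, where \<open>\<Phi> = - lewy_energy w (lewy_inv w)\<close> is the
  Legendre transform; so the image of the strip under \<open>phi\<close> lands at one point.\<close>

lemma strip_landing:
  assumes f: "flat y n r a"
  obtains e where "cmod e = 1"
    "\<And>\<epsilon>. \<epsilon> > 0 \<Longrightarrow> \<exists>X1. \<forall>w. n \<bullet> w > X1 \<longrightarrow> \<bar>(\<i> * n) \<bullet> w - ((\<i> * n) \<bullet> y + a)\<bar> < r / 4 \<longrightarrow> cmod (phi w - e) < \<epsilon>"
proof -
  note fD = flatD[OF f]
  let ?\<tau> = "\<i> * n"
  define Y0 where "Y0 = ?\<tau> \<bullet> y + a"
  define d where "d = n \<bullet> y"
  \<comment> \<open>The strip has half-width r/4, so discs of radius r/4 about its points stay in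
    the half-strip of half-width r/2 known to lie in W; the shift of the end from M to M + r serves
    the same purpose.\<close>
  define R where "R = r / 4"
  have R: "R > 0" using fD(2) by (simp add: R_def)
  have n0: "n \<bullet> n = 1" "?\<tau> \<bullet> ?\<tau> = 1" using fD(1) by (simp_all add: dot_square_norm norm_mult)
  obtain M where M: "M > 0" "\<And>w. n \<bullet> w > M \<Longrightarrow> \<bar>?\<tau> \<bullet> w - Y0\<bar> \<le> r / 2 \<Longrightarrow> w \<in> W"
    using flat_half_strip[OF f] unfolding Y0_def by blast
  obtain C where C: "C > 0" and C': "\<And>w z. z \<in> N \<Longrightarrow> lewy_energy w z \<le> lewy_energy w y \<Longrightarrow> \<bar>?\<tau> \<bullet> w - Y0\<bar> \<le> r / 2
    \<Longrightarrow> (n \<bullet> w) * (n \<bullet> y - n \<bullet> z) \<le> C" using flat_min_bound[OF f] unfolding Y0_def by blast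
  define S where "S = {w. n \<bullet> w > M + r \<and> \<bar>?\<tau> \<bullet> w - Y0\<bar> < R}"
  define Dd where "Dd = (\<lambda>w. d - n \<bullet> lewy_inv w)"
  have SW: "w \<in> W" if "w \<in> S" for w
    using that M(2)[of w] fD(2) by (auto simp: S_def R_def)
  have ballW: "ball w R \<subseteq> W" if w: "w \<in> S" for w
  proof
    fix x assume "x \<in> ball w R"
    then have x: "cmod (x - w) < R" by (simp add: dist_norm norm_minus_commute)
    have "\<bar>n \<bullet> (x - w)\<bar> \<le> cmod (x - w)" "\<bar>?\<tau> \<bullet> (x - w)\<bar> \<le> cmod (x - w)"
      using Cauchy_Schwarz_ineq2[of n "x - w"] Cauchy_Schwarz_ineq2[of ?\<tau> "x - w"] fD(1) by (auto simp: norm_mult)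
    then have "\<bar>n \<bullet> x - n \<bullet> w\<bar> < R" "\<bar>?\<tau> \<bullet> x - ?\<tau> \<bullet> w\<bar> < R"
      using x unfolding inner_diff_right by linarith+
    moreover have "n \<bullet> w > M + r" "\<bar>?\<tau> \<bullet> w - Y0\<bar> < R" using w by (auto simp: S_def)
    ultimately have "n \<bullet> x > M" "\<bar>?\<tau> \<bullet> x - Y0\<bar> \<le> r / 2"
      using R unfolding R_def by linarith+
    then show "x \<in> W" by (rule M(2))
  qed
  define v0 where "v0 = d - n \<bullet> U 0"
  have v0: "v0 > 0" using interior_below_support[OF U_in[of 0] fD(1) fD(3)] by (simp add: v0_def d_def)
  have one: "1 - cmod (phi w) \<le> 2 / v0 * Dd w" if "w \<in> W" for w
    using harnack[OF fD(1) fD(3) phi_in[OF that]] v0 unfolding Dd_def U_phi[OF that] v0_def[symmetric] d_def[symmetric]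
    by (simp add: field_simps)
  have Ddpos: "Dd w > 0" if "w \<in> W" for w
    using interior_below_support[OF lewy_inv_in[OF that] fD(1) fD(3)] by (simp add: Dd_def d_def)
  have minW: "lewy_energy w (lewy_inv w) \<le> lewy_energy w v" if "w \<in> W" "v \<in> N" for w v
    using lewy_min_is_preimage[OF lewy_inv_in[OF that(1)] that(2)] by (simp add: lewy_lewy_inv[OF that(1)])
  have Ddle: "Dd w \<le> C / (n \<bullet> w)" if w: "w \<in> S" for w
  proof -
    have "(n \<bullet> w) * (n \<bullet> y - n \<bullet> lewy_inv w) \<le> C"
      by (rule C'[OF _ minW[OF SW[OF w] fD(4)]])
        (use lewy_inv_in[OF SW[OF w]] interior_subset w fD(2) in \<open>auto simp: S_def R_def\<close>)
    moreover have "n \<bullet> w > 0" using w M fD(2) by (auto simp: S_def)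
    ultimately show ?thesis by (simp add: Dd_def d_def pos_le_divide_eq mult.commute)
  qed
  \<comment> \<open>Schwarz-Pick on discs of radius R contributes 2/R, Harnack contributes
    2/v0.\<close>
  define K where "K = 4 / (R * v0)"
  have K: "K > 0" using R v0 by (simp add: K_def)
  have dphi: "cmod (deriv phi w) \<le> K * Dd w" if w: "w \<in> S" for w
  proof -
    have "cmod (deriv phi w) \<le> 2 * (1 - cmod (phi w)) / R" by (rule deriv_phi_bound[OF ballW[OF w] R])
    also have "\<dots> \<le> 2 * (2 / v0 * Dd w) / R"
      using one[OF SW[OF w]] R by (intro divide_right_mono mult_left_mono) auto
    finally show ?thesis using R v0 by (simp add: K_def field_simps)
  qed
  have phi_der: "(phi has_field_derivative deriv phi w) (at w)" if "w \<in> S" for w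
    by (rule holomorphic_derivI[OF phi_hol open_W SW[OF that]])
  define L where "L = (\<lambda>X::real. X *\<^sub>R n + Y0 *\<^sub>R ?\<tau>)"
  have nL: "n \<bullet> L X = X" and tL: "?\<tau> \<bullet> L X = Y0" for X
    using n0 by (simp_all add: L_def inner_add_right)
  have LS: "L X \<in> S" if "X > M + r" for X
    using that R by (simp add: S_def nL tL)
  \<comment> \<open>The bounded function whose increments will dominate those of \<open>phi\<close>
    along the central line L of the strip.\<close>
  define \<Psi> where "\<Psi> = (\<lambda>X. d * X + lewy_energy (L X) (lewy_inv (L X)))"
  have energy_shift: "lewy_energy (L X') v = lewy_energy (L X) v - (X' - X) * (n \<bullet> v)" for X X' v
    by (simp add: lewy_energy_def L_def inner_add_left algebra_simps)
  have \<Psi>der: "(\<Psi> has_real_derivative Dd (L X)) (at X)" if X: "X > M + r" for X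
  proof -
    have "((\<lambda>h. (\<Psi> (X + h) - \<Psi> X) / h - Dd (L X)) \<longlongrightarrow> 0) (at 0)"
    proof (rule tendsto_rabs_zero_cancel, rule tendsto_sandwich)
      show "\<forall>\<^sub>F h in at 0. 0 \<le> \<bar>(\<Psi> (X + h) - \<Psi> X) / h - Dd (L X)\<bar>" by simp
      show "((\<lambda>h::real. \<bar>h\<bar>) \<longlongrightarrow> 0) (at 0)" by (auto intro!: tendsto_eq_intros)
      have "\<forall>\<^sub>F h in at 0. h \<noteq> 0 \<and> \<bar>h\<bar> < X - (M + r)"
        unfolding eventually_at using X by (auto intro!: exI[of _ "X - (M + r)"])
      then show "\<forall>\<^sub>F h in at 0. \<bar>(\<Psi> (X + h) - \<Psi> X) / h - Dd (L X)\<bar> \<le> \<bar>h\<bar>"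
      proof (rule eventually_mono)
        fix h assume h: "h \<noteq> 0 \<and> \<bar>h\<bar> < X - (M + r)"
        then have w: "L X \<in> W" "L (X + h) \<in> W" using LS X SW by auto
        \<comment> \<open>Each of the two minimisers is a competitor for the other energy. This
          confines the error of the difference quotient to |h| times the displacement of the
          minimiser, which is at most |h|; the inverse itself need not be differentiated.\<close>
        define p q where "p = lewy_inv (L X)" and "q = lewy_inv (L (X + h))"
        have pq: "p \<in> N" "q \<in> N" using lewy_inv_in w interior_subset by (auto simp: p_def q_def)
        have 1: "lewy_energy (L (X + h)) q \<le> lewy_energy (L X) p - h * (n \<bullet> p)"
          using minW[OF w(2) pq(1)] energy_shift[of "X + h" p X] by (simp add: q_def)
        have 2: "lewy_energy (L X) p \<le> lewy_energy (L (X + h)) q + h * (n \<bullet> q)"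
          using minW[OF w(1) pq(2)] energy_shift[of "X + h" q X] by (simp add: p_def)
        define E where "E = \<Psi> (X + h) - \<Psi> X - h * Dd (L X)"
        have E: "E = lewy_energy (L (X + h)) q - lewy_energy (L X) p + h * (n \<bullet> p)"
          unfolding E_def \<Psi>_def Dd_def p_def[symmetric] q_def[symmetric] by (simp add: algebra_simps)
        have "\<bar>E\<bar> \<le> \<bar>h * (n \<bullet> q - n \<bullet> p)\<bar>" using 1 2 unfolding E right_diff_distrib by linarith
        also have "\<dots> = \<bar>h\<bar> * \<bar>n \<bullet> (q - p)\<bar>" by (simp add: abs_mult inner_diff_right)
        also have "\<dots> \<le> \<bar>h\<bar> * \<bar>h\<bar>"
        proof (rule mult_left_mono)
          have "\<bar>n \<bullet> (q - p)\<bar> \<le> cmod (q - p)" using Cauchy_Schwarz_ineq2[of n "q - p"] fD(1) by simp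
          also have "\<dots> \<le> cmod (L (X + h) - L X)" unfolding p_def q_def by (rule lewy_inv_nonexpanding[OF w(2,1)])
          also have "\<dots> = \<bar>h\<bar>" using fD(1) by (simp add: L_def algebra_simps flip: scaleR_left_diff_distrib)
          finally show "\<bar>n \<bullet> (q - p)\<bar> \<le> \<bar>h\<bar>" .
        qed simp
        finally have "\<bar>E\<bar> / \<bar>h\<bar> \<le> \<bar>h\<bar>" using h by (simp add: pos_divide_le_eq)
        moreover have "(\<Psi> (X + h) - \<Psi> X) / h - Dd (L X) = E / h" using h by (simp add: E_def field_simps)
        ultimately show "\<bar>(\<Psi> (X + h) - \<Psi> X) / h - Dd (L X)\<bar> \<le> \<bar>h\<bar>" by simp
      qed
    qed simp
    then have "((\<lambda>h. (\<Psi> (X + h) - \<Psi> X) / h) \<longlongrightarrow> Dd (L X)) (at 0)" by (rule LIM_zero_cancel)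
    then show ?thesis by (simp add: DERIV_def)
  qed
  have \<Psi>cont: "continuous_on {X..X'} \<Psi>" if "X > M + r" for X X'
    by (rule DERIV_continuous_on[where D="\<lambda>X. Dd (L X)"], rule has_field_derivative_at_within, rule \<Psi>der) (use that in auto)
  have Lder: "((\<lambda>X. phi (L X)) has_vector_derivative n * deriv phi (L X)) (at X)" if "X > M + r" for X
  proof -
    have "(L has_vector_derivative n) (at X)" unfolding L_def by (auto intro!: derivative_eq_intros)
    from field_vector_diff_chain_at[OF this phi_der[OF LS[OF that]]] show ?thesis by (simp add: o_def)
  qed
  have phi_le: "cmod (phi (L X') - phi (L X)) \<le> K * (\<Psi> X' - \<Psi> X)" if X: "X > M + r" "X < X'" for X X'
  proof -
    have "cmod (phi (L X') - phi (L X)) \<le> K * \<Psi> X' - K * \<Psi> X"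
    proof (rule differentiable_bound_general[OF X(2)])
      show "continuous_on {X..X'} (\<lambda>X. phi (L X))"
      proof (rule continuous_at_imp_continuous_on, rule ballI)
        fix x assume "x \<in> {X..X'}"
        then have "x > M + r" using X by simp
        from has_vector_derivative_continuous[OF Lder[OF this]] show "isCont (\<lambda>X. phi (L X)) x" .
      qed
      show "continuous_on {X..X'} (\<lambda>X. K * \<Psi> X)" by (intro continuous_intros \<Psi>cont X)
      fix x assume x: "X < x" "x < X'"
      then have xM: "x > M + r" using X by simp
      show "((\<lambda>X. phi (L X)) has_vector_derivative n * deriv phi (L x)) (at x)" by (rule Lder[OF xM])
      show "((\<lambda>X. K * \<Psi> X) has_vector_derivative K * Dd (L x)) (at x)"
        using DERIV_cmult[OF \<Psi>der[OF xM]] by (simp add: has_real_derivative_iff_has_vector_derivative)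
      show "cmod (n * deriv phi (L x)) \<le> K * Dd (L x)" using dphi[OF LS[OF xM]] fD(1) by (simp add: norm_mult)
    qed
    then show ?thesis by (simp add: algebra_simps)
  qed
  have \<Psi>mono: "\<Psi> X \<le> \<Psi> X'" if "X > M + r" "X \<le> X'" for X X'
  proof (cases "X = X'")
    case False
    then have "X < X'" using that by simp
    then have "0 \<le> K * (\<Psi> X' - \<Psi> X)" using order_trans[OF norm_ge_zero phi_le[OF that(1)]] by blast
    then show ?thesis using K by (simp add: zero_le_mult_iff)
  qed simp
  \<comment> \<open>The energy of the competitor y on the central line, without its part linear in
    X; that part is cancelled by \<open>d * X\<close> in \<Psi>.\<close>
  define B where "B = \<sigma> y + (y \<bullet> y) / 2 - Y0 * (?\<tau> \<bullet> y)"
  have \<Psi>le: "\<Psi> X \<le> B" if "X > M + r" for X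
  proof -
    have "lewy_energy (L X) (lewy_inv (L X)) \<le> lewy_energy (L X) y"
      by (rule minW[OF SW[OF LS[OF that]] fD(4)])
    also have "\<dots> = B - d * X" by (simp add: lewy_energy_def L_def B_def d_def inner_add_left)
    finally show ?thesis by (simp add: \<Psi>_def)
  qed
  define T where "T = (SUP X\<in>{M + r<..}. \<Psi> X)"
  have bdd: "bdd_above (\<Psi> ` {M + r<..})" using \<Psi>le by (auto intro!: bdd_aboveI[of _ B])
  have \<Psi>T: "\<Psi> X \<le> T" if "X > M + r" for X unfolding T_def using bdd that by (auto intro: cSUP_upper)
  have Tapprox: "\<exists>X1>M + r. \<forall>X\<ge>X1. T - \<Psi> X < \<epsilon>" if "\<epsilon> > 0" for \<epsilon>
  proof -
    have "T - \<epsilon> < T" using that by simp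
    then obtain X1 where "X1 > M + r" "T - \<epsilon> < \<Psi> X1"
      unfolding T_def using less_cSUP_iff[OF _ bdd, of "T - \<epsilon>"] by (auto simp: T_def)
    then show ?thesis using \<Psi>mono[of X1] by (intro exI[of _ X1]) force
  qed
  have "Cauchy (\<lambda>k::nat. phi (L (M + r + 1 + real k)))"
  proof (rule CauchyI)
    fix \<epsilon> :: real assume "\<epsilon> > 0"
    then obtain X1 where X1: "X1 > M + r" "\<And>X. X \<ge> X1 \<Longrightarrow> T - \<Psi> X < \<epsilon> / K"
      using Tapprox[of "\<epsilon> / K"] K by auto
    obtain k0 :: nat where k0: "X1 \<le> real k0" using real_arch_simple by blast
    have half: "cmod (phi (L (M + r + 1 + real k)) - phi (L (M + r + 1 + real j))) < \<epsilon>" if "k0 \<le> j" "j < k" for j k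
    proof -
      have j: "M + r + 1 + real j \<ge> X1" using k0 that M(1) fD(2) by (simp add: of_nat_mono order_trans)
      have "cmod (phi (L (M + r + 1 + real k)) - phi (L (M + r + 1 + real j))) \<le> K * (\<Psi> (M + r + 1 + real k) - \<Psi> (M + r + 1 + real j))"
        by (rule phi_le) (use that in auto)
      also have "\<dots> \<le> K * (T - \<Psi> (M + r + 1 + real j))"
        using K \<Psi>T[of "M + r + 1 + real k"] by (intro mult_left_mono) auto
      also have "\<dots> < K * (\<epsilon> / K)" using X1(2)[OF j] K by (intro mult_strict_left_mono)
      finally show ?thesis using K by simp
    qed
    show "\<exists>k0. \<forall>m\<ge>k0. \<forall>n\<ge>k0. cmod (phi (L (M + r + 1 + real m)) - phi (L (M + r + 1 + real n))) < \<epsilon>"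
    proof (intro exI[of _ k0] allI impI)
      fix m n assume "k0 \<le> m" "k0 \<le> n"
      then show "cmod (phi (L (M + r + 1 + real m)) - phi (L (M + r + 1 + real n))) < \<epsilon>"
        using half[of m n] half[of n m] \<open>\<epsilon> > 0\<close> by (cases m n rule: linorder_cases) (auto simp: norm_minus_commute)
    qed
  qed
  then obtain e where e: "(\<lambda>k::nat. phi (L (M + r + 1 + real k))) \<longlonglongrightarrow> e"
    using Cauchy_convergent_iff convergent_def by blast
  have e_le: "cmod (e - phi (L X)) \<le> K * (T - \<Psi> X)" if X: "X > M + r" for X
  proof (rule LIMSEQ_le_const2)
    show "(\<lambda>k. cmod (phi (L (M + r + 1 + real k)) - phi (L X))) \<longlonglongrightarrow> cmod (e - phi (L X))"
      by (intro tendsto_intros e)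
    obtain k0 :: nat where k0: "X < real k0" using reals_Archimedean2 by blast
    have "cmod (phi (L (M + r + 1 + real k)) - phi (L X)) \<le> K * (T - \<Psi> X)" if "k \<ge> k0" for k
    proof -
      have "X < M + r + 1 + real k" using k0 that M(1) fD(2) by (simp add: of_nat_mono)
      from phi_le[OF X this] show ?thesis
      proof (rule order_trans)
        show "K * (\<Psi> (M + r + 1 + real k) - \<Psi> X) \<le> K * (T - \<Psi> X)"
          using K \<Psi>T[of "M + r + 1 + real k"] by (intro mult_left_mono) auto
      qed
    qed
    then show "\<exists>k0. \<forall>k\<ge>k0. cmod (phi (L (M + r + 1 + real k)) - phi (L X)) \<le> K * (T - \<Psi> X)" by blast
  qed
  \<comment> \<open>Across the strip the pointwise bound is enough: the derivative is O(1/X) on a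
    segment of length at most R.\<close>
  have strip: "cmod (phi w - phi (L (n \<bullet> w))) \<le> K * (C / (n \<bullet> w)) * R" if w: "w \<in> S" for w
  proof -
    define X where "X = n \<bullet> w"
    define Sg where "Sg = closed_segment w (L X)"
    have X: "X > M + r" using w by (simp add: S_def X_def)
    have seg: "z \<in> S \<and> n \<bullet> z = X" if "z \<in> Sg" for z
    proof -
      have "convex {z. n \<bullet> z = X}" by (rule convex_hyperplane)
      moreover have "convex {z. \<bar>?\<tau> \<bullet> z - Y0\<bar> < R}"
      proof -
        have "{z. \<bar>?\<tau> \<bullet> z - Y0\<bar> < R} = {z. ?\<tau> \<bullet> z < Y0 + R} \<inter> {z. ?\<tau> \<bullet> z > Y0 - R}" by auto
        then show ?thesis by (simp add: convex_Int convex_halfspace_lt convex_halfspace_gt)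
      qed
      ultimately have "convex ({z. n \<bullet> z = X} \<inter> {z. \<bar>?\<tau> \<bullet> z - Y0\<bar> < R})" by (rule convex_Int)
      then have "Sg \<subseteq> {z. n \<bullet> z = X} \<inter> {z. \<bar>?\<tau> \<bullet> z - Y0\<bar> < R}"
        unfolding Sg_def by (rule closed_segment_subset[rotated 2]) (use w R in \<open>auto simp: S_def X_def nL tL\<close>)
      then show ?thesis using that X by (auto simp: S_def)
    qed
    have "cmod (phi w - phi (L X)) \<le> K * (C / X) * cmod (w - L X)"
    proof (rule field_differentiable_bound[where S=Sg])
      show "convex Sg" by (simp add: Sg_def)
      show "w \<in> Sg" "L X \<in> Sg" by (simp_all add: Sg_def)
      fix z assume z: "z \<in> Sg"
      show "(phi has_field_derivative deriv phi z) (at z within Sg)"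
        using phi_der seg[OF z] has_field_derivative_at_within by blast
      have "cmod (deriv phi z) \<le> K * Dd z" using dphi seg[OF z] by blast
      also have "\<dots> \<le> K * (C / X)" using Ddle[of z] seg[OF z] K by (intro mult_left_mono) auto
      finally show "cmod (deriv phi z) \<le> K * (C / X)" .
    qed
    also have "\<dots> \<le> K * (C / X) * R"
    proof (rule mult_left_mono)
      have "w - L X = (?\<tau> \<bullet> w - Y0) *\<^sub>R ?\<tau>"
        using frame_expand[OF fD(1), of w] by (simp add: L_def X_def algebra_simps)
      then have "cmod (w - L X) = \<bar>?\<tau> \<bullet> w - Y0\<bar>" using fD(1) by (simp add: norm_mult)
      then show "cmod (w - L X) \<le> R" using w by (simp add: S_def)
      show "0 \<le> K * (C / X)" using K C X M fD(2) by simp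
    qed
    finally show ?thesis by (simp add: X_def)
  qed
  have main: "\<exists>X1. \<forall>w. n \<bullet> w > X1 \<longrightarrow> \<bar>?\<tau> \<bullet> w - ((\<i> * n) \<bullet> y + a)\<bar> < r / 4 \<longrightarrow> cmod (phi w - e) < \<epsilon>" if \<epsilon>: "\<epsilon> > 0" for \<epsilon>
  proof -
    obtain X1 where X1: "X1 > M + r" "\<And>X. X \<ge> X1 \<Longrightarrow> T - \<Psi> X < \<epsilon> / 2 / K"
      using Tapprox[of "\<epsilon> / 2 / K"] K \<epsilon> by auto
    define X2 where "X2 = max X1 (2 * K * C * R / \<epsilon>)"
    have "cmod (phi w - e) < \<epsilon>" if w: "n \<bullet> w > X2" "\<bar>?\<tau> \<bullet> w - Y0\<bar> < r / 4" for w
    proof -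
      have wS: "w \<in> S" using w X1(1) by (auto simp: S_def R_def X2_def)
      have X: "n \<bullet> w > X1" "n \<bullet> w > 2 * K * C * R / \<epsilon>" using w by (auto simp: X2_def)
      have Xp: "n \<bullet> w > 0" using X(1) X1(1) M(1) fD(2) by linarith
      have "K * (C / (n \<bullet> w)) * R < \<epsilon> / 2"
        using X(2) \<epsilon> Xp by (simp add: field_simps)
      moreover have "cmod (e - phi (L (n \<bullet> w))) < \<epsilon> / 2"
      proof -
        have "cmod (e - phi (L (n \<bullet> w))) \<le> K * (T - \<Psi> (n \<bullet> w))" by (rule e_le) (use X X1 in auto)
        also have "\<dots> < K * (\<epsilon> / 2 / K)" using X1(2)[of "n \<bullet> w"] X(1) K by (intro mult_strict_left_mono) auto
        finally show ?thesis using K by simp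
      qed
      moreover have "cmod (phi w - e) \<le> cmod (phi w - phi (L (n \<bullet> w))) + cmod (e - phi (L (n \<bullet> w)))"
        using norm_triangle_ineq4[of "phi w - phi (L (n \<bullet> w))" "e - phi (L (n \<bullet> w))"] by simp
      ultimately show ?thesis using strip[OF wS] by linarith
    qed
    then show ?thesis unfolding Y0_def by blast
  qed
  \<comment> \<open>By Harnack, 1 - |phi| is bounded by a multiple of the depth, which is
    O(1/X).\<close>
  have "cmod e = 1"
  proof (rule LIMSEQ_unique)
    show "(\<lambda>k. cmod (phi (L (M + r + 1 + real k)))) \<longlonglongrightarrow> cmod e" by (intro tendsto_intros e)
    show "(\<lambda>k. cmod (phi (L (M + r + 1 + real k)))) \<longlonglongrightarrow> 1"
    proof (rule tendsto_sandwich)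
      have c: "(\<lambda>k. 1 - 2 / v0 * (C / (M + r + 1 + real k))) \<longlonglongrightarrow> 1 - 2 / v0 * 0"
        by (intro tendsto_intros tendsto_divide_0[OF tendsto_const] filterlim_at_top_imp_at_infinity
            filterlim_tendsto_add_at_top[OF tendsto_const] filterlim_real_sequentially)
      then show "(\<lambda>k. 1 - 2 / v0 * (C / (M + r + 1 + real k))) \<longlonglongrightarrow> 1" by simp
      show "\<forall>\<^sub>F k in sequentially. 1 - 2 / v0 * (C / (M + r + 1 + real k)) \<le> cmod (phi (L (M + r + 1 + real k)))"
      proof (rule always_eventually, rule allI)
        fix k
        have S: "L (M + r + 1 + real k) \<in> S" by (rule LS) simp
        have "2 / v0 * Dd (L (M + r + 1 + real k)) \<le> 2 / v0 * (C / (M + r + 1 + real k))"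
          using Ddle[OF S] v0 unfolding nL by (intro mult_left_mono) auto
        then show "1 - 2 / v0 * (C / (M + r + 1 + real k)) \<le> cmod (phi (L (M + r + 1 + real k)))"
          using one[OF SW[OF S]] by linarith
      qed
      show "\<forall>\<^sub>F k in sequentially. cmod (phi (L (M + r + 1 + real k))) \<le> 1"
        by (rule always_eventually) (use phi_in[OF SW[OF LS]] in \<open>auto simp: less_imp_le\<close>)
    qed (rule tendsto_const)
  qed
  then show thesis using that main by blast
qed

text \<open>As z tends to an edge point, its Lewy image goes to infinity in the normal direction
  while its tangential coordinate converges. For |t| < r/4 it ends in the one strip over y, so all
  these edge points share the landing point.\<close>

lemma flat_landing:
  assumes f: "flat y n r a"
  obtains e where "cmod e = 1" "\<And>t. \<bar>t\<bar> < r / 4 \<Longrightarrow> (G \<longlongrightarrow> e) (at (y + t *\<^sub>R (\<i> * n)) within interior N)"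
proof -
  note fD = flatD[OF f]
  obtain e where e: "cmod e = 1" and lim: "\<And>\<epsilon>. \<epsilon> > 0 \<Longrightarrow> \<exists>X1. \<forall>w. n \<bullet> w > X1 \<longrightarrow> \<bar>(\<i> * n) \<bullet> w - ((\<i> * n) \<bullet> y + a)\<bar> < r / 4 \<longrightarrow> cmod (phi w - e) < \<epsilon>"
    using strip_landing[OF f] by metis
  have "(G \<longlongrightarrow> e) (at (y + t *\<^sub>R (\<i> * n)) within interior N)" if t: "\<bar>t\<bar> < r / 4" for t
  proof (rule tendstoI)
    fix \<epsilon> :: real assume "\<epsilon> > 0"
    then obtain X1 where X1: "\<And>w. n \<bullet> w > X1 \<Longrightarrow> \<bar>(\<i> * n) \<bullet> w - ((\<i> * n) \<bullet> y + a)\<bar> < r / 4 \<Longrightarrow> cmod (phi w - e) < \<epsilon>"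
      using lim by blast
    let ?y = "y + t *\<^sub>R (\<i> * n)"
    let ?F = "at ?y within interior N"
    have f': "flat ?y n (r - \<bar>t\<bar>) a" using flat_shift[OF f] t fD(2) by simp
    have "filterlim (\<lambda>z. n \<bullet> z + grad \<sigma> z \<bullet> n) at_top ?F"
      by (rule filterlim_tendsto_add_at_top[OF _ flat_grad_normal[OF f']])
         (rule tendsto_inner[OF tendsto_const tendsto_ident_at])
    then have 1: "\<forall>\<^sub>F z in ?F. n \<bullet> z + grad \<sigma> z \<bullet> n > X1" by (simp add: filterlim_at_top_dense)
    have "((\<lambda>z. \<bar>(\<i> * n) \<bullet> z + grad \<sigma> z \<bullet> (\<i> * n) - ((\<i> * n) \<bullet> y + a)\<bar>) \<longlongrightarrow> \<bar>(\<i> * n) \<bullet> ?y + a - ((\<i> * n) \<bullet> y + a)\<bar>) ?F"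
      by (intro tendsto_intros flat_grad_tangential[OF f'])
    moreover have "\<bar>(\<i> * n) \<bullet> ?y + a - ((\<i> * n) \<bullet> y + a)\<bar> = \<bar>t\<bar>"
      using fD(1) by (simp add: inner_add_right dot_square_norm norm_mult)
    moreover have "\<bar>t\<bar> < r / 4" by (rule t)
    ultimately have 2: "\<forall>\<^sub>F z in ?F. \<bar>(\<i> * n) \<bullet> z + grad \<sigma> z \<bullet> (\<i> * n) - ((\<i> * n) \<bullet> y + a)\<bar> < r / 4"
      by (simp only: order_tendstoD)
    from 1 2 show "\<forall>\<^sub>F z in ?F. dist (G z) e < \<epsilon>"
      by eventually_elim (auto simp: G_def dist_norm lewy_def inner_add_right inner_commute intro!: X1)
  qed
  then show thesis using that e by blast
qed

end

section \<open>The boundary function\<close>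

text \<open>A boundary point that is not extreme lies inside a segment of N. A supporting functional
  attains its maximum over this segment at an inner point, hence is constant on it, and the segment
  lies in the supporting line.\<close>

lemma edge_at_non_extreme:
  fixes N :: "complex set"
  assumes cvx: "convex N" and cl: "closed N" and int: "interior N \<noteq> {}"
    and y: "y \<in> frontier N" and ne: "\<not> y extreme_point_of N"
  obtains n r where "cmod n = 1" "r > 0" "\<And>z. z \<in> N \<Longrightarrow> n \<bullet> z \<le> n \<bullet> y"
    "\<And>t. \<bar>t\<bar> \<le> r \<Longrightarrow> y + t *\<^sub>R (\<i> * n) \<in> N"
proof -
  have yN: "y \<in> N" using y cl frontier_subset_eq by blast
  have "y \<notin> rel_interior N" using y rel_interior_nonempty_interior[OF int] by (simp add: frontier_def)
  then obtain a0 where a0: "a0 \<noteq> 0" "\<And>z. z \<in> N \<Longrightarrow> a0 \<bullet> y \<le> a0 \<bullet> z"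
    using supporting_hyperplane_rel_boundary[OF cvx yN] by metis
  define n where "n = (- 1 / cmod a0) *\<^sub>R a0"
  have n1: "cmod n = 1" using a0 by (simp add: n_def)
  have sup: "n \<bullet> z \<le> n \<bullet> y" if "z \<in> N" for z
    using a0(2)[OF that] a0(1) by (simp add: n_def divide_right_mono)
  obtain a b where ab: "a \<in> N" "b \<in> N" "y \<in> open_segment a b"
    using ne yN by (auto simp: extreme_point_of_def)
  then obtain u where u: "0 < u" "u < 1" "y = (1 - u) *\<^sub>R a + u *\<^sub>R b" and "a \<noteq> b"
    by (auto simp: in_segment)
  have ya: "y \<noteq> a" using ab(3) by (auto simp: open_segment_def)
  have "n \<bullet> y = (1 - u) * (n \<bullet> a) + u * (n \<bullet> b)" by (subst u(3)) (simp add: inner_add_right)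
  then have bal: "(1 - u) * (n \<bullet> y - n \<bullet> a) + u * (n \<bullet> y - n \<bullet> b) = 0" by (simp add: algebra_simps)
  moreover have "(1 - u) * (n \<bullet> y - n \<bullet> a) \<ge> 0" "u * (n \<bullet> y - n \<bullet> b) \<ge> 0"
    using u sup[OF ab(1)] sup[OF ab(2)] by auto
  ultimately have "(1 - u) * (n \<bullet> y - n \<bullet> a) = 0" "u * (n \<bullet> y - n \<bullet> b) = 0" by linarith+
  then have na: "n \<bullet> (a - y) = 0" "n \<bullet> (b - y) = 0" using u by (auto simp: inner_diff_right)
  \<comment> \<open>Signed positions of the two end points along the tangent; since y is a proper
    convex combination of them, the signs are opposite.\<close>
  define \<alpha> \<beta> where "\<alpha> = (\<i> * n) \<bullet> (a - y)" and "\<beta> = (\<i> * n) \<bullet> (b - y)"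
  have a: "y + \<alpha> *\<^sub>R (\<i> * n) = a" and b: "y + \<beta> *\<^sub>R (\<i> * n) = b"
    using frame_expand[OF n1, of "a - y"] frame_expand[OF n1, of "b - y"] na by (simp_all add: \<alpha>_def \<beta>_def algebra_simps)
  have "(1 - u) *\<^sub>R (a - y) + u *\<^sub>R (b - y) = 0" using u(3) by (simp add: algebra_simps)
  then have "(\<i> * n) \<bullet> ((1 - u) *\<^sub>R (a - y) + u *\<^sub>R (b - y)) = 0" by simp
  then have ab0: "(1 - u) * \<alpha> + u * \<beta> = 0" by (simp add: inner_add_right \<alpha>_def \<beta>_def)
  have \<alpha>0: "\<alpha> \<noteq> 0" using a ya by auto
  define P Q where "P = max \<alpha> \<beta>" and "Q = min \<alpha> \<beta>"
  have PQ: "P > 0" "Q < 0"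
  proof -
    have "(\<alpha> > 0 \<and> \<beta> < 0) \<or> (\<alpha> < 0 \<and> \<beta> > 0)"
    proof (cases "\<alpha> > 0")
      case True
      then have "(1 - u) * \<alpha> > 0" using u by simp
      then have "u * \<beta> < 0" using ab0 by linarith
      then show ?thesis using True u by (simp add: mult_less_0_iff)
    next
      case False
      then have "\<alpha> < 0" using \<alpha>0 by simp
      then have "(1 - u) * \<alpha> < 0" using u by (simp add: mult_less_0_iff)
      then have "u * \<beta> > 0" using ab0 by linarith
      then show ?thesis using \<open>\<alpha> < 0\<close> u by (simp add: zero_less_mult_iff)
    qed
    then show "P > 0" "Q < 0" by (auto simp: P_def Q_def)
  qed
  have PN: "y + P *\<^sub>R (\<i> * n) \<in> N" "y + Q *\<^sub>R (\<i> * n) \<in> N"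
    using a b ab by (auto simp: P_def Q_def max_def min_def)
  have seg: "y + t *\<^sub>R (\<i> * n) \<in> N" if "y + k *\<^sub>R (\<i> * n) \<in> N" "k \<noteq> 0" "0 \<le> t / k" "t / k \<le> 1" for t k
  proof -
    have "(1 - t / k) *\<^sub>R y + (t / k) *\<^sub>R (y + k *\<^sub>R (\<i> * n)) \<in> N"
      using cvx yN that by (simp add: convex_alt)
    moreover have "(1 - t / k) *\<^sub>R y + (t / k) *\<^sub>R (y + k *\<^sub>R (\<i> * n)) = y + t *\<^sub>R (\<i> * n)"
      using that(2) by (simp add: algebra_simps)
    ultimately show ?thesis by simp
  qed
  show thesis
  proof (rule that[OF n1 _ sup])
    show "0 < min P (- Q)" using PQ by simp
    fix t assume t: "\<bar>t\<bar> \<le> min P (- Q)"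
    show "y + t *\<^sub>R (\<i> * n) \<in> N"
    proof (cases "t \<ge> 0")
      case True then show ?thesis using t PQ by (intro seg[OF PN(1)]) auto
    next
      case False then show ?thesis using t PQ by (intro seg[OF PN(2)]) (auto simp: divide_nonpos_neg neg_divide_le_eq)
    qed
  qed
qed

locale tension_bdry = tension_disc +
  fixes L :: "complex \<Rightarrow> real" and A :: "complex set"
  assumes L_sigma: "\<And>x. x \<in> frontier N \<Longrightarrow> \<sigma> x = L x"
    and L_pw: "piecewise_affine_boundary N L"
    and A_def: "A = corners N \<union> nondiff_points N L"
    and finite_A: "finite A"
begin

lemma closed_N: "closed N" using compact_N by (rule compact_imp_closed)

lemma frontierI: "z \<in> N \<Longrightarrow> z \<notin> interior N \<Longrightarrow> z \<in> frontier N"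
  using closure_subset by (auto simp: frontier_def)

lemma frontier_N: "z \<in> frontier N \<Longrightarrow> z \<in> N" "z \<in> frontier N \<Longrightarrow> z \<notin> interior N"
  using closed_N frontier_subset_eq by (auto simp: frontier_def)

text \<open>Only finitely many points are exceptional, so a short segment about y meets none of them
  except possibly y. Since y may be a break itself, each half is treated on its own and the slopes
  ap and am may differ.\<close>

lemma bent_edge:
  assumes y: "y \<in> frontier N" "y \<notin> corners N"
  obtains n r am ap where "cmod n = 1" "r > 0" "\<And>z. z \<in> N \<Longrightarrow> n \<bullet> z \<le> n \<bullet> y"
    "\<And>t. \<bar>t\<bar> \<le> r \<Longrightarrow> y + t *\<^sub>R (\<i> * n) \<in> N"
    "\<And>t. \<bar>t\<bar> \<le> r \<Longrightarrow> t \<noteq> 0 \<Longrightarrow> y + t *\<^sub>R (\<i> * n) \<notin> A"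
    "\<And>t. \<bar>t\<bar> \<le> r \<Longrightarrow> \<sigma> (y + t *\<^sub>R (\<i> * n)) = \<sigma> y + (if t \<ge> 0 then ap else am) * t"
proof -
  obtain n r where n: "cmod n = 1" and r: "r > 0" and sup: "\<And>z. z \<in> N \<Longrightarrow> n \<bullet> z \<le> n \<bullet> y"
    and seg: "\<And>t. \<bar>t\<bar> \<le> r \<Longrightarrow> y + t *\<^sub>R (\<i> * n) \<in> N"
    using edge_at_non_extreme[OF convex_N closed_N interior_N y(1)] y(2) unfolding corners_def by blast
  let ?\<tau> = "\<i> * n"
  have fr: "y + t *\<^sub>R ?\<tau> \<in> frontier N" if "\<bar>t\<bar> \<le> r" for t
  proof (rule frontierI[OF seg[OF that]])
    show "y + t *\<^sub>R ?\<tau> \<notin> interior N"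
      using interior_below_support[OF _ n sup, of "y + t *\<^sub>R ?\<tau>"] by (auto simp: inner_add_right)
  qed
  obtain F where F: "finite F" and aff: "\<forall>a b. closed_segment a b \<subseteq> frontier N \<and> open_segment a b \<inter> (F \<union> corners N) = {}
      \<longrightarrow> affine_on_segment L a b"
    using L_pw unfolding piecewise_affine_boundary_def by (elim exE conjE)
  obtain d where d: "d > 0" "\<And>x. x \<in> F \<union> A \<Longrightarrow> x \<noteq> y \<Longrightarrow> d \<le> dist y x"
    using finite_set_avoid[of "F \<union> A" y] F finite_A by auto
  define r' where "r' = min r d / 2"
  have r': "0 < r'" "r' < r" "r' < d" using r d by (auto simp: r'_def)
  have avoid: "y + t *\<^sub>R ?\<tau> \<notin> F \<union> A" if "\<bar>t\<bar> \<le> r'" "t \<noteq> 0" for t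
  proof
    assume "y + t *\<^sub>R ?\<tau> \<in> F \<union> A"
    moreover have "y + t *\<^sub>R ?\<tau> \<noteq> y" using that n by auto
    ultimately have "d \<le> dist y (y + t *\<^sub>R ?\<tau>)" by (rule d(2))
    then show False using that r' n by (simp add: dist_norm norm_mult)
  qed
  have one_side: "L (y + (s * k) *\<^sub>R ?\<tau>) = (1 - s) * L y + s * L (y + k *\<^sub>R ?\<tau>)" if k: "\<bar>k\<bar> = r'" and s: "0 \<le> s" "s \<le> 1" for k s
  proof -
    have pt: "(1 - u) *\<^sub>R y + u *\<^sub>R (y + k *\<^sub>R ?\<tau>) = y + (u * k) *\<^sub>R ?\<tau>" for u by (simp add: algebra_simps)
    have ub: "\<bar>u * k\<bar> \<le> r'" if "0 \<le> u" "u \<le> 1" for u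
      using that k r'(1) by (simp add: abs_mult mult_left_le_one_le)
    have "affine_on_segment L y (y + k *\<^sub>R ?\<tau>)"
    proof (rule aff[rule_format], rule conjI)
      show "closed_segment y (y + k *\<^sub>R ?\<tau>) \<subseteq> frontier N"
      proof
        fix x assume "x \<in> closed_segment y (y + k *\<^sub>R ?\<tau>)"
        then obtain u where u: "0 \<le> u" "u \<le> 1" "x = y + (u * k) *\<^sub>R ?\<tau>" unfolding in_segment pt by blast
        then show "x \<in> frontier N" using fr[of "u * k"] ub[of u] r' by auto
      qed
      show "open_segment y (y + k *\<^sub>R ?\<tau>) \<inter> (F \<union> corners N) = {}"
      proof (rule ccontr)
        assume "open_segment y (y + k *\<^sub>R ?\<tau>) \<inter> (F \<union> corners N) \<noteq> {}"
        then obtain x where x: "x \<in> open_segment y (y + k *\<^sub>R ?\<tau>)" "x \<in> F \<union> A" by (auto simp: A_def)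
        then obtain u where u: "0 < u" "u < 1" "x = y + (u * k) *\<^sub>R ?\<tau>" unfolding in_segment pt by blast
        then show False using avoid[of "u * k"] ub[of u] x(2) k r' by auto
      qed
    qed
    then have "L ((1 - complex_of_real s) * y + complex_of_real s * (y + k *\<^sub>R ?\<tau>)) = (1 - s) * L y + s * L (y + k *\<^sub>R ?\<tau>)"
      using s unfolding affine_on_segment_def by auto
    moreover have "(1 - complex_of_real s) * y + complex_of_real s * (y + k *\<^sub>R ?\<tau>) = y + (s * k) *\<^sub>R ?\<tau>"
      unfolding pt[symmetric] by (simp add: scaleR_conv_of_real)
    ultimately show ?thesis by simp
  qed
  define ap am where "ap = (L (y + r' *\<^sub>R ?\<tau>) - L y) / r'" and "am = (L y - L (y + (- r') *\<^sub>R ?\<tau>)) / r'"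
  have val: "\<sigma> (y + t *\<^sub>R ?\<tau>) = \<sigma> y + (if t \<ge> 0 then ap else am) * t" if t: "\<bar>t\<bar> \<le> r'" for t
  proof -
    have s: "\<sigma> (y + t *\<^sub>R ?\<tau>) = L (y + t *\<^sub>R ?\<tau>)" "\<sigma> y = L y"
      using L_sigma fr[of t] y(1) t r' by auto
    show ?thesis
    proof (cases "t \<ge> 0")
      case True
      have "L (y + (t / r' * r') *\<^sub>R ?\<tau>) = (1 - t / r') * L y + t / r' * L (y + r' *\<^sub>R ?\<tau>)"
        by (rule one_side) (use r' t True in auto)
      moreover have "t / r' * r' = t" using r' by simp
      ultimately have "L (y + t *\<^sub>R ?\<tau>) = (1 - t / r') * L y + t / r' * L (y + r' *\<^sub>R ?\<tau>)" by (simp only:)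
      also have "\<dots> = L y + ap * t" by (simp add: ap_def divide_inverse algebra_simps)
      finally show ?thesis using True unfolding s by simp
    next
      case False
      have "0 \<le> - t / r'" using r'(1) False by (intro divide_nonneg_pos) auto
      moreover have "- t / r' \<le> 1" by (subst pos_divide_le_eq) (use r'(1) t in auto)
      ultimately have "L (y + (- t / r' * (- r')) *\<^sub>R ?\<tau>) = (1 - - t / r') * L y + - t / r' * L (y + (- r') *\<^sub>R ?\<tau>)"
        using r' by (intro one_side) auto
      moreover have "- t / r' * (- r') = t" using r' by simp
      ultimately have "L (y + t *\<^sub>R ?\<tau>) = (1 - - t / r') * L y + - t / r' * L (y + (- r') *\<^sub>R ?\<tau>)" by (simp only:)
      also have "\<dots> = L y + am * t" by (simp add: am_def divide_inverse algebra_simps)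
      finally show ?thesis using False unfolding s by simp
    qed
  qed
  show thesis by (rule that[OF n r'(1) sup _ _ val]) (use r' seg avoid in auto)
qed

text \<open>The direction v of differentiability is an unspecified one. As y + tv lies in N for both
  signs of t, v is tangential, and the derivative from the two sides equates the slopes.\<close>

lemma flat_at_regular:
  assumes y: "y \<in> frontier N - A"
  obtains n r a where "flat y n r a"
proof -
  have y1: "y \<in> frontier N" "y \<notin> corners N" "y \<notin> nondiff_points N L" using y by (auto simp: A_def)
  obtain n r am ap where n: "cmod n = 1" and r: "r > 0" and sup: "\<And>z. z \<in> N \<Longrightarrow> n \<bullet> z \<le> n \<bullet> y"
    and seg: "\<And>t. \<bar>t\<bar> \<le> r \<Longrightarrow> y + t *\<^sub>R (\<i> * n) \<in> N"
    and val: "\<And>t. \<bar>t\<bar> \<le> r \<Longrightarrow> \<sigma> (y + t *\<^sub>R (\<i> * n)) = \<sigma> y + (if t \<ge> 0 then ap else am) * t"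
    using bent_edge[OF y1(1,2)] by metis
  obtain v e where v: "v \<noteq> 0" "e > 0" "\<And>t. \<bar>t\<bar> < e \<Longrightarrow> y + of_real t * v \<in> frontier N"
    and dif: "(\<lambda>t. L (y + of_real t * v)) differentiable (at 0)"
    using y1 unfolding nondiff_points_def by blast
  have "n \<bullet> v = 0"
  proof -
    have "y + of_real (e/2) * v \<in> N" "y + of_real (- e/2) * v \<in> N" 
      using frontier_N(1)[OF v(3)[of "e/2"]] frontier_N(1)[OF v(3)[of "- e/2"]] v(2) by simp_all
    from sup[OF this(1)] sup[OF this(2)] have "(e/2) * (n \<bullet> v) \<le> 0" "(- e/2) * (n \<bullet> v) \<le> 0"
      unfolding inner_add_right by (simp_all add: inner_complex_def algebra_simps)
    then have "(e/2) * (n \<bullet> v) = 0" by simp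
    then show ?thesis using v(2) by simp
  qed
  define k where "k = (\<i> * n) \<bullet> v"
  have vk: "v = k *\<^sub>R (\<i> * n)" using frame_expand[OF n, of v] \<open>n \<bullet> v = 0\<close> by (simp add: k_def)
  have k0: "k \<noteq> 0" using v(1) vk by auto
  have vt: "of_real t * v = (t * k) *\<^sub>R (\<i> * n)" for t unfolding vk by (simp add: scaleR_conv_of_real)
  obtain D where D: "((\<lambda>t. L (y + of_real t * v)) has_real_derivative D) (at 0)"
    using dif by (auto simp: real_differentiable_def)
  then have q: "((\<lambda>h. (L (y + of_real h * v) - L y) / h) \<longlongrightarrow> D) (at 0)" by (simp add: DERIV_def)
  define \<epsilon> where "\<epsilon> = min e (r / \<bar>k\<bar>)"
  have \<epsilon>: "\<epsilon> > 0" using v(2) r k0 by (simp add: \<epsilon>_def)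
  have val': "(L (y + of_real h * v) - L y) / h = (if h * k \<ge> 0 then ap else am) * k" if h: "\<bar>h\<bar> < \<epsilon>" "h \<noteq> 0" for h
  proof -
    have "\<bar>h * k\<bar> \<le> r" using h k0 by (simp add: \<epsilon>_def abs_mult pos_less_divide_eq)
    from val[OF this] have "\<sigma> (y + of_real h * v) = \<sigma> y + (if h * k \<ge> 0 then ap else am) * (h * k)" unfolding vt .
    moreover have "\<sigma> (y + of_real h * v) = L (y + of_real h * v)" "\<sigma> y = L y"
      using h y1(1) by (auto intro!: L_sigma v(3) simp: \<epsilon>_def)
    ultimately show ?thesis using h(2) by (simp add: field_simps)
  qed
  \<comment> \<open>If v points along the negative tangent, positive increments see the slope am;
    hence the case distinction on k, reversed for the left limit.\<close>
  have "(if k \<ge> 0 then ap else am) * k = D"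
  proof (rule tendsto_unique)
    show "((\<lambda>h. (L (y + of_real h * v) - L y) / h) \<longlongrightarrow> D) (at_right 0)" by (rule tendsto_within_subset[OF q]) simp
    have "\<forall>\<^sub>F h in at_right (0::real). h \<in> {0<..<\<epsilon>}" by (rule eventually_at_right_real[OF \<epsilon>])
    then have "\<forall>\<^sub>F h in at_right (0::real). (if k \<ge> 0 then ap else am) * k = (L (y + of_real h * v) - L y) / h"
      by (rule eventually_mono) (use val' k0 in \<open>auto simp: zero_le_mult_iff\<close>)
    then show "((\<lambda>h. (L (y + of_real h * v) - L y) / h) \<longlongrightarrow> (if k \<ge> 0 then ap else am) * k) (at_right 0)"
      by (rule tendsto_eventually[OF eventually_mono]) auto
  qed simp
  moreover have "(if k \<le> 0 then ap else am) * k = D"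
  proof (rule tendsto_unique)
    show "((\<lambda>h. (L (y + of_real h * v) - L y) / h) \<longlongrightarrow> D) (at_left 0)" by (rule tendsto_within_subset[OF q]) simp
    have "\<forall>\<^sub>F h in at_left (0::real). h \<in> {-\<epsilon><..<0}" by (rule eventually_at_left_real) (use \<epsilon> in simp)
    then have "\<forall>\<^sub>F h in at_left (0::real). (if k \<le> 0 then ap else am) * k = (L (y + of_real h * v) - L y) / h"
      by (rule eventually_mono) (use val' k0 in \<open>auto simp: zero_le_mult_iff\<close>)
    then show "((\<lambda>h. (L (y + of_real h * v) - L y) / h) \<longlongrightarrow> (if k \<le> 0 then ap else am) * k) (at_left 0)"
      by (rule tendsto_eventually[OF eventually_mono]) auto
  qed simp
  ultimately have "ap = am" using k0 by (auto split: if_splits)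
  then have "flat y n r ap" unfolding flat_def using n r sup seg val by auto
  then show thesis by (rule that)
qed

lemma kink_slopes_differ:
  assumes y: "y \<in> nondiff_points N L" and n: "cmod n = 1" and r: "r > 0" and sup: "\<And>z. z \<in> N \<Longrightarrow> n \<bullet> z \<le> n \<bullet> y"
    and seg: "\<And>t. \<bar>t\<bar> \<le> r \<Longrightarrow> y + t *\<^sub>R (\<i> * n) \<in> N"
  shows "\<not> (\<forall>t. \<bar>t\<bar> \<le> r \<longrightarrow> \<sigma> (y + t *\<^sub>R (\<i> * n)) = \<sigma> y + a * t)"
proof
  assume val: "\<forall>t. \<bar>t\<bar> \<le> r \<longrightarrow> \<sigma> (y + t *\<^sub>R (\<i> * n)) = \<sigma> y + a * t"
  have fr: "y + t *\<^sub>R (\<i> * n) \<in> frontier N" if "\<bar>t\<bar> \<le> r" for t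
  proof (rule frontierI[OF seg[OF that]])
    show "y + t *\<^sub>R (\<i> * n) \<notin> interior N"
      using interior_below_support[OF _ n sup, of "y + t *\<^sub>R (\<i> * n)"] by (auto simp: inner_add_right)
  qed
  have d: "((\<lambda>t. \<sigma> y + a * t) has_real_derivative a) (at 0)" by (auto intro!: derivative_eq_intros)
  have eq: "\<sigma> y + a * t = L (y + of_real t * (\<i> * n))" if "t \<in> {-r<..<r}" for t
    using val that L_sigma[OF fr[of t]] by (simp add: scaleR_conv_of_real abs_le_iff)
  have "((\<lambda>t. L (y + of_real t * (\<i> * n))) has_real_derivative a) (at 0)"
    by (rule has_field_derivative_transform_within_open[OF d, of "{-r<..<r}"]) (use r eq in auto)
  then have "(\<lambda>t. L (y + of_real t * (\<i> * n))) differentiable (at 0)" by (auto simp: real_differentiable_def)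
  moreover have "\<i> * n \<noteq> 0" using n by auto
  moreover have "\<forall>t. \<bar>t\<bar> < r \<longrightarrow> y + of_real t * (\<i> * n) \<in> frontier N" using fr by (simp add: scaleR_conv_of_real)
  ultimately show False using y r unfolding nondiff_points_def by blast
qed

end

section \<open>Counting the landing points\<close>

lemma norm_scaleR_sgn: "norm v *\<^sub>R sgn v = (v :: 'a :: real_normed_vector)"
  by (cases "v = 0") (auto simp: sgn_div_norm)

text \<open>Radial projection from an interior point. It transfers the arcs of the circle, and their
  number, to the boundary of N.\<close>

lemma frontier_radial_homeomorphism:
  fixes N :: "complex set"
  assumes cvx: "convex N" and cpt: "compact N" and c: "c \<in> interior N"
  obtains g where "homeomorphism (frontier N) (sphere 0 1) (\<lambda>x. sgn (x - c)) g"
proof -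
  have fr: "x \<in> N" "x \<notin> interior N" if "x \<in> frontier N" for x
    using that compact_imp_closed[OF cpt] frontier_subset_eq by (auto simp: frontier_def)
  have "\<exists>g. homeomorphism (frontier N) (sphere 0 1) (\<lambda>x. sgn (x - c)) g"
  proof (rule homeomorphism_compact)
    show "compact (frontier N)" using cpt by (rule compact_frontier)
    show "continuous_on (frontier N) (\<lambda>x. sgn (x - c))"
      unfolding sgn_div_norm using fr c by (intro continuous_intros) auto
    show "(\<lambda>x. sgn (x - c)) ` frontier N = sphere 0 1"
    proof (intro equalityI subsetI)
      fix u assume "u \<in> (\<lambda>x. sgn (x - c)) ` frontier N"
      then show "u \<in> sphere 0 1" using fr c by (auto simp: norm_sgn)
    next
      fix u :: complex assume u: "u \<in> sphere 0 1"
      then have "u \<noteq> 0" by auto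
      then obtain d where d: "0 < d" "c + d *\<^sub>R u \<in> frontier N"
        using ray_to_frontier[OF compact_imp_bounded[OF cpt] c] by metis
      have "sgn (c + d *\<^sub>R u - c) = u" using d(1) u by (simp add: sgn_div_norm)
      then show "u \<in> (\<lambda>x. sgn (x - c)) ` frontier N" using d(2) by (metis imageI)
    qed
    \<comment> \<open>The nearer of two boundary points on one ray would be a proper contraction of
      the other towards c, hence interior.\<close>
    have aux: "cmod (x - c) \<ge> cmod (x' - c)" if "x \<in> frontier N" "x' \<in> frontier N" "sgn (x - c) = sgn (x' - c)" for x x'
    proof (rule ccontr)
      assume less: "\<not> cmod (x - c) \<ge> cmod (x' - c)"
      define s where "s = cmod (x - c) / cmod (x' - c)"
      have p: "cmod (x' - c) > 0" using fr(2)[OF that(2)] c by auto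
      then have s: "s < 1" "s \<ge> 0" using less by (auto simp: s_def)
      have e1: "x - c = cmod (x - c) *\<^sub>R sgn (x - c)" "x' - c = cmod (x' - c) *\<^sub>R sgn (x' - c)"
        by (simp_all only: norm_scaleR_sgn)
      have "s *\<^sub>R (x' - c) = s *\<^sub>R (cmod (x' - c) *\<^sub>R sgn (x' - c))" using e1(2) by simp
      also have "\<dots> = cmod (x - c) *\<^sub>R sgn (x' - c)" using p by (simp add: s_def)
      finally have xs: "x - c = s *\<^sub>R (x' - c)" using e1(1) that(3) by simp
      have "x' - (1 - s) *\<^sub>R (x' - c) = c + s *\<^sub>R (x' - c)" by (simp add: algebra_simps)
      also have "\<dots> = x" using xs by (simp add: algebra_simps)
      finally have "x \<in> interior N"
        using mem_interior_convex_shrink[OF cvx c fr(1)[OF that(2)], of "1 - s"] s by simp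
      then show False using fr(2)[OF that(1)] by simp
    qed
    show "inj_on (\<lambda>x. sgn (x - c)) (frontier N)"
    proof (rule inj_onI)
      fix x x' assume x: "x \<in> frontier N" "x' \<in> frontier N" "sgn (x - c) = sgn (x' - c)"
      then have "cmod (x - c) = cmod (x' - c)" using aux[of x x'] aux[of x' x] by simp
      then have "cmod (x - c) *\<^sub>R sgn (x - c) = cmod (x' - c) *\<^sub>R sgn (x' - c)" using x(3) by simp
      then show "x = x'" by (simp add: norm_scaleR_sgn)
    qed
  qed
  then show thesis using that by blast
qed

context tension_bdry begin

definition E :: "complex set" where
  "E = {e. \<exists>y\<in>frontier N - A. (G \<longlongrightarrow> e) (at y within interior N)}"

lemma frontier_limit_point: "y \<in> frontier N \<Longrightarrow> y islimpt interior N"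
proof -
  assume y: "y \<in> frontier N"
  have "closure (interior N) = N"
    using convex_closure_interior[OF convex_N interior_N] closed_N by simp
  then show ?thesis using frontier_N[OF y] by (auto simp: closure_def)
qed

lemma landing_unique:
  assumes "y \<in> frontier N" "(G \<longlongrightarrow> e) (at y within interior N)" "(G \<longlongrightarrow> e') (at y within interior N)"
  shows "e = e'"
  using assms frontier_limit_point by (metis tendsto_unique trivial_limit_within)

text \<open>Close to y the box below the edge consists of interior points, so every boundary point
  there lies on the edge, where the landing point is the same.\<close>

lemma landing_locally_constant:
  assumes y: "y \<in> frontier N - A"
  obtains e \<delta> where "\<delta> > 0" "cmod e = 1"
    "\<And>y'. y' \<in> frontier N \<Longrightarrow> dist y y' < \<delta> \<Longrightarrow> (G \<longlongrightarrow> e) (at y' within interior N)"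
proof -
  obtain n r a where f: "flat y n r a" using flat_at_regular[OF y] .
  note fD = flatD[OF f]
  obtain e where e: "cmod e = 1" "\<And>t. \<bar>t\<bar> < r / 4 \<Longrightarrow> (G \<longlongrightarrow> e) (at (y + t *\<^sub>R (\<i> * n)) within interior N)"
    using flat_landing[OF f] by metis
  obtain h where h: "h > 0" and box: "\<And>t \<eta>. \<bar>t\<bar> \<le> r / 2 \<Longrightarrow> 0 < \<eta> \<Longrightarrow> \<eta> \<le> h \<Longrightarrow> y + t *\<^sub>R (\<i> * n) - \<eta> *\<^sub>R n \<in> interior N"
    using flat_box[OF f, of "r/2"] fD(2) by auto
  show thesis
  proof (rule that[of "min h (r / 4)" e])
    show "min h (r / 4) > 0" using h fD(2) by simp
    fix y' assume y': "y' \<in> frontier N" "dist y y' < min h (r / 4)"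
    define t where "t = (\<i> * n) \<bullet> (y' - y)"
    define \<eta> where "\<eta> = n \<bullet> (y - y')"
    have x: "y' = y + t *\<^sub>R (\<i> * n) - \<eta> *\<^sub>R n"
      using frame_expand[OF fD(1), of "y' - y"] by (simp add: t_def \<eta>_def inner_diff_right algebra_simps)
    have b: "\<bar>t\<bar> \<le> cmod (y' - y)" "\<bar>\<eta>\<bar> \<le> cmod (y' - y)"
      using Cauchy_Schwarz_ineq2[of "\<i> * n" "y' - y"] Cauchy_Schwarz_ineq2[of n "y - y'"] fD(1)
      by (auto simp: t_def \<eta>_def norm_mult norm_minus_commute)
    have d: "cmod (y' - y) < h" "cmod (y' - y) < r / 4" using y'(2) by (auto simp: dist_norm norm_minus_commute)
    have "\<eta> \<ge> 0" using fD(3)[OF frontier_N(1)[OF y'(1)]] by (simp add: \<eta>_def inner_diff_right)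
    moreover have "\<not> \<eta> > 0"
    proof
      assume "\<eta> > 0"
      then have "y' \<in> interior N" unfolding x using b d fD(2) by (intro box) auto
      then show False using frontier_N(2)[OF y'(1)] by simp
    qed
    ultimately have "y' = y + t *\<^sub>R (\<i> * n)" using x by simp
    moreover have "\<bar>t\<bar> < r / 4" using b d by linarith
    ultimately show "(G \<longlongrightarrow> e) (at y' within interior N)" using e(2) by simp
  qed (rule e(1))
qed

lemma E_sphere: "E \<subseteq> sphere 0 1"
proof
  fix e assume "e \<in> E"
  then obtain y where y: "y \<in> frontier N - A" "(G \<longlongrightarrow> e) (at y within interior N)" by (auto simp: E_def)
  obtain e' \<delta> where "\<delta> > 0" "cmod e' = 1" "\<And>y'. y' \<in> frontier N \<Longrightarrow> dist y y' < \<delta> \<Longrightarrow> (G \<longlongrightarrow> e') (at y' within interior N)"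
    using landing_locally_constant[OF y(1)] by metis
  then show "e \<in> sphere 0 1" using landing_unique[OF _ y(2), of e'] y(1) by force
qed

lemma A_frontier: "A \<subseteq> frontier N"
proof
  fix p assume "p \<in> A"
  then consider "p extreme_point_of N" | "p \<in> nondiff_points N L" by (auto simp: A_def corners_def)
  then show "p \<in> frontier N"
  proof cases
    case 1
    then show ?thesis using extreme_point_not_in_interior[OF 1] by (auto simp: extreme_point_of_def intro: frontierI)
  qed (auto simp: nondiff_points_def)
qed

lemma A_nonempty: "A \<noteq> {}"
proof -
  have "N \<noteq> {}" using interior_N interior_subset by auto
  then obtain p where "p extreme_point_of N"
    using extreme_point_exists_convex[OF compact_N convex_N] by blast
  then show ?thesis by (auto simp: A_def corners_def)
qed

text \<open>The landing point is constant on each component of the boundary without A. Under radial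
  projection the components become arcs indexed by their starting points in the image of A, so E has
  at most as many elements as A.\<close>

lemma card_E: "finite E" "card E \<le> card A" "E \<noteq> {}"
proof -
  obtain c where c: "c \<in> interior N" using interior_N by auto
  obtain g where hom: "homeomorphism (frontier N) (sphere 0 1) (\<lambda>x. sgn (x - c)) g"
    using frontier_radial_homeomorphism[OF convex_N compact_N c] .
  let ?\<pi> = "\<lambda>x. sgn (x - c)"
  define A' where "A' = ?\<pi> ` A"
  have A': "finite A'" "A' \<subseteq> sphere 0 1" "A' \<noteq> {}"
    using finite_A A_frontier A_nonempty homeomorphism_image1[OF hom] by (auto simp: A'_def)
  have cA': "card A' \<le> card A" unfolding A'_def by (rule card_image_le[OF finite_A])
  have gfr: "g u \<in> frontier N - A" if "u \<in> sphere 0 1 - A'" for u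
  proof
    show "g u \<in> frontier N" using that homeomorphism_image2[OF hom] by auto
    have "sgn (g u - c) = u" using that homeomorphism_apply2[OF hom, of u] by auto
    then show "g u \<notin> A" using that unfolding A'_def by (metis DiffD2 imageI)
  qed
  have arc_sub: "next_arc A' a \<subseteq> sphere 0 1 - A'" if "a \<in> A'" for a
    using next_arc_cover[OF A'] that by blast
  \<comment> \<open>A choice of the limit at each boundary point off A, unique by
    \<open>landing_unique\<close>.\<close>
  define land where "land = (\<lambda>y. SOME e. (G \<longlongrightarrow> e) (at y within interior N))"
  have land: "(G \<longlongrightarrow> land y) (at y within interior N)" if "y \<in> frontier N - A" for y
    unfolding land_def
    by (rule someI_ex) (use landing_locally_constant[OF that] that in \<open>metis DiffD1 dist_self\<close>)
  have const: "(\<lambda>u. land (g u)) constant_on next_arc A' a" if a: "a \<in> A'" for a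
  proof (rule locally_constant_imp_constant[OF connected_next_arc])
    fix u assume u: "u \<in> next_arc A' a"
    have y: "g u \<in> frontier N - A" using gfr arc_sub[OF a] u by blast
    obtain e \<delta> where \<delta>: "\<delta> > 0" and e: "\<And>y'. y' \<in> frontier N \<Longrightarrow> dist (g u) y' < \<delta> \<Longrightarrow> (G \<longlongrightarrow> e) (at y' within interior N)"
      using landing_locally_constant[OF y] by metis
    have cont: "continuous_on (next_arc A' a) g"
      using homeomorphism_cont2[OF hom] by (rule continuous_on_subset) (use arc_sub[OF a] in auto)
    define T where "T = next_arc A' a \<inter> g -` ball (g u) \<delta>"
    have "openin (top_of_set (next_arc A' a)) T"
      unfolding T_def by (rule continuous_openin_preimage_gen[OF cont open_ball])
    moreover have "u \<in> T" using u \<delta> by (simp add: T_def)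
    moreover have "land (g x) = land (g u)" if "x \<in> T" for x
    proof -
      have gx: "g x \<in> frontier N - A" using that gfr arc_sub[OF a] by (auto simp: T_def)
      have "land (g x) = e" by (rule landing_unique[OF _ land[OF gx] e]) (use gx that in \<open>auto simp: T_def\<close>)
      moreover have "land (g u) = e" by (rule landing_unique[OF _ land[OF y] e]) (use y \<delta> in auto)
      ultimately show ?thesis by simp
    qed
    ultimately show "\<exists>T. openin (top_of_set (next_arc A' a)) T \<and> u \<in> T \<and> (\<forall>x\<in>T. land (g x) = land (g u))" by blast
  qed
  then obtain l where l: "\<And>a u. a \<in> A' \<Longrightarrow> u \<in> next_arc A' a \<Longrightarrow> land (g u) = l a"
    unfolding constant_on_def by metis
  have "E \<subseteq> l ` A'"
  proof
    fix e assume "e \<in> E"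
    then obtain y where y: "y \<in> frontier N - A" "(G \<longlongrightarrow> e) (at y within interior N)" by (auto simp: E_def)
    have el: "e = land y" using landing_unique[OF _ y(2) land[OF y(1)]] y(1) by auto
    have gy: "g (?\<pi> y) = y" using homeomorphism_apply1[OF hom] y(1) by auto
    have "?\<pi> y \<in> sphere 0 1 - A'"
    proof -
      have "?\<pi> y \<in> sphere 0 1" using homeomorphism_image1[OF hom] y(1) by auto
      moreover have "?\<pi> y \<notin> A'"
      proof
        assume "?\<pi> y \<in> A'"
        then obtain p where p: "p \<in> A" "?\<pi> y = ?\<pi> p" by (auto simp: A'_def)
        then have "y = p" using homeomorphism_apply1[OF hom, of y] homeomorphism_apply1[OF hom, of p] y(1) A_frontier by auto
        then show False using p y(1) by auto
      qed
      ultimately show ?thesis by auto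
    qed
    then obtain a where "a \<in> A'" "?\<pi> y \<in> next_arc A' a" using next_arc_cover[OF A'] by blast
    then show "e \<in> l ` A'" using l gy el by (metis imageI)
  qed
  then show "finite E" "card E \<le> card A"
    using A'(1) cA' finite_subset[of E "l ` A'"] card_mono[of "l ` A'" E] card_image_le[of A' l] by auto
  obtain a u where "a \<in> A'" "u \<in> next_arc A' a" using A' next_arc_nonempty by blast
  then have "g u \<in> frontier N - A" using gfr arc_sub by blast
  then show "E \<noteq> {}" using land unfolding E_def by blast
qed

section \<open>Boundary values of U on the circle\<close>

text \<open>Apply \<open>G\<close> to the convergent values: an interior limit would force \<zeta>0
  into the open disc, and a limit of \<open>G\<close> at y has to be the limit of the sequence
  itself.\<close>

lemma cluster_in_frontier:
  assumes z: "\<And>k::nat. cmod (\<zeta> k) < 1" and l: "\<zeta> \<longlonglongrightarrow> \<zeta>0" "cmod \<zeta>0 = 1" and y: "(\<lambda>k. U (\<zeta> k)) \<longlonglongrightarrow> y"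
  shows "y \<in> frontier N" "\<And>e. (G \<longlongrightarrow> e) (at y within interior N) \<Longrightarrow> e = \<zeta>0"
proof -
  have UI: "U (\<zeta> k) \<in> interior N" for k by (rule U_in[OF z])
  have yN: "y \<in> N"
    using closed_sequentially[OF closed_N _ y] UI interior_subset by blast
  show fr: "y \<in> frontier N"
  proof (rule frontierI[OF yN], rule notI)
    assume yI: "y \<in> interior N"
    have "(\<lambda>k. G (U (\<zeta> k))) \<longlonglongrightarrow> G y"
      by (rule continuous_on_tendsto_compose[OF cont_G y yI]) (simp add: UI)
    then have "\<zeta> \<longlonglongrightarrow> G y" by (simp add: G_U z)
    then show False using G_in[OF yI] LIMSEQ_unique[OF l(1)] l(2) by auto
  qed
  fix e assume e: "(G \<longlongrightarrow> e) (at y within interior N)"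
  have "filterlim (\<lambda>k. U (\<zeta> k)) (at y within interior N) sequentially"
    using y UI frontier_N(2)[OF fr] by (auto simp: filterlim_at intro!: always_eventually)
  from filterlim_compose[OF e this] have "\<zeta> \<longlonglongrightarrow> e" by (simp add: G_U z)
  then show "e = \<zeta>0" using l(1) by (rule LIMSEQ_unique)
qed

lemma cluster_exists:
  assumes z: "\<And>k::nat. cmod (\<zeta> k) < 1"
  obtains y \<phi> where "strict_mono (\<phi> :: nat \<Rightarrow> nat)" "(\<lambda>k. U (\<zeta> (\<phi> k))) \<longlonglongrightarrow> y"
proof -
  have "\<forall>k. U (\<zeta> k) \<in> N" using U_in[OF z] interior_subset by blast
  then show thesis
    using that seq_compactE[of N "\<lambda>k. U (\<zeta> k)"] compact_N unfolding compact_eq_seq_compact_metric o_def by metis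
qed

text \<open>Otherwise U would have a cluster value at x outside A. Such a boundary point has a
  landing point, which must be x, so x would belong to E.\<close>

lemma near_A:
  assumes x: "x \<in> sphere 0 1 - E" and \<epsilon>: "\<epsilon> > 0"
  shows "\<exists>\<delta>>0. \<forall>\<zeta>. cmod \<zeta> < 1 \<longrightarrow> dist \<zeta> x < \<delta> \<longrightarrow> (\<exists>p\<in>A. dist (U \<zeta>) p < \<epsilon>)"
proof (rule ccontr)
  assume no: "\<not> ?thesis"
  have "\<exists>\<zeta>. cmod \<zeta> < 1 \<and> dist \<zeta> x < inverse (real (Suc k)) \<and> (\<forall>p\<in>A. \<not> dist (U \<zeta>) p < \<epsilon>)" for k
    using no by (metis inverse_positive_iff_positive of_nat_0_less_iff zero_less_Suc)
  then obtain \<zeta> where \<zeta>: "\<And>k. cmod (\<zeta> k) < 1" "\<And>k. dist (\<zeta> k) x < inverse (real (Suc k))" "\<And>k p. p \<in> A \<Longrightarrow> \<not> dist (U (\<zeta> k)) p < \<epsilon>"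
    by metis
  have "(\<lambda>k. dist (\<zeta> k) x) \<longlonglongrightarrow> 0"
    by (rule tendsto_sandwich[OF _ _ tendsto_const LIMSEQ_inverse_real_of_nat]) (use \<zeta>(2) in \<open>auto simp: less_imp_le\<close>)
  then have lim: "\<zeta> \<longlonglongrightarrow> x" using tendsto_dist_iff by blast
  obtain y \<phi> where \<phi>: "strict_mono (\<phi> :: nat \<Rightarrow> nat)" and y: "(\<lambda>k. U (\<zeta> (\<phi> k))) \<longlonglongrightarrow> y"
    using cluster_exists[OF \<zeta>(1)] .
  have lim': "(\<lambda>k. \<zeta> (\<phi> k)) \<longlonglongrightarrow> x" using LIMSEQ_subseq_LIMSEQ[OF lim \<phi>] by (simp add: o_def)
  have x1: "cmod x = 1" using x by simp
  note cl = cluster_in_frontier[OF \<zeta>(1) lim' x1 y]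
  have "y \<notin> A"
  proof
    assume "y \<in> A"
    have "\<forall>\<^sub>F k in sequentially. dist (U (\<zeta> (\<phi> k))) y < \<epsilon>" using y \<epsilon> by (simp add: tendstoD)
    then show False using \<zeta>(3)[OF \<open>y \<in> A\<close>] by simp
  qed
  then have yA: "y \<in> frontier N - A" using cl(1) by auto
  obtain e \<delta> where "\<delta> > 0" and e: "\<And>y'. y' \<in> frontier N \<Longrightarrow> dist y y' < \<delta> \<Longrightarrow> (G \<longlongrightarrow> e) (at y' within interior N)"
    using landing_locally_constant[OF yA] by metis
  then have ey: "(G \<longlongrightarrow> e) (at y within interior N)" using cl(1) by simp
  then have "e = x" by (rule cl(2))
  then show False using ey yA x unfolding E_def by blast
qed

lemma separation_A: obtains s where "s > 0" "\<And>p q. p \<in> A \<Longrightarrow> q \<in> A \<Longrightarrow> dist p q < 2 * s \<Longrightarrow> p = q"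
proof -
  have "\<exists>d>0. \<forall>q\<in>A. q \<noteq> p \<longrightarrow> d \<le> dist p q" for p using finite_set_avoid[OF finite_A] by blast
  then obtain d where d: "\<And>p. d p > 0" "\<And>p q. q \<in> A \<Longrightarrow> q \<noteq> p \<Longrightarrow> d p \<le> dist p q" by metis
  define s where "s = Min (d ` A) / 2"
  have m: "Min (d ` A) > 0" "\<And>p. p \<in> A \<Longrightarrow> Min (d ` A) \<le> d p"
    using finite_A A_nonempty d(1) by auto
  show thesis
  proof (rule that[of s])
    show "s > 0" using m by (simp add: s_def)
    fix p q assume "p \<in> A" "q \<in> A" "dist p q < 2 * s"
    then show "p = q" using m(2)[of p] d(2)[of q p] by (auto simp: s_def)
  qed
qed

text \<open>Near x the values of U lie in small disjoint discs about the points of A. The part of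
  the disc near x is an intersection of two balls, hence connected, so only one of these points is
  involved.\<close>

lemma boundary_limit_exists:
  assumes x: "x \<in> sphere 0 1 - E"
  shows "\<exists>p\<in>A. (U \<longlongrightarrow> p) (at x within ball 0 1)"
proof -
  obtain s where s: "s > 0" "\<And>p q. p \<in> A \<Longrightarrow> q \<in> A \<Longrightarrow> dist p q < 2 * s \<Longrightarrow> p = q" using separation_A by metis
  obtain \<delta> where \<delta>: "\<delta> > 0" "\<And>\<zeta>. cmod \<zeta> < 1 \<Longrightarrow> dist \<zeta> x < \<delta> \<Longrightarrow> \<exists>p\<in>A. dist (U \<zeta>) p < s"
    using near_A[OF x s(1)] by blast
  define C where "C = ball 0 1 \<inter> ball x \<delta>"
  have conC: "connected C" unfolding C_def by (intro convex_connected convex_Int) auto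
  define f where "f = (\<lambda>\<zeta>. SOME p. p \<in> A \<and> dist (U \<zeta>) p < s)"
  have f: "f \<zeta> \<in> A" "dist (U \<zeta>) (f \<zeta>) < s" if "\<zeta> \<in> C" for \<zeta>
  proof -
    have "\<exists>p. p \<in> A \<and> dist (U \<zeta>) p < s" using \<delta>(2)[of \<zeta>] that by (auto simp: C_def dist_commute)
    then have "f \<zeta> \<in> A \<and> dist (U \<zeta>) (f \<zeta>) < s" unfolding f_def by (rule someI_ex)
    then show "f \<zeta> \<in> A" "dist (U \<zeta>) (f \<zeta>) < s" by auto
  qed
  have uniq: "f \<zeta> = p" if "\<zeta> \<in> C" "p \<in> A" "dist (U \<zeta>) p < s" for \<zeta> p
    using s(2)[OF f(1)[OF that(1)] that(2)] f(2)[OF that(1)] that(3) dist_triangle2[of "f \<zeta>" p "U \<zeta>"]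
    by (simp add: dist_commute)
  have "f constant_on C"
  proof (rule locally_constant_imp_constant[OF conC])
    fix \<zeta> assume z: "\<zeta> \<in> C"
    have cont: "continuous_on C U" using cont_U by (rule continuous_on_subset) (auto simp: C_def)
    define T where "T = C \<inter> U -` ball (f \<zeta>) s"
    have "openin (top_of_set C) T" unfolding T_def by (rule continuous_openin_preimage_gen[OF cont open_ball])
    moreover have "\<zeta> \<in> T" using z f(2)[OF z] by (simp add: T_def dist_commute)
    moreover have "\<forall>x\<in>T. f x = f \<zeta>" using uniq f(1)[OF z] by (auto simp: T_def dist_commute)
    ultimately show "\<exists>T. openin (top_of_set C) T \<and> \<zeta> \<in> T \<and> (\<forall>x\<in>T. f x = f \<zeta>)" by blast
  qed
  then obtain p where p: "\<And>\<zeta>. \<zeta> \<in> C \<Longrightarrow> f \<zeta> = p" unfolding constant_on_def by blast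
  have "x \<in> closure (ball 0 1)" using x by simp
  then obtain \<zeta>1 where "\<zeta>1 \<in> C" using \<delta>(1) unfolding closure_approachable C_def by (force simp: dist_commute)
  then have pA: "p \<in> A" using f(1) p by metis
  have "(U \<longlongrightarrow> p) (at x within ball 0 1)"
  proof (rule tendstoI)
    fix \<epsilon> :: real assume "\<epsilon> > 0"
    then obtain \<delta>' where \<delta>': "\<delta>' > 0" "\<And>\<zeta>. cmod \<zeta> < 1 \<Longrightarrow> dist \<zeta> x < \<delta>' \<Longrightarrow> \<exists>p\<in>A. dist (U \<zeta>) p < min s \<epsilon>"
      using near_A[OF x, of "min s \<epsilon>"] s(1) by auto
    show "\<forall>\<^sub>F \<zeta> in at x within ball 0 1. dist (U \<zeta>) p < \<epsilon>"
      unfolding eventually_at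
    proof (intro exI[of _ "min \<delta> \<delta>'"] conjI ballI impI)
      show "min \<delta> \<delta>' > 0" using \<delta> \<delta>' by simp
      fix \<zeta> assume z: "\<zeta> \<in> ball 0 1" "\<zeta> \<noteq> x \<and> dist \<zeta> x < min \<delta> \<delta>'"
      then have zC: "\<zeta> \<in> C" by (auto simp: C_def dist_commute)
      obtain q where q: "q \<in> A" "dist (U \<zeta>) q < min s \<epsilon>" using \<delta>'(2)[of \<zeta>] z by auto
      then have "q = p" using uniq[OF zC q(1)] p[OF zC] by simp
      then show "dist (U \<zeta>) p < \<epsilon>" using q by simp
    qed
  qed
  then show ?thesis using pA by blast
qed

text \<open>Unspecified on E, which no integral detects because E is finite.\<close>

definition ustar :: "complex \<Rightarrow> complex" where
  "ustar x = (SOME p. p \<in> A \<and> (U \<longlongrightarrow> p) (at x within ball 0 1))"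

lemma ustar:
  assumes "x \<in> sphere 0 1 - E"
  shows "ustar x \<in> A" "(U \<longlongrightarrow> ustar x) (at x within ball 0 1)"
proof -
  have "\<exists>p. p \<in> A \<and> (U \<longlongrightarrow> p) (at x within ball 0 1)" using boundary_limit_exists[OF assms] by blast
  then have "ustar x \<in> A \<and> (U \<longlongrightarrow> ustar x) (at x within ball 0 1)" unfolding ustar_def by (rule someI_ex)
  then show "ustar x \<in> A" "(U \<longlongrightarrow> ustar x) (at x within ball 0 1)" by auto
qed

text \<open>Values at neighbouring points are at most s apart, while distinct points of A are at
  least 2s apart.\<close>

lemma ustar_constant:
  assumes S: "connected S" "S \<subseteq> sphere 0 1 - E"
  shows "ustar constant_on S"
proof (rule locally_constant_imp_constant[OF S(1)])
  fix x assume x: "x \<in> S"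
  obtain s where s: "s > 0" "\<And>p q. p \<in> A \<Longrightarrow> q \<in> A \<Longrightarrow> dist p q < 2 * s \<Longrightarrow> p = q" using separation_A by metis
  have xs: "x \<in> sphere 0 1 - E" using S x by blast
  have "\<forall>\<^sub>F \<zeta> in at x within ball 0 1. dist (U \<zeta>) (ustar x) < s" using ustar(2)[OF xs] s(1) by (rule tendstoD)
  then obtain \<delta> where \<delta>: "\<delta> > 0" "\<And>\<zeta>. \<zeta> \<in> ball 0 1 \<Longrightarrow> \<zeta> \<noteq> x \<Longrightarrow> dist \<zeta> x < \<delta> \<Longrightarrow> dist (U \<zeta>) (ustar x) < s"
    unfolding eventually_at by blast
  have eq: "ustar x' = ustar x" if x': "x' \<in> S \<inter> ball x \<delta>" for x'
  proof -
    have xs': "x' \<in> sphere 0 1 - E" using S x' by blast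
    have "x' islimpt ball 0 1" using xs' by (simp add: islimpt_ball)
    then have nt: "at x' within ball 0 1 \<noteq> bot" by (simp add: trivial_limit_within)
    have "\<forall>\<^sub>F \<zeta> in at x' within ball 0 1. \<zeta> \<in> ball x \<delta>"
      unfolding eventually_at_topological using x' by (intro exI[of _ "ball x \<delta>"]) auto
    moreover have "\<forall>\<^sub>F \<zeta> in at x' within ball 0 1. \<zeta> \<in> ball 0 1" by (simp add: eventually_at_filter)
    ultimately have "\<forall>\<^sub>F \<zeta> in at x' within ball 0 1. dist (U \<zeta>) (ustar x) \<le> s"
    proof eventually_elim
      case (elim \<zeta>)
      then have "\<zeta> \<noteq> x" using xs by auto
      then show ?case using \<delta>(2)[of \<zeta>] elim by (simp add: dist_commute less_imp_le)
    qed
    moreover have "((\<lambda>\<zeta>. dist (U \<zeta>) (ustar x)) \<longlongrightarrow> dist (ustar x') (ustar x)) (at x' within ball 0 1)"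
      by (intro tendsto_intros ustar(2)[OF xs'])
    ultimately have "dist (ustar x') (ustar x) \<le> s" using nt by (intro tendsto_upperbound)
    then show ?thesis using s(1) by (intro s(2) ustar(1) xs xs') simp
  qed
  show "\<exists>T. openin (top_of_set S) T \<and> x \<in> T \<and> (\<forall>x'\<in>T. ustar x' = ustar x)"
  proof (intro exI[of _ "S \<inter> ball x \<delta>"] conjI ballI eq)
    show "openin (top_of_set S) (S \<inter> ball x \<delta>)" by (simp add: openin_open_Int)
    show "x \<in> S \<inter> ball x \<delta>" using x \<delta>(1) by simp
  qed
qed

lemma U_representation:
  assumes z: "cmod \<zeta> < 1"
  shows "((\<lambda>t. ustar (cis t) * of_real (poisson_kernel \<zeta> t)) has_integral (2 * of_real pi * U \<zeta>)) {0..2*pi}"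
proof -
  obtain B where B: "\<And>z. z \<in> N \<Longrightarrow> cmod z \<le> B" using compact_imp_bounded[OF compact_N] by (auto simp: bounded_iff)
  show ?thesis
    by (rule poisson_representation[OF psi_hol psi2_hol z U_eq _ card_E(1) ustar(2)])
       (use U_in B interior_subset in blast)+
qed

lemma U_functional_representation:
  assumes z: "cmod \<zeta> < 1"
  shows "((\<lambda>t. (d - n \<bullet> ustar (cis t)) * poisson_kernel \<zeta> t) has_integral (2 * pi * (d - n \<bullet> U \<zeta>))) {0..2*pi}"
proof -
  have "((\<lambda>t. n \<bullet> (ustar (cis t) * of_real (poisson_kernel \<zeta> t))) has_integral n \<bullet> (2 * of_real pi * U \<zeta>)) {0..2*pi}"
    by (rule has_integral_linear[OF U_representation[OF z] bounded_linear_inner_right, unfolded o_def])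
  moreover have "n \<bullet> (ustar (cis t) * of_real (poisson_kernel \<zeta> t)) = (n \<bullet> ustar (cis t)) * poisson_kernel \<zeta> t" for t
    by (simp add: inner_complex_def algebra_simps)
  moreover have "n \<bullet> (2 * of_real pi * U \<zeta>) = 2 * pi * (n \<bullet> U \<zeta>)"
    by (simp add: inner_complex_def algebra_simps)
  ultimately have "((\<lambda>t. (n \<bullet> ustar (cis t)) * poisson_kernel \<zeta> t) has_integral 2 * pi * (n \<bullet> U \<zeta>)) {0..2*pi}"
    by (simp only:)
  from has_integral_diff[OF has_integral_mult_right[OF poisson_kernel_has_integral[OF z], of d] this]
  show ?thesis by (simp add: algebra_simps)
qed


text \<open>The maximum principle in integrated form. The kernel is part of the hypothesis, so that
  the bound c may depend on \<zeta>.\<close>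

lemma harmonic_functional_lower_bound:
  assumes z: "cmod \<zeta> < 1"
    and le: "\<And>t. cis t \<notin> E \<Longrightarrow> c \<le> (d - m \<bullet> ustar (cis t)) * poisson_kernel \<zeta> t"
  shows "c \<le> d - m \<bullet> U \<zeta>"
proof -
  define T where "T = {t \<in> {0..0 + 2 * pi}. cis t \<in> E}"
  have T: "finite T" unfolding T_def by (rule finite_cis_vimage[OF card_E(1)])
  define F where "F = (\<lambda>t. if t \<in> T then c else (d - m \<bullet> ustar (cis t)) * poisson_kernel \<zeta> t)"
  have 1: "(F has_integral (2 * pi * (d - m \<bullet> U \<zeta>))) {0..2*pi}"
    by (rule has_integral_spike_finite[OF T _ U_functional_representation[OF z]]) (auto simp: F_def)
  have 2: "((\<lambda>t. c) has_integral (2 * pi * c)) {0..2*pi}"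
    using has_integral_const_real[of c 0 "2*pi"] by simp
  have "2 * pi * c \<le> 2 * pi * (d - m \<bullet> U \<zeta>)"
  proof (rule has_integral_le[OF 2 1])
    fix t :: real assume "t \<in> {0..2*pi}"
    then show "c \<le> F t" using le[of t] by (simp add: F_def T_def)
  qed
  then show ?thesis by (simp only: mult_le_cancel_left_pos[of "2 * pi"] pi_gt_zero zero_less_mult_iff zero_less_numeral simp_thms)
qed

text \<open>Boundary values near e contribute with the right sign. The others are seen from \<zeta>
  at distance at least \<rho>, where the kernel is O(1 - |\<zeta>|).\<close>

lemma local_bound:
  assumes \<rho>: "\<rho> > 0"
    and near: "\<And>x. x \<in> sphere 0 1 - E \<Longrightarrow> dist x e < 2 * \<rho> \<Longrightarrow> m \<bullet> ustar x \<le> d"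
  obtains C where "C \<ge> 0" "\<And>\<zeta>. cmod \<zeta> < 1 \<Longrightarrow> dist \<zeta> e < \<rho> \<Longrightarrow> m \<bullet> U \<zeta> - d \<le> C * (1 - cmod \<zeta>)"
proof -
  define K where "K = Max ((\<lambda>p. \<bar>d - m \<bullet> p\<bar>) ` A)"
  have K: "\<bar>d - m \<bullet> p\<bar> \<le> K" if "p \<in> A" for p
    unfolding K_def using finite_A that by (intro Max_ge) auto
  have K0: "K \<ge> 0" using K A_nonempty by (meson abs_ge_zero ex_in_conv order_trans)
  show thesis
  proof (rule that[of "2 * K / \<rho>\<^sup>2"])
    show "2 * K / \<rho>\<^sup>2 \<ge> 0" using K0 by simp
    fix \<zeta> assume z: "cmod \<zeta> < 1" and d: "dist \<zeta> e < \<rho>"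
    have z2: "1 - (cmod \<zeta>)\<^sup>2 \<ge> 0" using z by (simp add: abs_square_le_1)
    have "- (K * ((1 - (cmod \<zeta>)\<^sup>2) / \<rho>\<^sup>2)) \<le> d - m \<bullet> U \<zeta>"
    proof (rule harmonic_functional_lower_bound[OF z])
      fix t assume t: "cis t \<notin> E"
      then have x: "cis t \<in> sphere 0 1 - E" by simp
      have P: "poisson_kernel \<zeta> t \<ge> 0" by (rule poisson_kernel_nonneg[OF z])
      have L0: "K * ((1 - (cmod \<zeta>)\<^sup>2) / \<rho>\<^sup>2) \<ge> 0" using K0 z2 by simp
      show "- (K * ((1 - (cmod \<zeta>)\<^sup>2) / \<rho>\<^sup>2)) \<le> (d - m \<bullet> ustar (cis t)) * poisson_kernel \<zeta> t"
      proof (cases "dist (cis t) e < 2 * \<rho>")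
        case True
        then have "0 \<le> (d - m \<bullet> ustar (cis t)) * poisson_kernel \<zeta> t" using near[OF x] P by simp
        then show ?thesis using L0 by linarith
      next
        case False
        then have "\<rho> \<le> cmod (cis t - \<zeta>)"
          using d dist_triangle[of "cis t" e \<zeta>] by (simp add: dist_norm)
        then have "poisson_kernel \<zeta> t \<le> (1 - (cmod \<zeta>)\<^sup>2) / \<rho>\<^sup>2"
          unfolding poisson_kernel_def using \<rho> z2 by (intro divide_left_mono power_mono mult_pos_pos) auto
        moreover have "- K \<le> d - m \<bullet> ustar (cis t)" using K[OF ustar(1)[OF x]] by linarith
        ultimately have 1: "K * poisson_kernel \<zeta> t \<le> K * ((1 - (cmod \<zeta>)\<^sup>2) / \<rho>\<^sup>2)"
          and 2: "- K * poisson_kernel \<zeta> t \<le> (d - m \<bullet> ustar (cis t)) * poisson_kernel \<zeta> t"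
          using mult_left_mono[OF _ K0] mult_right_mono[OF _ P] by blast+
        show ?thesis using 1 2 unfolding mult_minus_left by linarith
      qed
    qed
    moreover have "K * ((1 - (cmod \<zeta>)\<^sup>2) / \<rho>\<^sup>2) \<le> 2 * K / \<rho>\<^sup>2 * (1 - cmod \<zeta>)"
    proof -
      have "1 - (cmod \<zeta>)\<^sup>2 = (1 + cmod \<zeta>) * (1 - cmod \<zeta>)" by (simp add: power2_eq_square algebra_simps)
      also have "\<dots> \<le> 2 * (1 - cmod \<zeta>)" using z by (intro mult_right_mono) auto
      finally have "K * ((1 - (cmod \<zeta>)\<^sup>2) / \<rho>\<^sup>2) \<le> K * ((2 * (1 - cmod \<zeta>)) / \<rho>\<^sup>2)"
        using K0 by (intro mult_left_mono divide_right_mono) auto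
      then show ?thesis by (simp add: mult_ac)
    qed
    ultimately show "m \<bullet> U \<zeta> - d \<le> 2 * K / \<rho>\<^sup>2 * (1 - cmod \<zeta>)" by linarith
  qed
qed

section \<open>Every element of A is a boundary value\<close>

text \<open>An extreme point p of N is not in the convex hull of the other points of A, hence
  strictly separated from it. If p were missed, the maximum principle would keep U, and with it N,
  on the far side of the separating line.\<close>

lemma ustar_attains_corner:
  assumes p: "p \<in> corners N"
  shows "\<exists>x\<in>sphere 0 1 - E. ustar x = p"
proof (rule ccontr)
  assume no: "\<not> ?thesis"
  let ?H = "convex hull (A - {p})"
  have "A \<subseteq> N" using A_frontier frontier_N(1) by auto
  then have HN: "?H \<subseteq> N" by (intro hull_minimal) (auto simp: convex_N)
  have ext: "p extreme_point_of N" using p by (simp add: corners_def)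
  have "p \<notin> ?H"
  proof
    assume "p \<in> ?H"
    then have "p extreme_point_of ?H" using ext HN unfolding extreme_point_of_def by blast
    then show False using extreme_point_of_convex_hull by blast
  qed
  moreover have "closed ?H" using finite_A by (intro compact_imp_closed finite_imp_compact_convex_hull) auto
  ultimately obtain a b where ab: "a \<bullet> p < b" "\<And>x. x \<in> ?H \<Longrightarrow> b < a \<bullet> x"
    using separating_hyperplane_closed_point[OF convex_convex_hull] by metis
  have "- a \<bullet> U \<zeta> \<le> - b" if z: "cmod \<zeta> < 1" for \<zeta>
  proof -
    have "0 \<le> - b - (- a) \<bullet> U \<zeta>"
    proof (rule harmonic_functional_lower_bound[OF z])
      fix t assume "cis t \<notin> E"
      then have x: "cis t \<in> sphere 0 1 - E" by simp
      then have "ustar (cis t) \<in> A - {p}" using no ustar(1)[OF x] by auto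
      then have "b < a \<bullet> ustar (cis t)" by (intro ab(2) hull_inc)
      then show "0 \<le> (- b - (- a) \<bullet> ustar (cis t)) * poisson_kernel \<zeta> t"
        using poisson_kernel_nonneg[OF z] by simp
    qed
    then show ?thesis by simp
  qed
  then have "b \<le> a \<bullet> z" if "z \<in> interior N" for z
    using G_in[OF that] U_G[OF that] by force
  then have "closure (interior N) \<subseteq> {z. a \<bullet> z \<ge> b}"
    by (intro closure_minimal closed_halfspace_ge) auto
  moreover have "p \<in> closure (interior N)"
    using frontier_limit_point[of p] A_frontier p by (auto simp: closure_def A_def)
  ultimately show False using ab(1) by auto
qed

text \<open>As E is finite, one arc adjoins e on either side, with value p1 on the counter-clockwise
  and p2 on the clockwise side. At this stage p1 and p2 may coincide.\<close>

lemma ustar_near_exceptional: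
  assumes e: "e \<in> E"
  obtains \<rho> p1 p2 where "\<rho> > 0" "p1 \<in> A" "p2 \<in> A"
    "\<And>x. x \<in> sphere 0 1 - E \<Longrightarrow> dist x e < 2 * \<rho> \<Longrightarrow> ustar x = p1 \<or> ustar x = p2"
    "\<And>\<epsilon>. \<epsilon> > 0 \<Longrightarrow> \<exists>x\<in>sphere 0 1 - E. dist x e < \<epsilon> \<and> ustar x = p1"
    "\<And>\<epsilon>. \<epsilon> > 0 \<Longrightarrow> \<exists>x\<in>sphere 0 1 - E. dist x e < \<epsilon> \<and> ustar x = p2"
proof -
  have ce: "cmod e = 1" using e E_sphere by auto
  define t0 where "t0 = Arg e"
  have et: "cis t0 = e" using cis_Arg_unit[OF ce] by (simp add: t0_def)
  define T where "T = {t \<in> {t0 - pi..t0 - pi + 2 * pi}. cis t \<in> E}"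
  have "finite T" unfolding T_def by (rule finite_cis_vimage[OF card_E(1)])
  then obtain d where d: "d > 0" "\<And>t. t \<in> T \<Longrightarrow> t \<noteq> t0 \<Longrightarrow> d \<le> dist t0 t"
    using finite_set_avoid[of T t0] by auto
  define \<delta> where "\<delta> = min d pi"
  have \<delta>: "\<delta> > 0" "\<delta> \<le> pi" "\<delta> \<le> d" using d by (auto simp: \<delta>_def)
  have notE: "cis t \<in> sphere 0 1 - E" if "t \<noteq> t0" "\<bar>t - t0\<bar> < \<delta>" for t
  proof -
    have "t \<notin> T" using d(2)[of t] that \<delta> by (auto simp: dist_real_def abs_minus_commute)
    then show ?thesis using that \<delta> by (auto simp: T_def abs_le_iff)
  qed
  have "ustar constant_on cis ` {t0<..<t0 + \<delta>}"
    by (rule ustar_constant) (auto intro!: connected_continuous_image continuous_intros notE)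
  then obtain p1 where p1: "\<And>t. t0 < t \<Longrightarrow> t < t0 + \<delta> \<Longrightarrow> ustar (cis t) = p1"
    unfolding constant_on_def by auto
  have "ustar constant_on cis ` {t0 - \<delta><..<t0}"
    by (rule ustar_constant) (auto intro!: connected_continuous_image continuous_intros notE)
  then obtain p2 where p2: "\<And>t. t0 - \<delta> < t \<Longrightarrow> t < t0 \<Longrightarrow> ustar (cis t) = p2"
    unfolding constant_on_def by auto
  have pA: "p1 \<in> A" "p2 \<in> A"
    using ustar(1)[OF notE[of "t0 + \<delta>/2"]] ustar(1)[OF notE[of "t0 - \<delta>/2"]] p1[of "t0 + \<delta>/2"] p2[of "t0 - \<delta>/2"] \<delta>
    by auto
  \<comment> \<open>The part of the circle not covered by the two adjacent arcs and e: compact and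
    without e, hence at a positive distance from e.\<close>
  define K where "K = cis ` ({t0 - pi..t0 - \<delta>} \<union> {t0 + \<delta>..t0 + pi})"
  have "compact K" unfolding K_def by (intro compact_continuous_image continuous_intros compact_Un) auto
  moreover have "e \<notin> K"
  proof
    assume "e \<in> K"
    then obtain t where t: "t \<in> {t0 - pi..t0 - \<delta>} \<union> {t0 + \<delta>..t0 + pi}" "e = cis t" unfolding K_def by blast
    then obtain k :: int where k: "t = t0 + 2 * pi * of_int k" using et by (metis cis_eq_cis_iff)
    define q where "q = 2 * pi * real_of_int k"
    have q: "\<bar>q\<bar> \<le> pi" "q \<noteq> 0"
      using t(1) \<delta> unfolding k q_def[symmetric] by auto
    then have "\<bar>k\<bar> \<ge> 1" by (auto simp: q_def)
    then have "2 * pi * 1 \<le> 2 * pi * real_of_int \<bar>k\<bar>" by (intro mult_left_mono) (auto simp del: of_int_abs)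
    also have "\<dots> = \<bar>q\<bar>" by (simp add: q_def abs_mult)
    finally show False using q(1) pi_gt_zero by linarith
  qed
  ultimately obtain \<rho>' where \<rho>': "\<rho>' > 0" "ball e \<rho>' \<subseteq> - K"
    using open_Compl[OF compact_imp_closed] openE by (metis ComplI)
  have near: "ustar x = p1 \<or> ustar x = p2" if x: "x \<in> sphere 0 1 - E" "dist x e < \<rho>'" for x
  proof -
    define s where "s = Arg (x / e)"
    have "cmod (x / e) = 1" using x ce by (simp add: norm_divide)
    then have "cis s = x / e" by (simp add: s_def cis_Arg_unit)
    then have xs: "x = cis (t0 + s)" using ce et by (auto simp: cis_mult[symmetric])
    have s: "- pi < s" "s \<le> pi" using Arg_bounded[of "x / e"] by (auto simp: s_def)
    have "x \<notin> K" using \<rho>' x(2) by (auto simp: dist_commute)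
    then have "t0 + s \<notin> {t0 - pi..t0 - \<delta>} \<union> {t0 + \<delta>..t0 + pi}" unfolding K_def xs by blast
    then have "\<bar>s\<bar> < \<delta>" using s by (auto simp: abs_if)
    moreover have "s \<noteq> 0" using xs x e et by auto
    ultimately show ?thesis using p1[of "t0 + s"] p2[of "t0 + s"] xs by (auto simp: abs_if split: if_splits)
  qed
  have cc: "\<exists>\<delta>'>0. \<forall>t. \<bar>t - t0\<bar> < \<delta>' \<longrightarrow> dist (cis t) e < \<epsilon>" if "\<epsilon> > 0" for \<epsilon>
  proof -
    have "continuous_on UNIV cis" by (intro continuous_intros)
    then have "isCont cis t0" by (simp add: continuous_on_eq_continuous_at)
    then show ?thesis using that et unfolding continuous_at_eps_delta dist_real_def by blast
  qed
  show thesis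
  proof (rule that[of "\<rho>' / 2" p1 p2])
    fix \<epsilon> :: real assume "\<epsilon> > 0"
    then obtain \<delta>' where \<delta>': "\<delta>' > 0" "\<And>t. \<bar>t - t0\<bar> < \<delta>' \<Longrightarrow> dist (cis t) e < \<epsilon>" using cc by blast
    define h where "h = min \<delta> \<delta>' / 2"
    have h: "0 < h" "h < \<delta>" "h < \<delta>'" using \<delta> \<delta>' by (auto simp: h_def)
    show "\<exists>x\<in>sphere 0 1 - E. dist x e < \<epsilon> \<and> ustar x = p1"
      using notE[of "t0 + h"] p1[of "t0 + h"] \<delta>'(2)[of "t0 + h"] h by (intro bexI[of _ "cis (t0 + h)"]) auto
    show "\<exists>x\<in>sphere 0 1 - E. dist x e < \<epsilon> \<and> ustar x = p2"
      using notE[of "t0 - h"] p2[of "t0 - h"] \<delta>'(2)[of "t0 - h"] h by (intro bexI[of _ "cis (t0 - h)"]) auto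
  qed (use \<rho>' pA near in auto)
qed

text \<open>The holomorphic function with real part \<open>n \<bullet> U\<close> and, as its
  imaginary part, the component of \<open>grad \<sigma>\<close> along U in the direction
  \<open>\<i> * n\<close>.\<close>

definition gconj :: "complex \<Rightarrow> complex \<Rightarrow> complex" where
  "gconj n \<zeta> = (cnj n * \<psi> \<zeta> + n * psi2 \<zeta>) / 2"

lemma gconj:
  assumes "cmod \<zeta> < 1"
  shows "Re (gconj n \<zeta>) = n \<bullet> U \<zeta>" "Im (gconj n \<zeta>) = grad \<sigma> (U \<zeta>) \<bullet> (\<i> * n)"
proof -
  have "psi2 \<zeta> = cnj (2 * U \<zeta> - \<psi> \<zeta>)" by (simp add: psi2_def U_def)
  then have p: "Re (psi2 \<zeta>) = 2 * Re (U \<zeta>) - Re (\<psi> \<zeta>)" "Im (psi2 \<zeta>) = Im (\<psi> \<zeta>) - 2 * Im (U \<zeta>)"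
    by simp_all
  have "Re (gconj n \<zeta>) = (Re n * Re (\<psi> \<zeta>) + Im n * Im (\<psi> \<zeta>) + (Re n * Re (psi2 \<zeta>) - Im n * Im (psi2 \<zeta>))) / 2"
    by (simp add: gconj_def)
  then show "Re (gconj n \<zeta>) = n \<bullet> U \<zeta>" unfolding p by (simp add: inner_complex_def algebra_simps)
  have "Im (gconj n \<zeta>) = (Re n * Im (\<psi> \<zeta>) - Im n * Re (\<psi> \<zeta>) + (Re n * Im (psi2 \<zeta>) + Im n * Re (psi2 \<zeta>))) / 2"
    by (simp add: gconj_def)
  then show "Im (gconj n \<zeta>) = grad \<sigma> (U \<zeta>) \<bullet> (\<i> * n)"
    unfolding p grad_U[OF assms] by (simp add: inner_complex_def algebra_simps)
qed

text \<open>The tangential component of \<open>grad \<sigma>\<close> along \<open>U\<close> is the harmonic conjugate of \<open>n \<bullet> U\<close>.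
  If the two boundary values of \<open>U\<close> next to \<open>e\<close> lie on the supporting line, it is therefore
  Lipschitz near \<open>e\<close>.\<close>

lemma conjugate_lipschitz:
  assumes n: "cmod n = 1" and sup: "\<And>z. z \<in> N \<Longrightarrow> n \<bullet> z \<le> d" and \<rho>: "\<rho> > 0"
    and near: "\<And>x. x \<in> sphere 0 1 - E \<Longrightarrow> dist x e < 2 * \<rho> \<Longrightarrow> n \<bullet> ustar x = d"
  obtains C where "\<And>\<zeta> \<zeta>'. cmod \<zeta> < 1 \<Longrightarrow> dist \<zeta> e < \<rho> \<Longrightarrow> cmod \<zeta>' < 1 \<Longrightarrow> dist \<zeta>' e < \<rho> \<Longrightarrow>
     \<bar>grad \<sigma> (U \<zeta>) \<bullet> (\<i> * n) - grad \<sigma> (U \<zeta>') \<bullet> (\<i> * n)\<bar> \<le> C * cmod (\<zeta> - \<zeta>')"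
    "\<And>\<zeta>. cmod \<zeta> < 1 \<Longrightarrow> dist \<zeta> e < \<rho> \<Longrightarrow> d - n \<bullet> U \<zeta> \<le> C * (1 - cmod \<zeta>)"
proof -
  obtain C where C: "C \<ge> 0" "\<And>\<zeta>. cmod \<zeta> < 1 \<Longrightarrow> dist \<zeta> e < \<rho> \<Longrightarrow> (- n) \<bullet> U \<zeta> - (- d) \<le> C * (1 - cmod \<zeta>)"
    using local_bound[OF \<rho>, of e "- n" "- d"] near by auto
  have hol: "gconj n holomorphic_on ball 0 1"
    unfolding gconj_def[abs_def] by (intro holomorphic_intros psi_hol psi2_hol) auto
  have D: "cmod (deriv (gconj n) \<zeta>) \<le> 2 * C" if z: "cmod \<zeta> < 1" "dist \<zeta> e < \<rho>" for \<zeta>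
  proof -
    have sub: "ball \<zeta> (1 - cmod \<zeta>) \<subseteq> ball 0 1"
    proof
      fix w assume "w \<in> ball \<zeta> (1 - cmod \<zeta>)"
      then show "w \<in> ball 0 1" using norm_triangle_sub[of w \<zeta>] by (simp add: dist_norm norm_minus_commute)
    qed
    have df: "(gconj n has_field_derivative deriv (gconj n) \<zeta>) (at \<zeta>)"
      by (rule holomorphic_derivI[OF hol open_ball]) (use z in simp)
    \<comment> \<open>The real part of d - \<open>gconj n\<close> is positive everywhere and O(1 -
      |\<zeta>|) near e, while a disc of radius 1 - |\<zeta>| is available; the half-plane estimate
      gives a bounded derivative.\<close>
    have "cmod (deriv (\<lambda>w. of_real d - gconj n w) \<zeta>) \<le> 2 * Re (of_real d - gconj n \<zeta>) / (1 - cmod \<zeta>)"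
    proof (rule norm_deriv_le_Re)
      show "(\<lambda>w. of_real d - gconj n w) holomorphic_on ball \<zeta> (1 - cmod \<zeta>)"
        by (intro holomorphic_intros holomorphic_on_subset[OF hol sub])
      fix w assume "w \<in> ball \<zeta> (1 - cmod \<zeta>)"
      then have w: "cmod w < 1" using sub by auto
      show "0 < Re (of_real d - gconj n w)"
        using interior_below_support[OF U_in[OF w] n sup] by (simp add: gconj(1)[OF w])
    qed (use z in simp)
    moreover have "deriv (\<lambda>w. of_real d - gconj n w) \<zeta> = - deriv (gconj n) \<zeta>"
      by (rule DERIV_imp_deriv) (auto intro!: derivative_eq_intros df)
    moreover have "2 * Re (of_real d - gconj n \<zeta>) / (1 - cmod \<zeta>) \<le> 2 * C"
      using C(2)[OF z] z(1) by (simp add: gconj(1)[OF z(1)] pos_divide_le_eq)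
    ultimately show ?thesis by simp
  qed
  show thesis
  proof (rule that[of "2 * C"])
    fix \<zeta> \<zeta>' assume z: "cmod \<zeta> < 1" "dist \<zeta> e < \<rho>" "cmod \<zeta>' < 1" "dist \<zeta>' e < \<rho>"
    have "cmod (gconj n \<zeta> - gconj n \<zeta>') \<le> 2 * C * cmod (\<zeta> - \<zeta>')"
    proof (rule field_differentiable_bound[where S="ball 0 1 \<inter> ball e \<rho>"])
      fix w :: complex assume w: "w \<in> ball 0 1 \<inter> ball e \<rho>"
      show "(gconj n has_field_derivative deriv (gconj n) w) (at w within ball 0 1 \<inter> ball e \<rho>)"
        by (rule has_field_derivative_at_within, rule holomorphic_derivI[OF hol open_ball]) (use w in simp)
      show "cmod (deriv (gconj n) w) \<le> 2 * C" by (rule D) (use w in \<open>auto simp: dist_commute\<close>)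
    qed (use z in \<open>auto simp: dist_commute intro: convex_Int\<close>)
    then show "\<bar>grad \<sigma> (U \<zeta>) \<bullet> (\<i> * n) - grad \<sigma> (U \<zeta>') \<bullet> (\<i> * n)\<bar> \<le> 2 * C * cmod (\<zeta> - \<zeta>')"
      using abs_Im_le_cmod[of "gconj n \<zeta> - gconj n \<zeta>'"] by (simp add: gconj(2) z)
  next
    fix \<zeta> assume z: "cmod \<zeta> < 1" "dist \<zeta> e < \<rho>"
    have "C * (1 - cmod \<zeta>) \<le> 2 * C * (1 - cmod \<zeta>)" using C(1) z by (intro mult_right_mono) auto
    then show "d - n \<bullet> U \<zeta> \<le> 2 * C * (1 - cmod \<zeta>)" using C(2)[OF z] by simp
  qed
qed


lemma ustar_attains_kink:
  assumes q: "q \<in> nondiff_points N L"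
  shows "\<exists>x\<in>sphere 0 1 - E. ustar x = q"
proof (rule ccontr)
  assume no: "\<not> ?thesis"
  have qf: "q \<in> frontier N" "q \<notin> corners N" using q by (auto simp: nondiff_points_def)
  obtain n r am ap where n: "cmod n = 1" and r: "r > 0" and sup: "\<And>z. z \<in> N \<Longrightarrow> n \<bullet> z \<le> n \<bullet> q"
    and seg: "\<And>t. \<bar>t\<bar> \<le> r \<Longrightarrow> q + t *\<^sub>R (\<i> * n) \<in> N"
    and notA: "\<And>t. \<bar>t\<bar> \<le> r \<Longrightarrow> t \<noteq> 0 \<Longrightarrow> q + t *\<^sub>R (\<i> * n) \<notin> A"
    and val: "\<And>t. \<bar>t\<bar> \<le> r \<Longrightarrow> \<sigma> (q + t *\<^sub>R (\<i> * n)) = \<sigma> q + (if t \<ge> 0 then ap else am) * t"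
    using bent_edge[OF qf] by metis
  let ?\<tau> = "\<i> * n"
  have amp: "am \<noteq> ap" using kink_slopes_differ[OF q n r sup seg, of ap] val by auto
  have tn: "?\<tau> \<bullet> ?\<tau> = 1" using n by (simp add: dot_square_norm norm_mult)
  \<comment> \<open>With half of r, the segments of half-length h centred at \<open>ym\<close> and
    \<open>yp\<close> fill exactly the two sides of q, so each carries a single slope.\<close>
  define h where "h = r / 2"
  have h: "0 < h" "h < r" using r by (auto simp: h_def)
  define ym yp where "ym = q + (- h) *\<^sub>R ?\<tau>" and "yp = q + h *\<^sub>R ?\<tau>"
  have fm: "flat ym n h am"
    unfolding flat_def
  proof (intro conjI allI impI ballI)
    show "n \<bullet> z \<le> n \<bullet> ym" if "z \<in> N" for z using sup[OF that] by (simp add: ym_def inner_diff_right)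
    fix t assume t: "\<bar>t\<bar> \<le> h"
    have e: "ym + t *\<^sub>R ?\<tau> = q + (t - h) *\<^sub>R ?\<tau>" by (simp add: ym_def algebra_simps)
    have b: "\<bar>t - h\<bar> \<le> r" using t by (auto simp: h_def abs_if split: if_splits)
    show "ym + t *\<^sub>R ?\<tau> \<in> N" unfolding e by (rule seg[OF b])
    have "\<sigma> ym = \<sigma> q + am * (- h)" unfolding ym_def using val[of "- h"] h by simp
    moreover have "\<sigma> (q + (t - h) *\<^sub>R ?\<tau>) = \<sigma> q + am * (t - h)"
      using val[OF b] t by (cases "t = h") auto
    ultimately show "\<sigma> (ym + t *\<^sub>R ?\<tau>) = \<sigma> ym + am * t" unfolding e by (simp add: algebra_simps)
  qed (use n h in auto)
  have fp: "flat yp n h ap"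
    unfolding flat_def
  proof (intro conjI allI impI ballI)
    show "n \<bullet> z \<le> n \<bullet> yp" if "z \<in> N" for z using sup[OF that] by (simp add: yp_def inner_add_right)
    fix t assume t: "\<bar>t\<bar> \<le> h"
    have e: "yp + t *\<^sub>R ?\<tau> = q + (t + h) *\<^sub>R ?\<tau>" by (simp add: yp_def algebra_simps)
    have b: "\<bar>t + h\<bar> \<le> r" "t + h \<ge> 0" using t by (auto simp: h_def abs_if split: if_splits)
    show "yp + t *\<^sub>R ?\<tau> \<in> N" unfolding e by (rule seg[OF b(1)])
    have "\<sigma> yp = \<sigma> q + ap * h" unfolding yp_def using val[of h] h by simp
    moreover have "\<sigma> (q + (t + h) *\<^sub>R ?\<tau>) = \<sigma> q + ap * (t + h)" using val[OF b(1)] b(2) by simp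
    ultimately show "\<sigma> (yp + t *\<^sub>R ?\<tau>) = \<sigma> yp + ap * t" unfolding e by (simp add: algebra_simps)
  qed (use n h in auto)
  have ymN: "ym \<in> N" unfolding ym_def by (rule seg) (use h in auto)
  have "ym \<notin> interior N"
    using interior_below_support[OF _ n sup, of ym] by (auto simp: ym_def inner_diff_right)
  then have ymf: "ym \<in> frontier N" using ymN by (intro frontierI)
  have ymA: "ym \<notin> A" unfolding ym_def by (rule notA) (use h in auto)
  obtain e where e: "(G \<longlongrightarrow> e) (at ym within interior N)"
    using flat_landing[OF fm] h by (metis abs_zero add.right_neutral divide_pos_pos scaleR_zero_left zero_less_numeral)
  have eE: "e \<in> E" using e ymf ymA by (auto simp: E_def)
  obtain f where f: "\<And>k::nat. f k \<in> interior N - {ym}" "f \<longlonglongrightarrow> ym"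
    using frontier_limit_point[OF ymf] unfolding islimpt_sequential by blast
  define \<zeta> where "\<zeta> = (\<lambda>k. G (f k))"
  have \<zeta>1: "cmod (\<zeta> k) < 1" for k using f(1)[of k] by (simp add: \<zeta>_def G_in)
  have U\<zeta>: "U (\<zeta> k) = f k" for k using f(1)[of k] by (simp add: \<zeta>_def U_G)
  have fat: "filterlim f (at ym within interior N) sequentially"
    using f by (auto simp: filterlim_at intro!: always_eventually)
  have \<zeta>e: "\<zeta> \<longlonglongrightarrow> e" unfolding \<zeta>_def by (rule filterlim_compose[OF e fat])
  have ce: "cmod e = 1" using eE E_sphere by auto
  have to1: "(\<lambda>k. C * (1 - cmod (z k))) \<longlonglongrightarrow> 0" if "z \<longlonglongrightarrow> e" for C z
    using tendsto_mult[OF tendsto_const[of C] tendsto_diff[OF tendsto_const[of 1] tendsto_norm[OF that]]] ce by simp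
  obtain \<rho> p1 p2 where \<rho>: "\<rho> > 0" and pA: "p1 \<in> A" "p2 \<in> A"
    and near: "\<And>x. x \<in> sphere 0 1 - E \<Longrightarrow> dist x e < 2 * \<rho> \<Longrightarrow> ustar x = p1 \<or> ustar x = p2"
    and ex1: "\<And>\<epsilon>. \<epsilon> > 0 \<Longrightarrow> \<exists>x\<in>sphere 0 1 - E. dist x e < \<epsilon> \<and> ustar x = p1"
    and ex2: "\<And>\<epsilon>. \<epsilon> > 0 \<Longrightarrow> \<exists>x\<in>sphere 0 1 - E. dist x e < \<epsilon> \<and> ustar x = p2"
    by (rule ustar_near_exceptional[OF eE]) (rule that)
  have ev\<rho>: "\<forall>\<^sub>F k in sequentially. dist (z k) e < \<rho>" if "z \<longlonglongrightarrow> e" for z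
    using that \<rho> by (rule tendstoD)
  \<comment> \<open>Otherwise a line separates \<open>ym\<close> from both neighbouring values, and
    \<open>local_bound\<close> keeps U near e away from \<open>ym\<close>, although
    \<open>U (\<zeta> k)\<close> tends to it.\<close>
  have ymseg: "ym \<in> closed_segment p1 p2"
  proof (rule ccontr)
    assume "ym \<notin> closed_segment p1 p2"
    then obtain a b where ab: "a \<bullet> ym < b" "\<And>x. x \<in> closed_segment p1 p2 \<Longrightarrow> b < a \<bullet> x"
      using separating_hyperplane_closed_point[OF convex_closed_segment closed_segment, of ym p1 p2] by metis
    have "(- a) \<bullet> ustar x \<le> - b" if "x \<in> sphere 0 1 - E" "dist x e < 2 * \<rho>" for x
      using near[OF that] ab(2)[of "ustar x"] by auto
    then obtain C where C: "\<And>\<zeta>. cmod \<zeta> < 1 \<Longrightarrow> dist \<zeta> e < \<rho> \<Longrightarrow> (- a) \<bullet> U \<zeta> - (- b) \<le> C * (1 - cmod \<zeta>)"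
      using local_bound[OF \<rho>, of e "- a" "- b"] by metis
    have "(- a) \<bullet> ym - (- b) \<le> 0"
    proof (rule tendsto_le[OF sequentially_bot to1[OF \<zeta>e, of C]])
      show "(\<lambda>k. (- a) \<bullet> U (\<zeta> k) - (- b)) \<longlonglongrightarrow> (- a) \<bullet> ym - (- b)"
        unfolding U\<zeta> by (intro tendsto_intros f(2))
      show "\<forall>\<^sub>F k in sequentially. (- a) \<bullet> U (\<zeta> k) - (- b) \<le> C * (1 - cmod (\<zeta> k))"
        using ev\<rho>[OF \<zeta>e] by (rule eventually_mono) (rule C[OF \<zeta>1])
    qed
    then show False using ab(1) by simp
  qed
  then obtain u where u: "0 \<le> u" "u \<le> 1" "ym = (1 - u) *\<^sub>R p1 + u *\<^sub>R p2" by (auto simp: in_segment)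
  have u': "0 < u" "u < 1" using u pA ymA by (cases "u = 0"; cases "u = 1"; auto)+
  have pN: "p1 \<in> N" "p2 \<in> N" using pA A_frontier frontier_N(1) by auto
  have "n \<bullet> ym = (1 - u) * (n \<bullet> p1) + u * (n \<bullet> p2)" by (subst u(3)) (simp add: inner_add_right)
  moreover have "n \<bullet> ym = n \<bullet> q" by (simp add: ym_def inner_diff_right)
  \<comment> \<open>A proper convex combination on a supporting line forces both points onto this
    line.\<close>
  ultimately have "(1 - u) * (n \<bullet> q - n \<bullet> p1) + u * (n \<bullet> q - n \<bullet> p2) = 0" by (simp add: algebra_simps)
  moreover have "(1 - u) * (n \<bullet> q - n \<bullet> p1) \<ge> 0" "u * (n \<bullet> q - n \<bullet> p2) \<ge> 0"
    using u' sup[OF pN(1)] sup[OF pN(2)] by auto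
  ultimately have "(1 - u) * (n \<bullet> q - n \<bullet> p1) = 0" "u * (n \<bullet> q - n \<bullet> p2) = 0" by linarith+
  then have np: "n \<bullet> p1 = n \<bullet> q" "n \<bullet> p2 = n \<bullet> q" using u' by auto
  define s where "s = (\<lambda>p. ?\<tau> \<bullet> (p - q))"
  have ps: "p = q + s p *\<^sub>R ?\<tau>" if "n \<bullet> p = n \<bullet> q" for p
    using frame_expand[OF n, of "p - q"] that by (simp add: s_def inner_diff_right algebra_simps)
  have pq: "p1 \<noteq> q" "p2 \<noteq> q" using ex1[of 1] ex2[of 1] no by auto
  \<comment> \<open>On the line, no point of A other than q is within distance r of q, and q itself
    is excluded by assumption.\<close>
  have big: "\<bar>s p\<bar> > r" if "p \<in> A" "n \<bullet> p = n \<bullet> q" "p \<noteq> q" for p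
  proof (rule ccontr)
    assume le: "\<not> \<bar>s p\<bar> > r"
    have "s p \<noteq> 0" using ps[OF that(2)] that(3) by auto
    then have "q + s p *\<^sub>R ?\<tau> \<notin> A" using le by (intro notA) auto
    then show False using ps[OF that(2)] that(1) by simp
  qed
  have "?\<tau> \<bullet> ym = (1 - u) * (?\<tau> \<bullet> p1) + u * (?\<tau> \<bullet> p2)" by (subst u(3)) (simp add: inner_add_right)
  then have comb: "- h = (1 - u) * s p1 + u * s p2"
    using tn by (simp add: ym_def s_def inner_add_right inner_diff_right algebra_simps)
  \<comment> \<open>If both values lay beyond -r, their average could not be -h; so one of them lies
    beyond r, past q and \<open>yp\<close>.\<close>
  have "\<exists>P. n \<bullet> P = n \<bullet> q \<and> s P > r \<and> (\<forall>\<epsilon>>0. \<exists>x\<in>sphere 0 1 - E. dist x e < \<epsilon> \<and> ustar x = P)"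
  proof (cases "s p1 > r")
    case True then show ?thesis using np ex1 by blast
  next
    case F1: False
    show ?thesis
    proof (cases "s p2 > r")
      case True then show ?thesis using np ex2 by blast
    next
      case False
      then have "s p1 < - r" "s p2 < - r" using F1 big[OF pA(1) np(1) pq(1)] big[OF pA(2) np(2) pq(2)] by auto
      then have "(1 - u) * s p1 \<le> (1 - u) * (- r)" "u * s p2 \<le> u * (- r)" 
        using u' by (intro mult_left_mono; simp)+
      then have "- h \<le> (1 - u) * (- r) + u * (- r)" using comb by linarith
      also have "\<dots> = - r" by (simp add: algebra_simps)
      finally show ?thesis using h by simp
    qed
  qed
  then obtain P where P: "n \<bullet> P = n \<bullet> q" "s P > r" and exP: "\<And>\<epsilon>. \<epsilon> > 0 \<Longrightarrow> \<exists>x\<in>sphere 0 1 - E. dist x e < \<epsilon> \<and> ustar x = P" by blast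
  \<comment> \<open>Arbitrarily close to e, U takes values near \<open>ym\<close> and values near P.
    The tangential coordinate of \<open>yp\<close> lies between theirs and is attained, by
    connectedness.\<close>
  have "\<exists>z. cmod z < 1 \<and> dist z e < inverse (real (Suc k)) \<and> ?\<tau> \<bullet> U z = ?\<tau> \<bullet> q + h" for k
  proof -
    define \<epsilon> where "\<epsilon> = inverse (real (Suc k))"
    have \<epsilon>: "\<epsilon> > 0" by (simp add: \<epsilon>_def)
    define C where "C = ball 0 1 \<inter> ball e \<epsilon>"
    have "connected C" unfolding C_def by (intro convex_connected convex_Int) auto
    then have con: "connected (U ` C)"
      by (rule connected_continuous_image[rotated]) (rule continuous_on_subset[OF cont_U], auto simp: C_def)
    have "(\<lambda>j. ?\<tau> \<bullet> U (\<zeta> j)) \<longlonglongrightarrow> ?\<tau> \<bullet> ym" unfolding U\<zeta> by (intro tendsto_intros f(2))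
    then have "\<forall>\<^sub>F j in sequentially. ?\<tau> \<bullet> U (\<zeta> j) < ?\<tau> \<bullet> q + h"
      by (rule order_tendstoD) (use tn h in \<open>simp add: ym_def inner_diff_right\<close>)
    moreover have "\<forall>\<^sub>F j in sequentially. dist (\<zeta> j) e < \<epsilon>" using \<zeta>e \<epsilon> by (rule tendstoD)
    ultimately have "\<forall>\<^sub>F j in sequentially. ?\<tau> \<bullet> U (\<zeta> j) < ?\<tau> \<bullet> q + h \<and> dist (\<zeta> j) e < \<epsilon>" by eventually_elim auto
    then obtain j where j: "?\<tau> \<bullet> U (\<zeta> j) < ?\<tau> \<bullet> q + h" "dist (\<zeta> j) e < \<epsilon>"
      using eventually_happens'[OF sequentially_bot] by blast
    obtain x where x: "x \<in> sphere 0 1 - E" "dist x e < \<epsilon>" "ustar x = P" using exP[OF \<epsilon>] by blast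
    have "((\<lambda>z. ?\<tau> \<bullet> U z) \<longlongrightarrow> ?\<tau> \<bullet> P) (at x within ball 0 1)"
      using ustar(2)[OF x(1)] unfolding x(3) by (intro tendsto_intros)
    then have "\<forall>\<^sub>F z in at x within ball 0 1. ?\<tau> \<bullet> U z > ?\<tau> \<bullet> q + h"
      by (rule order_tendstoD) (use P(2) h in \<open>simp add: s_def inner_diff_right\<close>)
    moreover have "\<forall>\<^sub>F z in at x within ball 0 1. z \<in> C"
      unfolding eventually_at_topological C_def using x(2) by (intro exI[of _ "ball e \<epsilon>"]) (auto simp: dist_commute)
    ultimately have ev: "\<forall>\<^sub>F z in at x within ball 0 1. ?\<tau> \<bullet> U z > ?\<tau> \<bullet> q + h \<and> z \<in> C" by eventually_elim auto
    have "x islimpt ball 0 1" using x(1) by (simp add: islimpt_ball)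
    then have "at x within ball 0 1 \<noteq> bot" by (simp add: trivial_limit_within)
    then obtain z where z: "?\<tau> \<bullet> U z > ?\<tau> \<bullet> q + h" "z \<in> C" using eventually_happens'[OF _ ev] by blast
    have "\<zeta> j \<in> C" using j(2) \<zeta>1 by (simp add: C_def dist_commute)
    then have "\<exists>v\<in>U ` C. ?\<tau> \<bullet> v = ?\<tau> \<bullet> q + h"
      using connected_ivt_hyperplane[OF con, of "U (\<zeta> j)" "U z" ?\<tau> "?\<tau> \<bullet> q + h"] j z by auto
    then show ?thesis unfolding \<epsilon>_def[symmetric] by (auto simp: C_def dist_commute)
  qed
  then obtain z where z: "\<And>k. cmod (z k) < 1" "\<And>k. dist (z k) e < inverse (real (Suc k))" "\<And>k. ?\<tau> \<bullet> U (z k) = ?\<tau> \<bullet> q + h"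
    by metis
  have "(\<lambda>k. dist (z k) e) \<longlonglongrightarrow> 0"
    by (rule tendsto_sandwich[OF _ _ tendsto_const LIMSEQ_inverse_real_of_nat]) (use z(2) in \<open>auto simp: less_imp_le\<close>)
  then have ze: "z \<longlonglongrightarrow> e" using tendsto_dist_iff by blast
  have near': "n \<bullet> ustar x = n \<bullet> q" if "x \<in> sphere 0 1 - E" "dist x e < 2 * \<rho>" for x
    using near[OF that] np by auto
  obtain C where lip: "\<And>\<zeta> \<zeta>'. cmod \<zeta> < 1 \<Longrightarrow> dist \<zeta> e < \<rho> \<Longrightarrow> cmod \<zeta>' < 1 \<Longrightarrow> dist \<zeta>' e < \<rho> \<Longrightarrow>
     \<bar>grad \<sigma> (U \<zeta>) \<bullet> ?\<tau> - grad \<sigma> (U \<zeta>') \<bullet> ?\<tau>\<bar> \<le> C * cmod (\<zeta> - \<zeta>')"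
    and flatC: "\<And>\<zeta>. cmod \<zeta> < 1 \<Longrightarrow> dist \<zeta> e < \<rho> \<Longrightarrow> n \<bullet> q - n \<bullet> U \<zeta> \<le> C * (1 - cmod \<zeta>)"
    by (rule conjugate_lipschitz[OF n _ \<rho>, of "n \<bullet> q" e]) (erule sup, erule (1) near', rule that)
  \<comment> \<open>The tangential coordinate is that of \<open>yp\<close> by construction and the
    depth is O(1 - |z|); hence U tends to \<open>yp\<close> along z.\<close>
  have "(\<lambda>k. n \<bullet> q - n \<bullet> U (z k)) \<longlonglongrightarrow> 0"
  proof (rule tendsto_sandwich[OF _ _ tendsto_const to1[OF ze, of C]])
    show "\<forall>\<^sub>F k in sequentially. 0 \<le> n \<bullet> q - n \<bullet> U (z k)"
      using sup U_in[OF z(1)] interior_subset by (intro always_eventually) (auto simp: subset_iff)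
    show "\<forall>\<^sub>F k in sequentially. n \<bullet> q - n \<bullet> U (z k) \<le> C * (1 - cmod (z k))"
      using ev\<rho>[OF ze] by (rule eventually_mono) (rule flatC[OF z(1)])
  qed
  then have "(\<lambda>k. yp - (n \<bullet> q - n \<bullet> U (z k)) *\<^sub>R n) \<longlonglongrightarrow> yp - 0 *\<^sub>R n" by (intro tendsto_intros)
  moreover have "yp - (n \<bullet> q - n \<bullet> U (z k)) *\<^sub>R n = U (z k)" for k
    using frame_expand[OF n, of "U (z k) - q"] z(3)[of k] by (simp add: yp_def inner_diff_right algebra_simps)
  ultimately have Uz: "(\<lambda>k. U (z k)) \<longlonglongrightarrow> yp" by simp
  have "yp \<notin> interior N"
    using interior_below_support[OF _ n sup, of yp] by (auto simp: yp_def inner_add_right)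
  then have "filterlim (\<lambda>k. U (z k)) (at yp within interior N) sequentially"
    using Uz U_in[OF z(1)] by (auto simp: filterlim_at intro!: always_eventually)
  from filterlim_compose[OF flat_grad_tangential[OF fp] this]
  have Tz: "(\<lambda>k. grad \<sigma> (U (z k)) \<bullet> ?\<tau>) \<longlonglongrightarrow> ap" .
  have T\<zeta>: "(\<lambda>k. grad \<sigma> (U (\<zeta> k)) \<bullet> ?\<tau>) \<longlonglongrightarrow> am"
    unfolding U\<zeta> by (rule filterlim_compose[OF flat_grad_tangential[OF fm] fat])
  \<comment> \<open>Both sequences tend to e, and the tangential gradient component is Lipschitz
    there, yet its limits along them are the two slopes of L.\<close>
  have "\<bar>am - ap\<bar> \<le> 0"
  proof (rule tendsto_le[OF sequentially_bot])
    show "(\<lambda>k. \<bar>grad \<sigma> (U (\<zeta> k)) \<bullet> ?\<tau> - grad \<sigma> (U (z k)) \<bullet> ?\<tau>\<bar>) \<longlonglongrightarrow> \<bar>am - ap\<bar>"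
      by (intro tendsto_intros Tz T\<zeta>)
    have "(\<lambda>k. C * cmod (\<zeta> k - z k)) \<longlonglongrightarrow> C * cmod (e - e)" by (intro tendsto_intros \<zeta>e ze)
    then show "(\<lambda>k. C * cmod (\<zeta> k - z k)) \<longlonglongrightarrow> 0" by simp
    show "\<forall>\<^sub>F k in sequentially. \<bar>grad \<sigma> (U (\<zeta> k)) \<bullet> ?\<tau> - grad \<sigma> (U (z k)) \<bullet> ?\<tau>\<bar> \<le> C * cmod (\<zeta> k - z k)"
      using ev\<rho>[OF \<zeta>e] ev\<rho>[OF ze] by eventually_elim (intro lip \<zeta>1 z(1))
  qed
  then show False using amp by simp
qed

section \<open>The sum of harmonic measures\<close>

text \<open>Arcs are indexed by their starting points in E. The map from arcs to values is onto A,
  and \<open>card E \<le> card A\<close> then leaves no room for two arcs with the same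
  value.\<close>

lemma ustar_arc_bijection:
  obtains val where "bij_betw val E A" "\<And>e x. e \<in> E \<Longrightarrow> x \<in> next_arc E e \<Longrightarrow> ustar x = val e"
proof -
  note cover = next_arc_cover[OF card_E(1) E_sphere card_E(3)]
  have "ustar constant_on next_arc E e" if "e \<in> E" for e
    by (rule ustar_constant[OF connected_next_arc]) (use cover that in blast)
  then obtain val where val: "\<And>e x. e \<in> E \<Longrightarrow> x \<in> next_arc E e \<Longrightarrow> ustar x = val e"
    unfolding constant_on_def by metis
  have im: "val ` E = A"
  proof (intro equalityI subsetI)
    fix p assume "p \<in> val ` E"
    then obtain e where e: "e \<in> E" "p = val e" by auto
    obtain x where x: "x \<in> next_arc E e" using next_arc_nonempty[OF card_E(1) E_sphere e(1)] by auto
    then have "x \<in> sphere 0 1 - E" using cover e(1) by blast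
    then show "p \<in> A" using ustar(1)[of x] val[OF e(1) x] e(2) by simp
  next
    fix p assume "p \<in> A"
    then have "\<exists>x\<in>sphere 0 1 - E. ustar x = p"
      using ustar_attains_corner ustar_attains_kink by (auto simp: A_def)
    then obtain x where x: "x \<in> sphere 0 1 - E" "ustar x = p" by blast
    then obtain e where "e \<in> E" "x \<in> next_arc E e" using cover by blast
    then show "p \<in> val ` E" using val x(2) by (metis imageI)
  qed
  have "card (val ` E) = card E"
    using card_E(2) card_image_le[OF card_E(1), of val] unfolding im by simp
  then have "inj_on val E" by (rule eq_card_imp_inj_on[OF card_E(1)])
  then have "bij_betw val E A" using im by (simp add: bij_betw_def)
  then show thesis using that val by blast
qed

lemma U_sum_harmonic_measures:
  assumes p: "inj_on p {1..m::nat}" "p ` {1..m} = A"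
  shows "\<exists>a b :: nat \<Rightarrow> real.
         (\<forall>j\<in>{1..m}. a j < b j \<and> b j \<le> a j + 2 * pi) \<and>
         (\<forall>j\<in>{1..m}. \<forall>k\<in>{1..m}. j \<noteq> k \<longrightarrow> open_arc (a j) (b j) \<inter> open_arc (a k) (b k) = {}) \<and>
         (\<Union>j\<in>{1..m}. closure (open_arc (a j) (b j))) = sphere 0 1 \<and>
         (\<forall>\<zeta>\<in>ball 0 1. U \<zeta> =
             (\<Sum>j=1..m. p j * complex_of_real (harmonic_measure_disc \<zeta> (open_arc (a j) (b j)))))"
proof -
  obtain val where bij: "bij_betw val E A" and val: "\<And>e x. e \<in> E \<Longrightarrow> x \<in> next_arc E e \<Longrightarrow> ustar x = val e"
    using ustar_arc_bijection by metis
  \<comment> \<open>The starting point of the arc on which the boundary value is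
    \<open>p j\<close>.\<close>
  define \<epsilon> where "\<epsilon> = (\<lambda>j. inv_into E val (p j))"
  have "bij_betw p {1..m} A" using p by (simp add: bij_betw_def)
  then have bije: "bij_betw \<epsilon> {1..m} E"
    using bij_betw_trans[OF _ bij_betw_inv_into[OF bij]] unfolding \<epsilon>_def o_def by blast
  have eE: "\<epsilon> j \<in> E" if "j \<in> {1..m}" for j using bije that by (auto simp: bij_betw_def)
  have ve: "val (\<epsilon> j) = p j" if "j \<in> {1..m}" for j
    unfolding \<epsilon>_def using bij p(2) that by (intro f_inv_into_f) (auto simp: bij_betw_def)
  note cover = next_arc_cover[OF card_E(1) E_sphere card_E(3)]
  define a b where "a = (\<lambda>j. Arg (\<epsilon> j))" and "b = (\<lambda>j. next_angle E (\<epsilon> j))"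
  have arc: "open_arc (a j) (b j) = next_arc E (\<epsilon> j)" for j by (simp add: a_def b_def next_arc_def)
  have Un: "(\<Union>j\<in>{1..m}. open_arc (a j) (b j)) = sphere 0 1 - E"

  proof -
    have "(\<Union>j\<in>{1..m}. next_arc E (\<epsilon> j)) = (\<Union>e\<in>\<epsilon> ` {1..m}. next_arc E e)" by simp
    then show ?thesis unfolding arc bij_betw_imp_surj_on[OF bije] cover .
  qed
  have disj: "open_arc (a j) (b j) \<inter> open_arc (a k) (b k) = {}" if jk: "j \<in> {1..m}" "k \<in> {1..m}" "j \<noteq> k" for j k
    unfolding arc
  proof (rule next_arc_disjoint[OF card_E(1) E_sphere eE[OF jk(1)] eE[OF jk(2)]])
    show "\<epsilon> j \<noteq> \<epsilon> k" using inj_on_eq_iff[OF bij_betw_imp_inj_on[OF bije] jk(1,2)] jk(3) by simp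
  qed
  have rep: "U \<zeta> = (\<Sum>j=1..m. p j * complex_of_real (harmonic_measure_disc \<zeta> (open_arc (a j) (b j))))"
    if "\<zeta> \<in> ball 0 1" for \<zeta>
  proof -
    have z: "cmod \<zeta> < 1" using that by simp
    let ?I = "\<lambda>j. open_arc (a j) (b j)"
    have hm: "((\<lambda>t. indicator (?I j) (cis t) * poisson_kernel \<zeta> t) has_integral (2 * pi * harmonic_measure_disc \<zeta> (?I j))) {0..2*pi}" for j
      using integrable_integral[OF open_arc_integrable[OF z, of "a j" "b j"]]
      by (simp add: harmonic_measure_disc_def poisson_kernel_def)
    have "((\<lambda>t. \<Sum>j=1..m. p j * of_real (indicator (?I j) (cis t) * poisson_kernel \<zeta> t)) has_integral
        (\<Sum>j=1..m. p j * of_real (2 * pi * harmonic_measure_disc \<zeta> (?I j)))) {0..2*pi}"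
      by (intro has_integral_sum has_integral_mult_right has_integral_of_real hm) simp
    moreover have "((\<lambda>t. \<Sum>j=1..m. p j * of_real (indicator (?I j) (cis t) * poisson_kernel \<zeta> t)) has_integral
        (2 * of_real pi * U \<zeta>)) {0..2*pi}"
    proof (rule has_integral_spike_finite[OF finite_cis_vimage[OF card_E(1), of 0] _ U_representation[OF z]])
      fix t assume "t \<in> {0..2*pi} - {t \<in> {0..0 + 2 * pi}. cis t \<in> E}"
      then have "cis t \<in> sphere 0 1 - E" by auto
      then obtain k where k: "k \<in> {1..m}" "cis t \<in> ?I k" using Un by blast
      \<comment> \<open>Off E exactly one arc contains \<open>cis t\<close>, so the sum of
        indicators reduces to the boundary value there.\<close>
      have "(\<Sum>j=1..m. p j * of_real (indicator (?I j) (cis t) * poisson_kernel \<zeta> t)) =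
         (\<Sum>j=1..m. if j = k then p k * of_real (poisson_kernel \<zeta> t) else 0)"
      proof (rule sum.cong[OF refl])
        fix j assume j: "j \<in> {1..m}"
        show "p j * of_real (indicator (?I j) (cis t) * poisson_kernel \<zeta> t) = (if j = k then p k * of_real (poisson_kernel \<zeta> t) else 0)"
          using disj[OF j k(1)] k(2) by (auto simp: indicator_def)
      qed
      also have "\<dots> = p k * of_real (poisson_kernel \<zeta> t)" using k(1) by simp
      also have "p k = ustar (cis t)" using val[OF eE[OF k(1)], of "cis t"] k(2) ve[OF k(1)] by (simp add: arc)
      finally show "(\<Sum>j=1..m. p j * of_real (indicator (?I j) (cis t) * poisson_kernel \<zeta> t)) = ustar (cis t) * of_real (poisson_kernel \<zeta> t)" .
    qed
    ultimately have "2 * of_real pi * U \<zeta> = (\<Sum>j=1..m. p j * of_real (2 * pi * harmonic_measure_disc \<zeta> (?I j)))"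
      using has_integral_unique by blast
    also have "\<dots> = 2 * of_real pi * (\<Sum>j=1..m. p j * of_real (harmonic_measure_disc \<zeta> (?I j)))"
      by (simp add: sum_distrib_left mult_ac)
    finally show ?thesis by simp
  qed
  have "(\<Union>j\<in>{1..m}. closure (open_arc (a j) (b j))) = closure (\<Union>j\<in>{1..m}. open_arc (a j) (b j))"
  proof
    show "(\<Union>j\<in>{1..m}. closure (open_arc (a j) (b j))) \<subseteq> closure (\<Union>j\<in>{1..m}. open_arc (a j) (b j))"
      by (intro UN_least closure_mono) blast
    show "closure (\<Union>j\<in>{1..m}. open_arc (a j) (b j)) \<subseteq> (\<Union>j\<in>{1..m}. closure (open_arc (a j) (b j)))"
    proof (rule closure_minimal)
      show "(\<Union>j\<in>{1..m}. open_arc (a j) (b j)) \<subseteq> (\<Union>j\<in>{1..m}. closure (open_arc (a j) (b j)))"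
        by (intro UN_mono closure_subset subset_refl)
    qed (intro closed_UN; simp)
  qed
  then have clos: "(\<Union>j\<in>{1..m}. closure (open_arc (a j) (b j))) = sphere 0 1"
    unfolding Un by (simp add: closure_sphere_minus_finite[OF card_E(1)])
  have ab: "a j < b j \<and> b j \<le> a j + 2 * pi" if "j \<in> {1..m}" for j
    unfolding a_def b_def using next_angle(1,2)[OF card_E(1) E_sphere eE[OF that]] by blast
  show ?thesis
  proof (rule exI[of _ a], rule exI[of _ b], intro conjI)
    show "\<forall>j\<in>{1..m}. a j < b j \<and> b j \<le> a j + 2 * pi" by (rule ballI) (rule ab)
    show "\<forall>j\<in>{1..m}. \<forall>k\<in>{1..m}. j \<noteq> k \<longrightarrow> open_arc (a j) (b j) \<inter> open_arc (a k) (b k) = {}"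
      by (intro ballI impI disj)
    show "\<forall>\<zeta>\<in>ball 0 1. U \<zeta> = (\<Sum>j=1..m. p j * complex_of_real (harmonic_measure_disc \<zeta> (open_arc (a j) (b j))))"
      by (rule ballI) (rule rep)
  qed (rule clos)
qed

end

theorem mainTheorem12:
  fixes N :: "complex set" and L \<sigma> :: "complex \<Rightarrow> real"
    and p :: "nat \<Rightarrow> complex" and m :: nat and \<psi> :: "complex \<Rightarrow> complex"
  assumes "convex_polygon N"
    and "admissible_boundary N L"
    and "surface_tension N L \<sigma>"
    and "ccw_listing N p m (corners N \<union> nondiff_points N L)"
    and "\<psi> holomorphic_on ball 0 1"
    and "bij_betw \<psi> (ball 0 1) (lewy \<sigma> ` interior N)"
  shows "harmonic_on (ball 0 1) (\<lambda>\<zeta>. inv_into (interior N) (lewy \<sigma>) (\<psi> \<zeta>))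
    \<and> (\<exists>g. homeomorphism (ball 0 1) (interior N) (\<lambda>\<zeta>. inv_into (interior N) (lewy \<sigma>) (\<psi> \<zeta>)) g)
    \<and> (\<exists>a b :: nat \<Rightarrow> real.
         (\<forall>j\<in>{1..m}. a j < b j \<and> b j \<le> a j + 2 * pi) \<and>
         (\<forall>j\<in>{1..m}. \<forall>k\<in>{1..m}. j \<noteq> k \<longrightarrow> open_arc (a j) (b j) \<inter> open_arc (a k) (b k) = {}) \<and>
         (\<Union>j\<in>{1..m}. closure (open_arc (a j) (b j))) = sphere 0 1 \<and>
         (\<forall>\<zeta>\<in>ball 0 1. inv_into (interior N) (lewy \<sigma>) (\<psi> \<zeta>) =
             (\<Sum>j=1..m. p j * complex_of_real (harmonic_measure_disc \<zeta> (open_arc (a j) (b j))))))"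
proof -
  have p: "inj_on p {1..m}" "p ` {1..m} = corners N \<union> nondiff_points N L"
    using assms(4) by (auto simp: ccw_listing_def)
  \<comment> \<open>Finiteness of the set of corners and kinks comes from the listing p.\<close>
  interpret tension_bdry N \<sigma> \<psi> L "corners N \<union> nondiff_points N L"
  proof unfold_locales
    show "convex N" "compact N" "interior N \<noteq> {}"
      using assms(1) by (auto simp: convex_polygon_def polytope_imp_convex polytope_imp_compact)
    show "convex_on N \<sigma>" "continuous_on N \<sigma>" "C2_on (interior N) \<sigma>"
      using assms(3) by (auto simp: surface_tension_def)
    show "hess_det \<sigma> z = 1" if "z \<in> interior N" for z using assms(3) that by (auto simp: surface_tension_def)
    show "\<sigma> x = L x" if "x \<in> frontier N" for x using assms(3) that by (auto simp: surface_tension_def)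
    show "piecewise_affine_boundary N L" using assms(2) by (simp add: admissible_boundary_def)
    show "finite (corners N \<union> nondiff_points N L)" using p(2) by (metis finite_atLeastAtMost finite_imageI)
  qed (use assms(5,6) in auto)
  have U_eq: "(\<lambda>\<zeta>. inv_into (interior N) (lewy \<sigma>) (\<psi> \<zeta>)) = U"
    by (simp add: U_def[abs_def] lewy_inv_def)
  show ?thesis
    unfolding U_eq fun_cong[OF U_eq]
    by (intro conjI exI[of _ G] harmonic_U homeomorphism_U U_sum_harmonic_measures[OF p])
qed

end
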